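(* Let $u\in S^{2,2}(B_R)$, with $|u|\le K_0$ for some $K_0>0$, be a solution in $B_R$ of $$-\mathscr{B}_\gamma u=V(z,t)\,u ,$$ where $V$ satisfies the bound $$|V(z,t)|\le K\,\psi(z,t).$$ Then there exist $R_0\in(0,R/2]$ depending on $m,k,\gamma$, and constants $C_1,C_2>0$ depending on $m,k,\gamma,K_0$ and $\int_{B_{R_0/4}}u^2\psi$, such that for all $0<r<\frac{R_0}{9}$ one has $$\|u\|_{L^\infty(B_r)}\ge C_1\left(\frac{r}{R_0}\right)^{C_2(K^{2/3}+1)}.$$
   Context: Let $m,k\ge 1$ be integers, $\gamma>0$, $N=m+k$, and write points of $\mathbb{R}^N$ as $(z,t)$ with $z\in\mathbb{R}^m$, $t\in\mathbb{R}^k$. Here $R>0$ and $K\ge 0$ are constants. Integrals are with respect to Lebesgue measure $dz\,dt$. Vector fields: $X_i=\partial_{z_i}$ for $i=1,\dots,m$, and $X_{m+j}=|z|^\gamma\partial_{t_j}$ for $j=1,\dots,k$. The Baouendi-Grushin operator is $\mathscr{B}_\gamma u=\sum_{i=1}^N X_i^2u=\Delta_z u+|z|^{2\gamma}\Delta_t u$. Also $Xu=(X_1u,\dots,X_Nu)$ and $|Xu|^2=\sum_{i=1}^N (X_iu)^2$. Pseudo-gauge: $\rho(z,t)=\left(|z|^{2(\gamma+1)}+(\gamma+1)^2|t|^2\right)^{\frac{1}{2(\gamma+1)}}$, and $B_r=\{(z,t)\in\mathbb{R}^N:\rho(z,t)<r\}$. Angle function: $\psi=|X\rho|^2=|z|^{2\gamma}/\rho^{2\gamma}$,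 so $0\le\psi\le1$. For an open set $\Omega\subset\mathbb{R}^N$, $S^{2,2}(\Omega)$ is the completion of $C^\infty(\overline\Omega)$ with respect to the norm $\left(\int_\Omega f^2+|Xf|^2+\sum_{i,j=1}^N|X_iX_jf|^2\right)^{1/2}$.
   Formalization: The integral of u²ψ over B_{R_0/4} is required to be positive; without this the claim fails, for instance for u = 0. *)

theory Defs
  imports "HOL-Probability.Essential_Supremum"
begin

text \<open>Points of \<open>\<real>\<^sup>N\<close>, \<open>N = m + k\<close>, are pairs \<open>(z, t)\<close> with \<open>m = CARD('m)\<close> and
  \<open>k = CARD('k)\<close>; the \<open>N\<close> vector fields are indexed by the sum type \<open>'m + 'k\<close>.\<close>

type_synonym ('m, 'k) pt = "(real ^ 'm) \<times> (real ^ 'k)"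

section \<open>Vector fields, gauge, angle function\<close>

text \<open>Partial derivatives are taken pointwise. On \<open>z = 0\<close>, a null set, iterated
  derivatives \<open>X\<^sub>i X\<^sub>j f\<close> of a smooth \<open>f\<close> may fail to exist, and then \<^const>\<open>deriv\<close> is arbitrary.\<close>

fun X :: "real \<Rightarrow> 'm + 'k \<Rightarrow> (('m::finite, 'k::finite) pt \<Rightarrow> real) \<Rightarrow> ('m, 'k) pt \<Rightarrow> real" where
  "X \<gamma> (Inl i) f (z, t) = deriv (\<lambda>s. f (z + s *\<^sub>R axis i 1, t)) 0"
| "X \<gamma> (Inr j) f (z, t) = norm z powr \<gamma> * deriv (\<lambda>s. f (z, t + s *\<^sub>R axis j 1)) 0"

definition Grushin :: "real \<Rightarrow> (('m::finite, 'k::finite) pt \<Rightarrow> real) \<Rightarrow> ('m, 'k) pt \<Rightarrow> real" where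
  "Grushin \<gamma> f p = (\<Sum>i\<in>UNIV. X \<gamma> i (X \<gamma> i f) p)"

fun pseudo_gauge :: "real \<Rightarrow> ('m::finite, 'k::finite) pt \<Rightarrow> real" where
  "pseudo_gauge \<gamma> (z, t) =
     (norm z powr (2 * (\<gamma> + 1)) + (\<gamma> + 1)\<^sup>2 * (norm t)\<^sup>2) powr (1 / (2 * (\<gamma> + 1)))"

definition gauge_ball :: "real \<Rightarrow> real \<Rightarrow> ('m::finite, 'k::finite) pt set" where
  "gauge_ball \<gamma> r = {p. pseudo_gauge \<gamma> p < r}"

fun angle :: "real \<Rightarrow> ('m::finite, 'k::finite) pt \<Rightarrow> real" where
  "angle \<gamma> (z, t) = norm z powr (2 * \<gamma>) / pseudo_gauge \<gamma> (z, t) powr (2 * \<gamma>)"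

lemma norm_sq_add_axis:
  fixes z :: "real ^ 'n::finite"
  shows "(norm (z + s *\<^sub>R axis i 1))\<^sup>2 = (norm z)\<^sup>2 + 2 * s * z $ i + s\<^sup>2"
  unfolding power2_norm_eq_inner
  by (simp add: inner_add_left inner_add_right inner_axis inner_axis' algebra_simps
      power2_eq_square)

lemma norm_sq_sum: "(norm z)\<^sup>2 = (\<Sum>i\<in>UNIV. (z $ i)\<^sup>2)" for z :: "real ^ 'n::finite"
  unfolding power2_norm_eq_inner by (simp add: inner_vec_def power2_eq_square)

text \<open>The formula defining \<^const>\<open>angle\<close> is \<open>|X \<rho>|\<^sup>2\<close>.\<close>

lemma angle_eq_norm_X_gauge:
  fixes z :: "real ^ 'm::finite" and t :: "real ^ 'k::finite"
  assumes "\<gamma> > 0" and z: "z \<noteq> 0"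
  shows "angle \<gamma> (z, t) = (\<Sum>i\<in>UNIV. (X \<gamma> i (pseudo_gauge \<gamma>) (z, t))\<^sup>2)"
proof -
  define A where "A = norm z powr (2 * (\<gamma> + 1)) + (\<gamma> + 1)\<^sup>2 * (norm t)\<^sup>2"
  define e where "e = 1 / (2 * (\<gamma> + 1))"
  define q where "q = (norm z)\<^sup>2"
  have q: "q > 0" using z by (simp add: q_def)
  have np: "norm x powr (2 * a) = (norm x)\<^sup>2 powr a" if "x \<noteq> 0" for a and x :: "real ^ 'n"
    using that by (metis norm_ge_zero powr_powr powr_numeral zero_less_norm_iff order_less_imp_le)
  have npa: "norm x powr (2 * a) = (norm x)\<^sup>2 powr a" for a and x :: "real ^ 'm"
    by (cases "x = 0") (auto simp: np powr_powr [symmetric] simp flip: powr_numeral)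
  have Aq: "A = q powr (\<gamma> + 1) + (\<gamma> + 1)\<^sup>2 * (norm t)\<^sup>2" by (simp only: A_def npa q_def)
  have A: "A > 0" unfolding Aq using q by (simp add: add_pos_nonneg)
  have e: "e * (2 * (\<gamma> + 1)) = 1" using assms by (simp add: e_def)
  have Xl: "X \<gamma> (Inl i) (pseudo_gauge \<gamma>) (z, t) = A powr (e - 1) * q powr \<gamma> * z $ i" for i
  proof -
    have d: "((\<lambda>s. q + 2 * s * z $ i + s\<^sup>2) has_real_derivative 2 * z $ i) (at 0)"
      by (auto intro!: derivative_eq_intros)
    have d': "((\<lambda>s. (q + 2 * s * z $ i + s\<^sup>2) powr (\<gamma> + 1) + (\<gamma> + 1)\<^sup>2 * (norm t)\<^sup>2)
       has_real_derivative (\<gamma> + 1) * q powr \<gamma> * (2 * z $ i)) (at 0)"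
      using DERIV_add[OF DERIV_fun_powr[OF d, of "\<gamma> + 1"] DERIV_const] q by simp
    have "((\<lambda>s. ((q + 2 * s * z $ i + s\<^sup>2) powr (\<gamma> + 1) + (\<gamma> + 1)\<^sup>2 * (norm t)\<^sup>2) powr e)
       has_real_derivative e * A powr (e - 1) * ((\<gamma> + 1) * q powr \<gamma> * (2 * z $ i))) (at 0)"
      using DERIV_fun_powr[OF d', of e] A by (simp add: Aq)
    also have "e * A powr (e - 1) * ((\<gamma> + 1) * q powr \<gamma> * (2 * z $ i))
        = (e * (2 * (\<gamma> + 1))) * (A powr (e - 1) * q powr \<gamma> * z $ i)" by (simp add: mult_ac)
    finally show ?thesis
      by (simp add: npa norm_sq_add_axis DERIV_imp_deriv e del: distrib_left_numeral flip: q_def e_def)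
  qed
  have Xr: "X \<gamma> (Inr j) (pseudo_gauge \<gamma>) (z, t)
      = norm z powr \<gamma> * (A powr (e - 1) * (\<gamma> + 1) * t $ j)" for j
  proof -
    have d: "((\<lambda>s. q powr (\<gamma> + 1) + (\<gamma> + 1)\<^sup>2 * ((norm t)\<^sup>2 + 2 * s * t $ j + s\<^sup>2))
       has_real_derivative (\<gamma> + 1)\<^sup>2 * (2 * t $ j)) (at 0)"
      by (auto intro!: derivative_eq_intros)
    have "((\<lambda>s. (q powr (\<gamma> + 1) + (\<gamma> + 1)\<^sup>2 * ((norm t)\<^sup>2 + 2 * s * t $ j + s\<^sup>2)) powr e)
       has_real_derivative e * A powr (e - 1) * ((\<gamma> + 1)\<^sup>2 * (2 * t $ j))) (at 0)"
      using DERIV_fun_powr[OF d, of e] A by (simp add: Aq)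
    also have "e * A powr (e - 1) * ((\<gamma> + 1)\<^sup>2 * (2 * t $ j))
        = (e * (2 * (\<gamma> + 1))) * (A powr (e - 1) * (\<gamma> + 1) * t $ j)"
      by (simp only: mult_ac power2_eq_square)
    finally show ?thesis
      by (simp add: npa norm_sq_add_axis DERIV_imp_deriv e del: distrib_left_numeral flip: q_def e_def)
  qed
  have zg: "norm z powr \<gamma> * norm z powr \<gamma> = q powr \<gamma>"
    by (simp add: q_def npa[symmetric] flip: powr_add)
  have "(\<Sum>i\<in>UNIV. (X \<gamma> i (pseudo_gauge \<gamma>) (z, t))\<^sup>2)
      = (\<Sum>i\<in>UNIV. (A powr (e - 1) * q powr \<gamma> * z $ i)\<^sup>2)
        + (\<Sum>j\<in>UNIV. (norm z powr \<gamma> * (A powr (e - 1) * (\<gamma> + 1) * t $ j))\<^sup>2)"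
    by (simp add: UNIV_Plus_UNIV[symmetric] sum.Plus Xl Xr del: UNIV_Plus_UNIV X.simps)
  also have "\<dots> = (A powr (e - 1))\<^sup>2 * (q powr \<gamma>)\<^sup>2 * q
        + (A powr (e - 1))\<^sup>2 * (norm z powr \<gamma> * norm z powr \<gamma>) * ((\<gamma> + 1)\<^sup>2 * (norm t)\<^sup>2)"
    unfolding q_def norm_sq_sum sum_distrib_left power_mult_distrib
    by (simp add: power2_eq_square mult_ac)
  also have "\<dots> = (A powr (e - 1))\<^sup>2 * q powr \<gamma> * A"
    unfolding zg using q by (simp add: Aq powr_add power2_eq_square algebra_simps)
  also have "\<dots> = q powr \<gamma> * A powr (2 * e - 1)"
  proof -
    have "(A powr (e - 1))\<^sup>2 * A = A powr (e - 1) * A powr (e - 1) * A powr 1"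
      using A by (simp add: power2_eq_square)
    also have "\<dots> = A powr (2 * e - 1)"
      unfolding powr_add[symmetric] by (rule arg_cong[of _ _ "(powr) A"]) simp
    finally show ?thesis by (simp add: mult_ac)
  qed
  also have "\<dots> = q powr \<gamma> / A powr (e * (2 * \<gamma>))"
  proof -
    have "e * (2 * \<gamma>) = 1 - 2 * e" using e by (simp add: algebra_simps)
    then show ?thesis using A by (simp add: powr_diff)
  qed
  also have "\<dots> = angle \<gamma> (z, t)"
    by (simp add: npa q_def A_def powr_powr flip: e_def del: distrib_left_numeral)
  finally show ?thesis by simp
qed

section \<open>The space \<open>S\<^sup>2\<^sup>,\<^sup>2\<close> and solutions\<close>

primrec Ck :: "nat \<Rightarrow> ('a::euclidean_space \<Rightarrow> real) \<Rightarrow> bool" where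
  "Ck 0 f \<longleftrightarrow> continuous_on UNIV f"
| "Ck (Suc n) f \<longleftrightarrow> (\<forall>x. f differentiable (at x)) \<and>
     (\<forall>b\<in>Basis. Ck n (\<lambda>x. frechet_derivative f (at x) b))"

definition smooth :: "('a::euclidean_space \<Rightarrow> real) \<Rightarrow> bool" where
  "smooth f \<longleftrightarrow> (\<forall>n. Ck n f)"

definition square_integrable :: "'a::euclidean_space set \<Rightarrow> ('a \<Rightarrow> real) \<Rightarrow> bool" where
  "square_integrable \<Omega> f \<longleftrightarrow>
     f \<in> borel_measurable (lebesgue_on \<Omega>) \<and> integrable (lebesgue_on \<Omega>) (\<lambda>p. (f p)\<^sup>2)"

definition L2_tendsto ::
    "'a::euclidean_space set \<Rightarrow> (nat \<Rightarrow> 'a \<Rightarrow> real) \<Rightarrow> ('a \<Rightarrow> real) \<Rightarrow> bool" where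
  "L2_tendsto \<Omega> f g \<longleftrightarrow>
     (\<forall>n. square_integrable \<Omega> (f n)) \<and> square_integrable \<Omega> g \<and>
     (\<lambda>n. LINT p|lebesgue_on \<Omega>. (f n p - g p)\<^sup>2) \<longlonglongrightarrow> 0"

definition S22_density ::
    "real \<Rightarrow> (('m::finite, 'k::finite) pt \<Rightarrow> real) \<Rightarrow> ('m, 'k) pt \<Rightarrow> real" where
  "S22_density \<gamma> f p = (f p)\<^sup>2 + (\<Sum>i\<in>UNIV. (X \<gamma> i f p)\<^sup>2)
     + (\<Sum>i\<in>UNIV. \<Sum>j\<in>UNIV. (X \<gamma> i (X \<gamma> j f) p)\<^sup>2)"

definition S22_norm ::
    "real \<Rightarrow> ('m::finite, 'k::finite) pt set \<Rightarrow> (('m, 'k) pt \<Rightarrow> real) \<Rightarrow> real" where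
  "S22_norm \<gamma> \<Omega> f = sqrt (LINT p|lebesgue_on \<Omega>. S22_density \<gamma> f p)"

text \<open>\<open>C\<^sup>\<infinity>\<close> of the closure of \<open>\<Omega>\<close> is taken to be the restrictions of smooth functions on the
  whole space. Finiteness of the norm has to be required: for \<open>m = 1\<close> and \<open>\<gamma> \<le> 1/2\<close> the derivative
  of \<open>|z|\<^sup>\<gamma>\<close> in \<open>X\<^sub>i X\<^sub>j f\<close> is not locally square integrable.\<close>

definition S22_smooth ::
    "real \<Rightarrow> ('m::finite, 'k::finite) pt set \<Rightarrow> (('m, 'k) pt \<Rightarrow> real) set" where
  "S22_smooth \<gamma> \<Omega> = {f. smooth f \<and> integrable (lebesgue_on \<Omega>) (S22_density \<gamma> f)}"

text \<open>The operators \<open>X\<^sub>i\<close> and \<open>X\<^sub>i X\<^sub>j\<close> are closable in \<open>L\<^sup>2(\<Omega>)\<close>, so the completion embeds into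
  \<open>L\<^sup>2(\<Omega>)\<close>: a point of it is given by the \<open>L\<^sup>2\<close> limit of a Cauchy sequence, and members of
  the set below are representatives of such limits.\<close>

definition S22_approx ::
    "real \<Rightarrow> ('m::finite, 'k::finite) pt set \<Rightarrow> (nat \<Rightarrow> ('m, 'k) pt \<Rightarrow> real) \<Rightarrow>
     (('m, 'k) pt \<Rightarrow> real) \<Rightarrow> bool" where
  "S22_approx \<gamma> \<Omega> f u \<longleftrightarrow>
     (\<forall>n. f n \<in> S22_smooth \<gamma> \<Omega>) \<and>
     (\<forall>\<epsilon>>0. \<exists>M. \<forall>n\<ge>M. \<forall>l\<ge>M. S22_norm \<gamma> \<Omega> (\<lambda>p. f n p - f l p) < \<epsilon>) \<and>
     L2_tendsto \<Omega> f u"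

definition S22 :: "real \<Rightarrow> ('m::finite, 'k::finite) pt set \<Rightarrow> (('m, 'k) pt \<Rightarrow> real) set" where
  "S22 \<gamma> \<Omega> = {u. \<exists>f. S22_approx \<gamma> \<Omega> f u}"

text \<open>The extension by continuity of the operator from smooth functions to the completion:
  \<open>g\<close> is (a representative of) the \<open>L\<^sup>2\<close> function obtained by applying it to \<open>u\<close>.\<close>

definition has_Grushin ::
    "real \<Rightarrow> ('m::finite, 'k::finite) pt set \<Rightarrow> (('m, 'k) pt \<Rightarrow> real) \<Rightarrow>
     (('m, 'k) pt \<Rightarrow> real) \<Rightarrow> bool" where
  "has_Grushin \<gamma> \<Omega> u g \<longleftrightarrow>
     (\<exists>f. S22_approx \<gamma> \<Omega> f u \<and> L2_tendsto \<Omega> (\<lambda>n. Grushin \<gamma> (f n)) g)"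

definition is_solution ::
    "real \<Rightarrow> ('m::finite, 'k::finite) pt set \<Rightarrow> (('m, 'k) pt \<Rightarrow> real) \<Rightarrow>
     (('m, 'k) pt \<Rightarrow> real) \<Rightarrow> bool" where
  "is_solution \<gamma> \<Omega> V u \<longleftrightarrow>
     (\<exists>g. has_Grushin \<gamma> \<Omega> u g \<and> (AE p in lebesgue_on \<Omega>. - g p = V p * u p))"

definition Linf_norm :: "'a::euclidean_space set \<Rightarrow> ('a \<Rightarrow> real) \<Rightarrow> ereal" where
  "Linf_norm \<Omega> u = esssup (lebesgue_on \<Omega>) (\<lambda>p. ereal \<bar>u p\<bar>)"

end

(*
The proof is a Carleman estimate in logarithmic polar coordinates. With s = ln rho, the measure
psi / rho^2 dz dt and the generator Z of the dilations play the roles of the cylinder measure and of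
the derivative in s. A Rellich-type multiplier 2 b (Z h + (q - b) h) + b' h, with the weight
b = alpha (1 - e^(s - s0) / 2), gives the lower bound alpha e^(s - s0) (b^2 - 1/4) ~ alpha^3 for the
zero order term. The potential contributes K^2 rho^4, so it is absorbed once alpha ~ K^(2/3) + 1. The
terms coming from the cutoffs live near rho = r and rho = R0; the latter are beaten by the weight,
and the former would have to be too small if u were smaller than (r / R0)^C on B_r.

The estimate needs the derivatives of u in t, which S22 controls only with the weight |z|^gamma. The
approximating smooth functions are therefore first averaged over finitely many small translates in t,
which commute with the operator.
*)
theory Submission
  imports Defs
begin

section \<open>Directional derivatives\<close>

text \<open>Two facts carry the geometry: the degenerate gradient of ln \<rho> is \<open>mm\<close>
  times the generator Z of the dilations (\<open>wgt_slg\<close>), and Z ln \<rho> = 1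
  (\<open>sum_slg\<close>). Radial weights therefore meet the gradient of h only through Z h, and no
  angular coordinates are needed. The multiplier is the skew part of the conjugated operator: for w
  = \<open>EE\<close>^(1/2) \<rho>^\<open>qq\<close> h it is 2 b Z w + b' w, whence the shift q - b.
  A constant b would give no zero order term: the gain is -2 b' (b^2 - 1/4). Gradient terms from the
  cutoffs are absorbed by a Caccioppoli identity with a weight \<open>zeta\<close> that dominates
  them. All weights live on shells away from the origin, so no decay of u there is asked for. In the
  averaging, the order of choices matters: first the length of the translates, then the
  approximating function, last the fineness of the grid; the bound on the t-derivatives does not
  depend on the last two. The bound on V survives because |z| is invariant under translations in t;
  the other factors are moved back onto a continuous weight.\<close>

definition has_dd :: "'a::real_normed_vector \<Rightarrow> ('a \<Rightarrow> real) \<Rightarrow> ('a \<Rightarrow> real) \<Rightarrow> bool" where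
  "has_dd e f f' \<longleftrightarrow> (\<forall>p. ((\<lambda>r. f (p + r *\<^sub>R e)) has_real_derivative f' p) (at 0))"

lemma has_ddD: "has_dd e f f' \<Longrightarrow> ((\<lambda>r. f (p + r *\<^sub>R e)) has_real_derivative f' p) (at 0)"
  by (auto simp: has_dd_def)

lemma has_dd_line:
  assumes "has_dd e f f'"
  shows "((\<lambda>r. f (p + r *\<^sub>R e)) has_real_derivative f' (p + r *\<^sub>R e)) (at r)"
proof -
  have "((\<lambda>x. f ((p + r *\<^sub>R e) + x *\<^sub>R e)) has_real_derivative f' (p + r *\<^sub>R e)) (at (r - r))"
    using has_ddD[OF assms] by simp
  then have "((\<lambda>x. f ((p + r *\<^sub>R e) + (x - r) *\<^sub>R e)) has_real_derivative f' (p + r *\<^sub>R e)) (at r)"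
    using DERIV_shift[of "\<lambda>x. f ((p + r *\<^sub>R e) + x *\<^sub>R e)" "f' (p + r *\<^sub>R e)" r "- r"] by simp
  then show ?thesis by (simp add: algebra_simps)
qed

lemma has_dd_const: "has_dd e (\<lambda>p. c) (\<lambda>p. 0)"
  by (simp add: has_dd_def)

lemma has_dd_add: "has_dd e f f' \<Longrightarrow> has_dd e g g' \<Longrightarrow> has_dd e (\<lambda>p. f p + g p) (\<lambda>p. f' p + g' p)"
  unfolding has_dd_def by (auto intro: DERIV_add)

lemma has_dd_mult:
  assumes "has_dd e f f'" "has_dd e g g'"
  shows "has_dd e (\<lambda>p. f p * g p) (\<lambda>p. f' p * g p + f p * g' p)"
  unfolding has_dd_def
proof
  fix p
  show "((\<lambda>r. f (p + r *\<^sub>R e) * g (p + r *\<^sub>R e)) has_real_derivative f' p * g p + f p * g' p) (at 0)"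
    using DERIV_mult[OF has_ddD[OF assms(1), of p] has_ddD[OF assms(2), of p]]
    by (simp add: algebra_simps)
qed

lemma has_dd_cmult: "has_dd e f f' \<Longrightarrow> has_dd e (\<lambda>p. c * f p) (\<lambda>p. c * f' p)"
  using has_dd_mult[OF has_dd_const] by simp

lemma has_dd_sum:
  "(\<And>i. i \<in> I \<Longrightarrow> has_dd e (f i) (f' i)) \<Longrightarrow> has_dd e (\<lambda>p. \<Sum>i\<in>I. f i p) (\<lambda>p. \<Sum>i\<in>I. f' i p)"
  unfolding has_dd_def by (auto intro: DERIV_sum)

lemma has_dd_shift: "has_dd e f f' \<Longrightarrow> has_dd e (\<lambda>p. f (p + v)) (\<lambda>p. f' (p + v))"
  unfolding has_dd_def
proof
  fix p assume "\<forall>p. ((\<lambda>r. f (p + r *\<^sub>R e)) has_real_derivative f' p) (at 0)"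
  then have "((\<lambda>r. f ((p + v) + r *\<^sub>R e)) has_real_derivative f' (p + v)) (at 0)" by blast
  then show "((\<lambda>r. f (p + r *\<^sub>R e + v)) has_real_derivative f' (p + v)) (at 0)"
    by (simp add: algebra_simps)
qed

lemma has_dd_cong: "has_dd e f f' \<Longrightarrow> (\<And>p. f' p = g' p) \<Longrightarrow> has_dd e f g'"
  by (simp add: has_dd_def)

lemma has_dd_increment_le:
  assumes "has_dd e f f'" and M: "\<And>r'. \<bar>r'\<bar> \<le> \<bar>r\<bar> \<Longrightarrow> \<bar>f' (p + r' *\<^sub>R e)\<bar> \<le> M"
  shows "\<bar>f (p + r *\<^sub>R e) - f p\<bar> \<le> M * \<bar>r\<bar>"
proof -
  have "norm (f (p + r *\<^sub>R e) - f (p + 0 *\<^sub>R e)) \<le> M * norm (r - 0)"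
    by (rule field_differentiable_bound[of "closed_segment 0 r"
          "\<lambda>r. f (p + r *\<^sub>R e)" "\<lambda>r. f' (p + r *\<^sub>R e)"])
      (auto simp: closed_segment_eq_real_ivl split: if_splits
        intro!: M DERIV_subset[OF has_dd_line[OF assms(1)]])
  then show ?thesis by simp
qed

section \<open>Bounded supports and translation invariance of the integral\<close>

lemma continuous_compact_bounded:
  fixes f :: "'a::euclidean_space \<Rightarrow> real"
  assumes "continuous_on UNIV f" "bounded S"
  obtains M where "M > 0" "\<And>p. p \<in> S \<Longrightarrow> \<bar>f p\<bar> \<le> M"
proof -
  have "compact (f ` closure S)"
    using assms by (meson compact_closure compact_continuous_image continuous_on_subset subset_UNIV)
  then obtain M where "\<forall>y\<in>f ` closure S. \<bar>y\<bar> \<le> M"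
    using compact_imp_bounded bounded_iff by (metis real_norm_def)
  then show ?thesis using that[of "max M 1"] closure_subset[of S] by force
qed

lemma integrable_bounded_support:
  fixes f :: "'a::euclidean_space \<Rightarrow> real"
  assumes "f \<in> borel_measurable borel" "\<And>p. \<bar>f p\<bar> \<le> M" "\<And>p. p \<notin> S \<Longrightarrow> f p = 0" "bounded S"
  shows "integrable lborel f"
proof -
  have c: "compact (closure S)" using assms(4) by simp
  have "integrable lborel (\<lambda>x. indicator (closure S) x *\<^sub>R M)"
    by (rule borel_integrable_compact[OF c continuous_on_const])
  then show ?thesis
  proof (rule Bochner_Integration.integrable_bound)
    show "AE x in lborel. norm (f x) \<le> norm (indicator (closure S) x *\<^sub>R M)"
    proof (rule AE_I2)
      fix x
      show "norm (f x) \<le> norm (indicator (closure S) x *\<^sub>R M)"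
      proof (cases "x \<in> S")
        case True
        then have "x \<in> closure S" using closure_subset by blast
        then show ?thesis using assms(2)[of x] by (simp add: indicator_def)
      qed (simp add: assms(3))
    qed
    show "f \<in> borel_measurable lborel" unfolding measurable_lborel2 by (rule assms(1))
  qed
qed

lemma integrable_continuous_bounded_support:
  fixes f :: "'a::euclidean_space \<Rightarrow> real"
  assumes "continuous_on UNIV f" "\<And>p. p \<notin> S \<Longrightarrow> f p = 0" "bounded S"
  shows "integrable lborel f"
proof -
  obtain M where M: "M > 0" "\<And>p. p \<in> S \<Longrightarrow> \<bar>f p\<bar> \<le> M"
    using continuous_compact_bounded assms by metis
  have "\<bar>f p\<bar> \<le> M" for p using M assms(2)[of p] by (cases "p \<in> S") auto
  then show ?thesis
    using integrable_bounded_support[of f M S] assms borel_measurable_continuous_onI by blast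
qed

lemma lborel_integrable_shift:
  fixes f :: "'a::euclidean_space \<Rightarrow> real"
  assumes "integrable lborel f"
  shows "integrable lborel (\<lambda>p. f (p + v))"
proof -
  have "integrable (distr lborel borel ((+) v)) f" using assms by (simp add: lborel_distr_plus)
  then show ?thesis by (subst (asm) integrable_distr_eq)
      (use borel_measurable_integrable[OF assms] in \<open>auto simp: add.commute\<close>)
qed

lemma lborel_integral_shift:
  fixes f :: "'a::euclidean_space \<Rightarrow> real"
  assumes "f \<in> borel_measurable borel"
  shows "(LINT p|lborel. f (p + v)) = (LINT p|lborel. f p)"
proof -
  have "(LINT p|lborel. f p) = (LINT p|distr lborel borel ((+) v). f p)"
    by (simp add: lborel_distr_plus)
  also have "\<dots> = (LINT p|lborel. f (v + p))"
    using assms by (subst integral_distr) auto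
  finally show ?thesis by (simp add: add.commute)
qed

section \<open>Integration by parts\<close>

definition zint :: "('a::euclidean_space \<Rightarrow> real) \<Rightarrow> bool" where
  "zint f \<longleftrightarrow> integrable lborel f \<and> (LINT p|lborel. f p) = 0"

lemma zint_cong: "zint f \<Longrightarrow> (\<And>p. f p = g p) \<Longrightarrow> zint g"
  by (simp add: zint_def cong: Bochner_Integration.integrable_cong)

lemma zint_add: "zint f \<Longrightarrow> zint g \<Longrightarrow> zint (\<lambda>p. f p + g p)"
  by (simp add: zint_def)

lemma zint_diff: "zint f \<Longrightarrow> zint g \<Longrightarrow> zint (\<lambda>p. f p - g p)"
  by (simp add: zint_def)

lemma zint_cmult: "zint f \<Longrightarrow> zint (\<lambda>p. c * f p)"
  by (simp add: zint_def)

lemma zint_sum: "(\<And>i. i \<in> I \<Longrightarrow> zint (f i)) \<Longrightarrow> zint (\<lambda>p. \<Sum>i\<in>I. f i p)"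
  by (simp add: zint_def)

text \<open>The difference quotients of \<open>F\<close> have integral zero by translation invariance, and they
  converge boundedly to \<open>F'\<close>.\<close>

lemma zint_has_dd:
  fixes F :: "'a::euclidean_space \<Rightarrow> real"
  assumes dd: "has_dd e F F'" and c: "continuous_on UNIV F" "continuous_on UNIV F'"
    and S: "\<And>p. p \<notin> S \<Longrightarrow> F p = 0" "bounded S"
  shows "zint F'"
proof -
  \<comment> \<open>\<open>T\<close> contains every point from which a step of at most
    \<open>e\<close> reaches the support, so all difference quotients \<open>Q n\<close> vanish off
    one compact set.\<close>
  define T where "T = (\<lambda>x. fst x + snd x) ` (closure S \<times> cball 0 (norm e))"
  have "compact (closure S \<times> cball (0::'a) (norm e))" using S(2) by (intro compact_Times compact_cball) simp
  then have "compact T" unfolding T_def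
    by (intro compact_continuous_image) (auto intro!: continuous_intros)
  then have bT: "bounded T" by (rule compact_imp_bounded)
  obtain b where b: "\<And>x. x \<in> T \<Longrightarrow> norm x \<le> b" using bT bounded_iff by metis
  obtain M where M: "M > 0" "\<And>p. p \<in> cball 0 (b + norm e) \<Longrightarrow> \<bar>F' p\<bar> \<le> M"
    using continuous_compact_bounded[OF c(2) bounded_cball] by metis
  have ST: "p \<in> T" if "p + r *\<^sub>R e \<in> S" "\<bar>r\<bar> \<le> 1" for p r
  proof -
    have "norm (- r *\<^sub>R e) \<le> norm e" using that(2) mult_right_mono[of "\<bar>r\<bar>" 1 "norm e"] by simp
    then have "(p + r *\<^sub>R e, - r *\<^sub>R e) \<in> closure S \<times> cball 0 (norm e)"
      using that(1) closure_subset by auto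
    then show ?thesis unfolding T_def by (rule rev_image_eqI) simp
  qed
  define Q where "Q = (\<lambda>n p. (F (p + (1 / real (Suc n)) *\<^sub>R e) - F p) * real (Suc n))"
  have Fm: "F \<in> borel_measurable borel" "F' \<in> borel_measurable borel"
    using c borel_measurable_continuous_onI by auto
  have Fi: "integrable lborel F" using integrable_continuous_bounded_support c(1) S by blast
  have n1: "\<bar>1 / real (Suc n)\<bar> \<le> 1" for n by simp
  have Q0: "(LINT p|lborel. Q n p) = 0" for n
  proof -
    have "(LINT p|lborel. Q n p) =
       ((LINT p|lborel. F (p + (1 / real (Suc n)) *\<^sub>R e)) - (LINT p|lborel. F p)) * real (Suc n)"
      unfolding Q_def using Fi lborel_integrable_shift[OF Fi]
      by (simp add: Bochner_Integration.integral_diff del: of_nat_Suc)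
    then show ?thesis using lborel_integral_shift[OF Fm(1)] by simp
  qed
  have Qb: "\<bar>Q n p\<bar> \<le> M * indicator T p" for n p
  proof (cases "p \<in> T")
    case True
    have "\<bar>F (p + (1 / real (Suc n)) *\<^sub>R e) - F p\<bar> \<le> M * \<bar>1 / real (Suc n)\<bar>"
    proof (rule has_dd_increment_le[OF dd])
      fix r' :: real assume "\<bar>r'\<bar> \<le> \<bar>1 / real (Suc n)\<bar>"
      then have "\<bar>r'\<bar> \<le> 1" using n1[of n] by linarith
      then have "norm (p + r' *\<^sub>R e) \<le> b + norm e"
        using norm_triangle_ineq[of p "r' *\<^sub>R e"] b[OF True] mult_right_mono[of "\<bar>r'\<bar>" 1 "norm e"] by simp
      then show "\<bar>F' (p + r' *\<^sub>R e)\<bar> \<le> M" by (intro M) simp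
    qed
    then have "\<bar>F (p + (1 / real (Suc n)) *\<^sub>R e) - F p\<bar> * real (Suc n) \<le> M * \<bar>1 / real (Suc n)\<bar> * real (Suc n)"
      by (rule mult_right_mono) simp
    then show ?thesis using True by (simp add: Q_def abs_mult del: of_nat_Suc)
  next
    case False
    then have "F (p + (1 / real (Suc n)) *\<^sub>R e) = 0" "F p = 0"
      using ST[of p "1 / real (Suc n)"] ST[of p 0] S(1) by auto
    then show ?thesis using False by (simp add: Q_def)
  qed
  have lim: "(\<lambda>n. Q n p) \<longlonglongrightarrow> F' p" for p
  proof -
    have l: "((\<lambda>h. (F (p + h *\<^sub>R e) - F p) / h) \<longlongrightarrow> F' p) (at 0)"
      using has_ddD[OF dd, of p] by (simp add: DERIV_def)
    have "filterlim (\<lambda>n. 1 / real (Suc n)) (at 0) sequentially"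
      unfolding filterlim_at using lim_1_over_n LIMSEQ_Suc[of "\<lambda>n. 1 / real n"] by (auto simp del: of_nat_Suc)
    from filterlim_compose[OF l this] show ?thesis by (simp add: Q_def del: of_nat_Suc)
  qed
  have wi: "integrable lborel (\<lambda>p. M * indicator T p :: real)"
  proof -
    have "integrable lborel (\<lambda>x. indicator T x *\<^sub>R M)"
      using \<open>compact T\<close> by (intro borel_integrable_compact continuous_on_const)
    then show ?thesis by (simp add: mult.commute)
  qed
  have Qm: "Q n \<in> borel_measurable lborel" for n unfolding Q_def using Fm by measurable
  have F'm: "F' \<in> borel_measurable lborel" using Fm by simp
  have a1: "AE x in lborel. (\<lambda>n. Q n x) \<longlonglongrightarrow> F' x" using lim by simp
  have a2: "AE x in lborel. norm (Q n x) \<le> M * indicator T x" for n using Qb by simp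
  have "(\<lambda>n. LINT p|lborel. Q n p) \<longlonglongrightarrow> (LINT p|lborel. F' p)"
    by (rule integral_dominated_convergence[OF F'm Qm wi a1 a2])
  then have "(LINT p|lborel. F' p) = 0" by (simp add: Q0 LIMSEQ_const_iff)
  moreover have "integrable lborel F'"
    by (rule integrable_dominated_convergence[OF F'm Qm wi a1 a2])
  ultimately show ?thesis by (simp add: zint_def)
qed

text \<open>Schwarz's theorem from directional derivatives alone: two applications of the mean value
  theorem write the second difference over a small parallelogram as t^2 \<open>fab\<close> at one
  point and, with the roles exchanged, as t^2 \<open>fba\<close> at another; both points tend to
  \<open>p\<close>.\<close>

lemma mixed_directional_derivatives_commute:
  fixes f :: "'a::real_normed_vector \<Rightarrow> real"
  assumes a: "has_dd a f fa" "has_dd b fa fab" and b: "has_dd b f fb" "has_dd a fb fba"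
    and c: "continuous_on UNIV fab" "continuous_on UNIV fba"
  shows "fab = fba"
proof
  fix p
  have one: "\<exists>\<xi> \<eta>. 0 < \<xi> \<and> \<xi> < t \<and> 0 < \<eta> \<and> \<eta> < t \<and>
      f (p + t *\<^sub>R a + t *\<^sub>R b) - f (p + t *\<^sub>R a) - f (p + t *\<^sub>R b) + f p = t\<^sup>2 * fab (p + \<xi> *\<^sub>R a + \<eta> *\<^sub>R b)"
    if a: "has_dd a f fa" "has_dd b fa fab" and t: "t > 0" for t and a b :: 'a and fa fab
  proof -
    have d1: "((\<lambda>x. f (p + t *\<^sub>R b + x *\<^sub>R a) - f (p + x *\<^sub>R a)) has_real_derivative
        fa (p + t *\<^sub>R b + x *\<^sub>R a) - fa (p + x *\<^sub>R a)) (at x)" for x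
      by (intro DERIV_diff has_dd_line[OF a(1)])
    obtain \<xi> where x: "0 < \<xi>" "\<xi> < t"
      "f (p + t *\<^sub>R b + t *\<^sub>R a) - f (p + t *\<^sub>R a) - (f (p + t *\<^sub>R b + 0 *\<^sub>R a) - f (p + 0 *\<^sub>R a))
         = (t - 0) * (fa (p + t *\<^sub>R b + \<xi> *\<^sub>R a) - fa (p + \<xi> *\<^sub>R a))"
      using MVT2[of 0 t "\<lambda>x. f (p + t *\<^sub>R b + x *\<^sub>R a) - f (p + x *\<^sub>R a)", OF t d1] by auto
    obtain \<eta> where y: "0 < \<eta>" "\<eta> < t"
      "fa (p + \<xi> *\<^sub>R a + t *\<^sub>R b) - fa (p + \<xi> *\<^sub>R a + 0 *\<^sub>R b) = (t - 0) * fab (p + \<xi> *\<^sub>R a + \<eta> *\<^sub>R b)"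
      using MVT2[of 0 t "\<lambda>y. fa (p + \<xi> *\<^sub>R a + y *\<^sub>R b)" "\<lambda>y. fab (p + \<xi> *\<^sub>R a + y *\<^sub>R b)", OF t has_dd_line[OF a(2)]]
      by auto
    have sw: "p + t *\<^sub>R b + u *\<^sub>R a = p + u *\<^sub>R a + t *\<^sub>R b" for u by simp
    have "f (p + t *\<^sub>R a + t *\<^sub>R b) - f (p + t *\<^sub>R a) - f (p + t *\<^sub>R b) + f p
        = t * (fa (p + \<xi> *\<^sub>R a + t *\<^sub>R b) - fa (p + \<xi> *\<^sub>R a))"
      using x(3) unfolding sw by simp
    also have "\<dots> = t\<^sup>2 * fab (p + \<xi> *\<^sub>R a + \<eta> *\<^sub>R b)"
      using y(3) by (simp add: power2_eq_square)
    finally show ?thesis using x y by blast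
  qed
  have two: "\<exists>u v. norm (u - p) \<le> t * (norm a + norm b) \<and> norm (v - p) \<le> t * (norm a + norm b) \<and> fab u = fba v"
    if t: "t > 0" for t
  proof -
    obtain x y where xy: "0 < x" "x < t" "0 < y" "y < t"
      "f (p + t *\<^sub>R a + t *\<^sub>R b) - f (p + t *\<^sub>R a) - f (p + t *\<^sub>R b) + f p = t\<^sup>2 * fab (p + x *\<^sub>R a + y *\<^sub>R b)"
      using one[OF a t] by blast
    obtain x' y' where xy': "0 < x'" "x' < t" "0 < y'" "y' < t"
      "f (p + t *\<^sub>R b + t *\<^sub>R a) - f (p + t *\<^sub>R b) - f (p + t *\<^sub>R a) + f p = t\<^sup>2 * fba (p + x' *\<^sub>R b + y' *\<^sub>R a)"
      using one[OF b t] by blast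
    have sw: "p + t *\<^sub>R b + t *\<^sub>R a = p + t *\<^sub>R a + t *\<^sub>R b" by simp
    have e: "fab (p + x *\<^sub>R a + y *\<^sub>R b) = fba (p + x' *\<^sub>R b + y' *\<^sub>R a)"
      using xy(5) xy'(5) t unfolding sw by (simp add: algebra_simps)
    have nb: "norm (p + u *\<^sub>R c + v *\<^sub>R d - p) \<le> t * (norm c + norm d)"
      if "0 < u" "u < t" "0 < v" "v < t" for u v c d
    proof -
      have "norm (p + u *\<^sub>R c + v *\<^sub>R d - p) \<le> norm (u *\<^sub>R c) + norm (v *\<^sub>R d)"
        using norm_triangle_ineq[of "u *\<^sub>R c" "v *\<^sub>R d"] by (simp add: algebra_simps)
      also have "\<dots> \<le> t * norm c + t * norm d"
        using that by (auto intro!: add_mono mult_right_mono)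
      finally show ?thesis by (simp add: algebra_simps)
    qed
    show ?thesis using e nb[OF xy(1-4), of a b] nb[OF xy'(1-4), of b a] by (metis add.commute)
  qed
  define t where "t n = 1 / real (Suc n)" for n
  have "\<forall>n. \<exists>u v. norm (u - p) \<le> t n * (norm a + norm b) \<and> norm (v - p) \<le> t n * (norm a + norm b) \<and> fab u = fba v"
    using two[of "t n" for n] by (auto simp: t_def simp del: of_nat_Suc)
  then obtain u v where uv: "\<And>n. norm (u n - p) \<le> t n * (norm a + norm b)"
    "\<And>n. norm (v n - p) \<le> t n * (norm a + norm b)" "\<And>n. fab (u n) = fba (v n)" by metis
  have "t \<longlonglongrightarrow> 0" unfolding t_def using LIMSEQ_Suc[OF lim_1_over_n] by simp
  then have t0: "(\<lambda>n. t n * (norm a + norm b)) \<longlonglongrightarrow> 0" using tendsto_mult_left_zero by blast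
  have up: "u \<longlonglongrightarrow> p"
    by (rule LIM_zero_cancel, rule Lim_null_comparison[OF _ t0]) (simp add: uv(1))
  have vp: "v \<longlonglongrightarrow> p"
    by (rule LIM_zero_cancel, rule Lim_null_comparison[OF _ t0]) (simp add: uv(2))
  have "(\<lambda>n. fab (u n)) \<longlonglongrightarrow> fab p" "(\<lambda>n. fba (v n)) \<longlonglongrightarrow> fba p"
    using continuous_on_tendsto_compose[OF c(1) up] continuous_on_tendsto_compose[OF c(2) vp] by auto
  then show "fab p = fba p" using uv(3) LIMSEQ_unique by simp
qed

section \<open>The geometry of the gauge\<close>

text \<open>This and the next lemma treat the points with z = 0, where the chain rule through the
  norm fails; along a coordinate axis the norm is then |x|.\<close>

lemma has_real_derivative_powr_ge_1:
  fixes a :: real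
  assumes "a > 1"
  shows "((\<lambda>x. \<bar>x\<bar> powr a) has_real_derivative 0) (at 0)"
proof -
  have "((\<lambda>h. \<bar>h\<bar> powr (a - 1)) \<longlongrightarrow> 0) (at 0)"
    using assms by (auto intro!: tendsto_eq_intros tendsto_powr')
  then have "((\<lambda>h. \<bar>\<bar>h\<bar> powr a / h\<bar>) \<longlongrightarrow> 0) (at 0)"
  proof (rule filterlim_mono_eventually[OF _ order_refl order_refl])
    show "\<forall>\<^sub>F h in at 0. \<bar>h\<bar> powr (a - 1) = \<bar>\<bar>h\<bar> powr a / h\<bar>"
      by (auto simp: eventually_at_filter powr_diff abs_mult)
  qed
  then have "((\<lambda>h. \<bar>h\<bar> powr a / h) \<longlongrightarrow> 0) (at 0)"
    by (rule tendsto_rabs_zero_cancel)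
  then show ?thesis by (simp add: DERIV_def)
qed

lemma has_real_derivative_sgn_powr:
  fixes a :: real
  assumes "a > 0"
  shows "((\<lambda>x. \<bar>x\<bar> powr a * x) has_real_derivative 0) (at 0)"
proof -
  have "((\<lambda>h. \<bar>h\<bar> powr a) \<longlongrightarrow> 0) (at 0)"
    using assms by (auto intro!: tendsto_eq_intros tendsto_powr')
  then have "((\<lambda>h. \<bar>h\<bar> powr a * h / h) \<longlongrightarrow> 0) (at 0)"
    by (rule filterlim_mono_eventually[OF _ order_refl order_refl]) (auto simp: eventually_at_filter)
  then show ?thesis by (simp add: DERIV_def)
qed

text \<open>Directions and coordinates of the two blocks are indexed by \<open>'m + 'k\<close>. In direction \<open>c\<close>,
  \<open>wgt c\<close> and \<open>dil c * crd c\<close> are the coefficients of the operator and of the generator of the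
  dilations, and \<open>slg c\<close> is the derivative of \<open>lg = ln \<rho>\<close>. Further, \<open>DD = \<rho>\<^sup>2\<^sup>\<kappa>\<close> with \<open>\<kappa> = \<gamma> + 1\<close>,
  \<open>mm = \<psi> / \<rho>\<^sup>2\<close>, \<open>2 * qq + 2\<close> is the homogeneous dimension, and \<open>rad F\<close> is \<open>F (ln \<rho>)\<close>, set to \<open>0\<close>
  at the origin, where \<open>lg\<close> has the junk value \<open>0\<close>.\<close>

locale grushin =
  fixes \<gamma> :: real and dims :: "('m::finite \<times> 'k::finite) itself"
  assumes gam: "\<gamma> > 0"
begin

definition "kap = \<gamma> + 1"

definition qq :: real where
  "qq = (real CARD('m) + kap * real CARD('k) - 2) / 2"

definition bas :: "'m + 'k \<Rightarrow> ('m, 'k) pt" where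
  "bas c = (case c of Inl i \<Rightarrow> (axis i 1, 0) | Inr j \<Rightarrow> (0, axis j 1))"

definition crd :: "'m + 'k \<Rightarrow> ('m, 'k) pt \<Rightarrow> real" where
  "crd c p = (case c of Inl i \<Rightarrow> fst p $ i | Inr j \<Rightarrow> snd p $ j)"

definition dil :: "'m + 'k \<Rightarrow> real" where
  "dil c = (case c of Inl i \<Rightarrow> 1 | Inr j \<Rightarrow> kap)"

definition WW :: "('m, 'k) pt \<Rightarrow> real" where
  "WW p = norm (fst p) powr (2 * \<gamma>)"

definition wgt :: "'m + 'k \<Rightarrow> ('m, 'k) pt \<Rightarrow> real" where
  "wgt c p = (case c of Inl i \<Rightarrow> 1 | Inr j \<Rightarrow> WW p)"

text \<open>The derivative of \<open>WW p * crd c p\<close> in direction \<open>c\<close>. The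
  product with the coordinate is continuously differentiable along \<open>c\<close> even where
  \<open>WW\<close> itself is not differentiable.\<close>

definition WX :: "'m + 'k \<Rightarrow> ('m, 'k) pt \<Rightarrow> real" where
  "WX c p = (case c of
      Inl i \<Rightarrow> WW p + 2 * \<gamma> * (norm (fst p) powr (2 * \<gamma> - 2) * (fst p $ i)\<^sup>2)
    | Inr j \<Rightarrow> WW p)"

definition DD :: "('m, 'k) pt \<Rightarrow> real" where
  "DD p = norm (fst p) powr (2 * kap) + kap\<^sup>2 * (norm (snd p))\<^sup>2"

definition lg :: "('m, 'k) pt \<Rightarrow> real" where
  "lg p = ln (DD p) / (2 * kap)"

definition mm :: "('m, 'k) pt \<Rightarrow> real" where
  "mm p = WW p / DD p"

definition rad :: "(real \<Rightarrow> real) \<Rightarrow> ('m, 'k) pt \<Rightarrow> real" where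
  "rad F p = (if p = 0 then 0 else F (lg p))"

definition slg :: "'m + 'k \<Rightarrow> ('m, 'k) pt \<Rightarrow> real" where
  "slg c p = (case c of Inl i \<Rightarrow> WW p * fst p $ i | Inr j \<Rightarrow> kap * snd p $ j) / DD p"

lemma kap: "kap > 1" "kap > 0" "kap \<noteq> 0" using gam by (auto simp: kap_def)

lemma WW_nonneg [simp]: "WW p \<ge> 0" by (simp add: WW_def)
lemma DD_nonneg [simp]: "DD p \<ge> 0" using kap by (simp add: DD_def)
lemma mm_nonneg [simp]: "mm p \<ge> 0" by (simp add: mm_def)

lemma DD_pos: "p \<noteq> 0 \<Longrightarrow> DD p > 0"
  using kap by (cases p) (auto simp: DD_def zero_prod_def add_pos_nonneg add_nonneg_pos)

lemma DD_0 [simp]: "DD 0 = 0" using kap by (simp add: DD_def)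

lemma DD_eq_0 [simp]: "DD p = 0 \<longleftrightarrow> p = 0" using DD_pos[of p] by (cases "p = 0") auto

lemma exp_lg: "p \<noteq> 0 \<Longrightarrow> exp (2 * kap * lg p) = DD p"
  using DD_pos kap by (simp add: lg_def)

lemma WW_continuous [continuous_intros]: "continuous_on A WW"
  unfolding WW_def using gam
  by (intro continuous_on_powr' continuous_intros) auto

lemma DD_continuous [continuous_intros]: "continuous_on A DD"
  unfolding DD_def using kap
  by (intro continuous_on_add continuous_on_powr' continuous_intros) auto

lemma wgt_continuous [continuous_intros]: "continuous_on A (wgt c)"
  unfolding wgt_def by (cases c) (auto intro!: continuous_intros)

lemma crd_continuous [continuous_intros]: "continuous_on A (crd c)"
  unfolding crd_def by (cases c) (auto intro!: continuous_intros)

text \<open>For \<gamma> < 1 the exponent 2 \<gamma> - 2 is negative; the factor z_i^2 brings the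
  product below |z|^(2 \<gamma>), which tends to 0 on z = 0.\<close>

lemma WX_continuous [continuous_intros]: "continuous_on A (WX c)"
proof (cases c)
  case (Inl i)
  let ?f = "\<lambda>p::('m, 'k) pt. norm (fst p) powr (2 * \<gamma> - 2) * (fst p $ i)\<^sup>2"
  have "isCont ?f p" for p
  proof (cases "fst p = 0")
    case False
    then show ?thesis by (auto intro!: continuous_intros)
  next
    case True
    have "((\<lambda>p::('m, 'k) pt. norm (fst p) powr (2 * \<gamma>)) \<longlongrightarrow> 0) (at p)"
    proof -
      have "isCont WW p" using WW_continuous[of UNIV] continuous_on_eq_continuous_at by blast
      then show ?thesis using True gam unfolding isCont_def by (simp add: WW_def[abs_def])
    qed
    then have "(?f \<longlongrightarrow> 0) (at p)"
    proof (rule Lim_null_comparison[rotated], intro always_eventually allI)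
      fix p :: "('m, 'k) pt"
      have "(fst p $ i)\<^sup>2 \<le> (norm (fst p))\<^sup>2"
        using component_le_norm_cart[of "fst p" i] abs_le_square_iff by fastforce
      then have "?f p \<le> norm (fst p) powr (2 * \<gamma> - 2) * (norm (fst p))\<^sup>2"
        by (rule mult_left_mono) simp
      also have "\<dots> = norm (fst p) powr (2 * \<gamma>)"
        by (cases "fst p = 0") (auto simp: powr_diff)
      finally show "norm (?f p) \<le> norm (fst p) powr (2 * \<gamma>)" by simp
    qed
    then show ?thesis using True by (simp add: isCont_def)
  qed
  then have "continuous_on A ?f" by (simp add: continuous_at_imp_continuous_on)
  then show ?thesis unfolding WX_def Inl by (auto intro!: continuous_intros)
qed (auto simp: WX_def intro!: continuous_intros)

lemma fst_bas: "fst (p + r *\<^sub>R bas (Inl i)) = fst p + r *\<^sub>R axis i 1" "snd (p + r *\<^sub>R bas (Inl i)) = snd p"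
  "fst (p + r *\<^sub>R bas (Inr j)) = fst p" "snd (p + r *\<^sub>R bas (Inr j)) = snd p + r *\<^sub>R axis j 1"
  by (simp_all add: bas_def)

lemma bas_simps [simp]: "fst (bas (Inl i)) = axis i 1" "snd (bas (Inl i)) = 0"
  "fst (bas (Inr j)) = 0" "snd (bas (Inr j)) = axis j 1"
  by (simp_all add: bas_def)

lemma has_dd_crd: "has_dd (bas d) (crd c) (\<lambda>p. if c = d then 1 else 0)"
  unfolding has_dd_def
proof
  fix p
  have "(\<lambda>r. crd c (p + r *\<^sub>R bas d)) = (\<lambda>r. crd c p + r * (if c = d then 1 else 0))"
    by (cases c; cases d) (auto simp: crd_def fst_bas axis_def bas_def)
  then show "((\<lambda>r. crd c (p + r *\<^sub>R bas d)) has_real_derivative (if c = d then 1 else 0)) (at 0)"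
    by (simp del: if_split_asm) (auto intro!: derivative_eq_intros)
qed

lemma norm_powr: "norm x powr a = ((norm x)\<^sup>2) powr (a / 2)" for x :: "'a::real_normed_vector"
  by (cases "x = 0") (auto simp: powr_powr simp flip: powr_numeral)

lemma has_dd_norm_sq: "((\<lambda>r. (norm (x + r *\<^sub>R axis i 1 :: real ^ 'n::finite))\<^sup>2) has_real_derivative 2 * x $ i) (at 0)"
  by (auto simp: norm_sq_add_axis intro!: derivative_eq_intros)

lemma has_dd_norm_powr:
  fixes x :: "real ^ 'n::finite"
  assumes "x \<noteq> 0"
  shows "((\<lambda>r. norm (x + r *\<^sub>R axis i 1) powr a) has_real_derivative a * norm x powr (a - 2) * x $ i) (at 0)"
proof -
  have "((\<lambda>r. (norm (x + r *\<^sub>R axis i 1))\<^sup>2 powr (a / 2)) has_real_derivative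
      (a / 2) * (norm (x + 0 *\<^sub>R axis i 1))\<^sup>2 powr (a / 2 - 1) * (2 * x $ i)) (at 0)"
    using DERIV_fun_powr[OF has_dd_norm_sq[of x i], of "a / 2"] assms by (simp add: mult_ac)
  moreover have "(norm x)\<^sup>2 powr (a / 2 - 1) = norm x powr (a - 2)"
    unfolding norm_powr[of x "a - 2"] by (simp add: diff_divide_distrib)
  ultimately show ?thesis by (simp add: norm_powr[of "x + _" a] mult.assoc)
qed

text \<open>Only the directions of t are covered: for \<gamma> \<le> 1/2 the function
  \<open>WW\<close> is not differentiable in z on z = 0. This is why derivatives are taken direction
  by direction.\<close>

lemma has_dd_WW_Inr: "has_dd (bas (Inr j)) WW (\<lambda>p. 0)"
  unfolding has_dd_def by (intro allI) (simp add: WW_def)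

lemma has_dd_WX: "has_dd (bas c) (\<lambda>p. WW p * crd c p) (WX c)"
proof (cases c)
  case (Inr j)
  have "has_dd (bas c) (\<lambda>p. WW p * crd c p) (\<lambda>p. 0 * crd c p + WW p * (if c = c then 1 else 0))"
    unfolding Inr by (intro has_dd_mult has_dd_WW_Inr has_dd_crd)
  then show ?thesis by (rule has_dd_cong) (simp add: Inr WX_def)
next
  case (Inl i)
  show ?thesis unfolding has_dd_def
  proof
    fix p :: "('m, 'k) pt"
    show "((\<lambda>r. WW (p + r *\<^sub>R bas c) * crd c (p + r *\<^sub>R bas c)) has_real_derivative WX c p) (at 0)"
    proof (cases "fst p = 0")
      case True
      then have "(\<lambda>r. WW (p + r *\<^sub>R bas c) * crd c (p + r *\<^sub>R bas c)) = (\<lambda>r. \<bar>r\<bar> powr (2 * \<gamma>) * r)"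
        by (simp add: WW_def crd_def Inl fst_bas)
      moreover have "WX c p = 0" using True gam by (simp add: WX_def WW_def Inl)
      ultimately show ?thesis using has_real_derivative_sgn_powr[of "2 * \<gamma>"] gam by simp
    next
      case False
      have "((\<lambda>r. norm (fst p + r *\<^sub>R axis i 1) powr (2 * \<gamma>) * (fst p $ i + r)) has_real_derivative
          (2 * \<gamma> * norm (fst p) powr (2 * \<gamma> - 2) * fst p $ i) * (fst p $ i + 0) +
          1 * norm (fst p + 0 *\<^sub>R axis i 1) powr (2 * \<gamma>)) (at 0)"
        by (intro DERIV_mult has_dd_norm_powr[OF False]) (auto intro!: derivative_eq_intros)
      moreover have "(2 * \<gamma> * norm (fst p) powr (2 * \<gamma> - 2) * fst p $ i) * (fst p $ i + 0) +
          1 * norm (fst p + 0 *\<^sub>R axis i 1) powr (2 * \<gamma>) = WX c p" by (simp add: WX_def Inl WW_def power2_eq_square)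
      ultimately show ?thesis
        by (simp add: WW_def crd_def Inl fst_bas)
    qed
  qed
qed

lemma has_dd_DD: "has_dd (bas c) DD (\<lambda>p. 2 * kap * slg c p * DD p)"
  unfolding has_dd_def
proof
  fix p :: "('m, 'k) pt"
  \<comment> \<open>At the origin \<open>slg\<close> is 0 through division by zero, and the
    right-hand side vanishes there too.\<close>
  have s: "slg c p * DD p = (case c of Inl i \<Rightarrow> WW p * fst p $ i | Inr j \<Rightarrow> kap * snd p $ j)"
    by (cases "p = 0") (auto simp: slg_def split: sum.split)
  show "((\<lambda>r. DD (p + r *\<^sub>R bas c)) has_real_derivative 2 * kap * slg c p * DD p) (at 0)"
  proof (cases c)
    case (Inr j)
    show ?thesis unfolding DD_def[of "p + _"] Inr fst_bas mult.assoc s[unfolded Inr]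
      by (rule derivative_eq_intros has_dd_norm_sq refl)+ (simp add: power2_eq_square)
  next
    case (Inl i)
    have "((\<lambda>r. norm (fst p + r *\<^sub>R axis i 1) powr (2 * kap)) has_real_derivative
        2 * kap * (WW p * fst p $ i)) (at 0)"
    proof (cases "fst p = 0")
      case True
      then show ?thesis using has_real_derivative_powr_ge_1[of "2 * kap"] kap by simp
    next
      case False
      show ?thesis using has_dd_norm_powr[OF False, of i "2 * kap"]
        by (simp add: WW_def kap_def mult_ac)
    qed
    then show ?thesis unfolding DD_def[of "p + _"] Inl fst_bas mult.assoc s[unfolded Inl]
      using DERIV_add[OF _ DERIV_const] by fastforce
  qed
qed

lemma has_dd_DD_at: "((\<lambda>r. DD (p + r *\<^sub>R bas c)) has_real_derivative 2 * kap * slg c p * DD p) (at 0)"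
  using has_ddD[OF has_dd_DD] .

lemma has_dd_lg:
  assumes "p \<noteq> 0"
  shows "((\<lambda>r. lg (p + r *\<^sub>R bas c)) has_real_derivative slg c p) (at 0)"
proof -
  have D: "DD p > 0" using DD_pos assms by blast
  have "((\<lambda>r. ln (DD (p + r *\<^sub>R bas c))) has_real_derivative
      (1 / DD (p + 0 *\<^sub>R bas c)) * (2 * kap * slg c p * DD p)) (at 0)"
    by (rule DERIV_chain2[OF DERIV_ln_divide has_dd_DD_at]) (use D in simp)
  from DERIV_cdivide[OF this, of "2 * kap"] show ?thesis
    unfolding lg_def using D kap assms by simp
qed

lemma lg_continuous: "continuous_on (- {0}) lg"
  unfolding lg_def using kap by (auto intro!: continuous_intros)

lemma sum_Plus: "(\<Sum>c\<in>UNIV. f c) = (\<Sum>i\<in>UNIV. f (Inl i)) + (\<Sum>j\<in>UNIV. f (Inr j))"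
  for f :: "'m + 'k \<Rightarrow> real"
  by (simp add: UNIV_Plus_UNIV[symmetric] sum.Plus del: UNIV_Plus_UNIV)

text \<open>The degenerate gradient of ln \<rho> points along the dilations. This replaces the
  splitting into a radial and an angular part that polar coordinates would give.\<close>

lemma wgt_slg: "p \<noteq> 0 \<Longrightarrow> wgt c p * slg c p = mm p * (dil c * crd c p)"
  by (cases c) (auto simp: wgt_def slg_def mm_def dil_def crd_def)

text \<open>Z ln \<rho> = 1, because \<rho> has degree one under the dilations that scale z by l and
  t by l^\<open>kap\<close>.\<close>

lemma sum_slg: "p \<noteq> 0 \<Longrightarrow> (\<Sum>c\<in>UNIV. slg c p * (dil c * crd c p)) = 1"
proof -
  assume p: "p \<noteq> 0"
  have "(\<Sum>c\<in>UNIV. slg c p * (dil c * crd c p)) =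
     (WW p * (norm (fst p))\<^sup>2 + kap\<^sup>2 * (norm (snd p))\<^sup>2) / DD p"
    unfolding sum_Plus norm_sq_sum
    by (simp add: slg_def dil_def crd_def sum_distrib_left sum_divide_distrib add_divide_distrib
        power2_eq_square mult_ac)
  also have "WW p * (norm (fst p))\<^sup>2 = norm (fst p) powr (2 * kap)"
    by (cases "fst p = 0") (use kap in \<open>auto simp: WW_def kap_def distrib_left powr_add\<close>)
  finally show ?thesis using p DD_pos[OF p] by (simp add: DD_def)
qed

text \<open>The divergence of \<open>WW\<close> times the generator of the dilations: the generator
  alone has divergence \<open>2 * qq + 2\<close>, and \<open>WW\<close> has degree 2 \<gamma> =
  \<open>2 * kap - 2\<close>.\<close>

lemma sum_WX: "(\<Sum>c\<in>UNIV. dil c * WX c p) = (2 * qq + 2 * kap) * WW p"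
proof -
  have "(\<Sum>i\<in>UNIV. norm (fst p) powr (2 * \<gamma> - 2) * (fst p $ i)\<^sup>2) = WW p"
    unfolding sum_distrib_left[symmetric] norm_sq_sum[symmetric] WW_def
    by (cases "fst p = 0") (use gam in \<open>auto simp: powr_diff\<close>)
  then show ?thesis unfolding sum_Plus
    by (simp add: dil_def WX_def sum.distrib sum_distrib_left[symmetric] qq_def kap_def field_simps)
qed

lemma sum_dil: "(\<Sum>c\<in>UNIV. dil c) = 2 * qq + 2"
  unfolding sum_Plus by (simp add: dil_def qq_def field_simps)

text \<open>This is |X ln \<rho>|^2 = \<psi> / \<rho>^2.\<close>

lemma mm_le: "p \<noteq> 0 \<Longrightarrow> (\<Sum>c\<in>UNIV. wgt c p * (slg c p)\<^sup>2) = mm p"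
proof -
  assume p: "p \<noteq> 0"
  have "(\<Sum>c\<in>UNIV. wgt c p * (slg c p)\<^sup>2) = (\<Sum>c\<in>UNIV. (wgt c p * slg c p) * slg c p)"
    by (simp add: power2_eq_square mult_ac)
  also have "\<dots> = mm p * (\<Sum>c\<in>UNIV. slg c p * (dil c * crd c p))"
    unfolding wgt_slg[OF p] sum_distrib_left by (simp add: mult_ac)
  finally show ?thesis using sum_slg[OF p] by simp
qed

section \<open>Shells between two gauge spheres, and weights that depend on the gauge only\<close>

definition shell :: "real \<Rightarrow> real \<Rightarrow> ('m, 'k) pt set" where
  "shell a b = {p. p \<noteq> 0 \<and> a \<le> lg p \<and> lg p \<le> b}"

text \<open>In terms of the continuous function \<open>DD\<close> the origin needs no exception,
  since \<open>DD 0 = 0\<close> violates the lower bound. Closedness and boundedness of shells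
  follow.\<close>

lemma shell_DD: "p \<in> shell a b \<longleftrightarrow> exp (2 * kap * a) \<le> DD p \<and> DD p \<le> exp (2 * kap * b)"
proof (cases "p = 0")
  case False
  then have "exp (2 * kap * a) \<le> exp (2 * kap * lg p) \<longleftrightarrow> a \<le> lg p"
    "exp (2 * kap * lg p) \<le> exp (2 * kap * b) \<longleftrightarrow> lg p \<le> b"
    using kap by auto
  then show ?thesis using False by (simp add: shell_def exp_lg)
qed (simp add: shell_def)

lemma shell_closed: "closed (shell a b)"
proof -
  have "shell a b = {p. exp (2 * kap * a) \<le> DD p} \<inter> {p. DD p \<le> exp (2 * kap * b)}"
    using shell_DD by auto
  then show ?thesis
    by (auto intro!: closed_Int closed_Collect_le continuous_intros)
qed

lemma DD_le_bounded: "bounded {p. DD p \<le> r}"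
proof (rule boundedI)
  fix p assume "p \<in> {p. DD p \<le> r}"
  then have D: "DD p \<le> r" by simp
  have r: "r \<ge> 0" using D DD_nonneg[of p] by linarith
  have "norm (fst p) powr (2 * kap) \<le> r" "kap\<^sup>2 * (norm (snd p))\<^sup>2 \<le> r"
    using D unfolding DD_def
    by (metis (mono_tags, lifting) add.commute add_increasing order_trans powr_ge_zero zero_le_mult_iff zero_le_power2 order_refl le_add_same_cancel1)+
  note A = this
  have "(norm (fst p) powr (2 * kap)) powr (1 / (2 * kap)) \<le> r powr (1 / (2 * kap))"
    by (rule powr_mono2) (use A kap in auto)
  then have 1: "norm (fst p) \<le> r powr (1 / (2 * kap))"
    using kap by (cases "fst p = 0") (auto simp: powr_powr)
  have "(norm (snd p))\<^sup>2 \<le> kap\<^sup>2 * (norm (snd p))\<^sup>2"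
    using kap by (simp add: mult_le_cancel_right1 one_le_power)
  then have "norm (snd p) \<le> sqrt r" using A(2) by (intro real_le_rsqrt) linarith
  moreover have "norm p \<le> norm (fst p) + norm (snd p)"
    by (metis norm_Pair_le prod.collapse)
  ultimately show "norm p \<le> r powr (1 / (2 * kap)) + sqrt r" using 1 by linarith
qed

lemma shell_bounded: "bounded (shell a b)"
  by (rule bounded_subset[OF DD_le_bounded[of "exp (2 * kap * b)"]]) (auto simp: shell_DD)

lemma rad_support: "(\<And>s. s \<notin> {a..b} \<Longrightarrow> F s = 0) \<Longrightarrow> p \<notin> shell a b \<Longrightarrow> rad F p = 0"
  by (auto simp: rad_def shell_def)

text \<open>A closed shell misses a neighbourhood of the origin, so the junk values of
  \<open>lg\<close> and \<open>slg\<close> at 0 never matter for a weight supported in a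
  shell.\<close>

lemma rad_locally_0:
  assumes "\<And>s. s \<notin> {a..b} \<Longrightarrow> F s = 0"
  shows "\<forall>\<^sub>F p in nhds 0. rad F p = 0"
proof -
  have "\<forall>\<^sub>F p in nhds 0. p \<in> - shell a b"
    using shell_closed by (intro eventually_nhds_in_open) (auto simp: shell_def)
  then show ?thesis by eventually_elim (use rad_support[OF assms] in auto)
qed

lemma rad_continuous:
  assumes F: "continuous_on UNIV F" and S: "\<And>s. s \<notin> {a..b} \<Longrightarrow> F s = 0"
  shows "continuous_on A (rad F)"
proof -
  have "isCont (rad F) p" for p
  proof (cases "p = 0")
    case True
    have "continuous (at p) (\<lambda>_::('m, 'k) pt. 0::real)" by simp
    then show ?thesis
      using isCont_cong[of "rad F" "\<lambda>_. 0" p] rad_locally_0[OF S] True by simp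
  next
    case False
    have "continuous_on (- {0}) (\<lambda>p. F (lg p))"
      by (rule continuous_on_compose2[OF F lg_continuous]) auto
    then have "continuous_on (- {0}) (rad F)"
      by (rule continuous_on_eq) (auto simp: rad_def)
    then show ?thesis using False by (simp add: continuous_on_eq_continuous_at open_Compl)
  qed
  then show ?thesis by (simp add: continuous_at_imp_continuous_on)
qed

lemma has_dd_rad:
  assumes F: "\<And>s. (F has_real_derivative F' s) (at s)" and S: "\<And>s. s \<notin> {a..b} \<Longrightarrow> F s = 0"
  shows "has_dd (bas c) (rad F) (\<lambda>p. rad F' p * slg c p)"
  unfolding has_dd_def
proof
  fix p :: "('m, 'k) pt"
  have t: "((\<lambda>r. p + r *\<^sub>R bas c) \<longlongrightarrow> p) (nhds 0)"
    by (intro tendsto_eq_intros) (auto simp: filterlim_ident)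
  show "((\<lambda>r. rad F (p + r *\<^sub>R bas c)) has_real_derivative rad F' p * slg c p) (at 0)"
  proof (cases "p = 0")
    case True
    have "\<forall>\<^sub>F q in nhds p. rad F q = 0" using rad_locally_0[of a b F] S True by blast
    then have "\<forall>\<^sub>F r in nhds 0. rad F (p + r *\<^sub>R bas c) = 0"
      using t unfolding filterlim_iff by blast
    then show ?thesis using DERIV_cong_ev[of 0 0 "\<lambda>r. rad F (p + r *\<^sub>R bas c)" "\<lambda>_. 0" 0 0] True
      by (simp add: rad_def)
  next
    case False
    have "\<forall>\<^sub>F q in nhds p. q \<in> - {0}" using False by (intro eventually_nhds_in_open) auto
    then have "\<forall>\<^sub>F r in nhds 0. p + r *\<^sub>R bas c \<in> - {0}" using t unfolding filterlim_iff by blast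
    then have ev: "\<forall>\<^sub>F r in nhds 0. rad F (p + r *\<^sub>R bas c) = F (lg (p + r *\<^sub>R bas c))"
      by eventually_elim (auto simp: rad_def)
    have "((\<lambda>r. F (lg (p + r *\<^sub>R bas c))) has_real_derivative F' (lg (p + 0 *\<^sub>R bas c)) * slg c p) (at 0)"
      by (rule DERIV_chain2[OF F has_dd_lg[OF False]])
    then show ?thesis using DERIV_cong_ev[OF refl ev refl] False by (simp add: rad_def)
  qed
qed

text \<open>The singular factor 1 / \<open>DD\<close> is moved into the profile as
  \<open>exp (- 2 * kap * s)\<close>, which leaves only continuous factors.\<close>

lemma rad_slg_continuous:
  assumes F: "continuous_on UNIV F" and S: "\<And>s. s \<notin> {a..b} \<Longrightarrow> F s = 0"
  shows "continuous_on A (\<lambda>p. rad F p * slg c p)"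
proof -
  have c: "continuous_on UNIV (rad (\<lambda>s. F s * exp (- 2 * kap * s)))"
    by (rule rad_continuous[of _ a b]) (auto simp: S intro!: continuous_intros F continuous_on_mult)
  have "rad F p * slg c p = rad (\<lambda>s. F s * exp (- 2 * kap * s)) p *
      (case c of Inl i \<Rightarrow> WW p * fst p $ i | Inr j \<Rightarrow> kap * snd p $ j)" for p
    by (cases "p = 0") (auto simp: rad_def slg_def exp_minus exp_lg divide_simps split: sum.split)
  then have e: "(\<lambda>p. rad F p * slg c p) = (\<lambda>p. rad (\<lambda>s. F s * exp (- 2 * kap * s)) p *
      (case c of Inl i \<Rightarrow> WW p * fst p $ i | Inr j \<Rightarrow> kap * snd p $ j))" by blast
  have "continuous_on A (\<lambda>p. case c of Inl i \<Rightarrow> WW p * fst p $ i | Inr j \<Rightarrow> kap * snd p $ j)"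
    by (cases c) (auto intro!: continuous_intros)
  then show ?thesis unfolding e
    by (intro continuous_on_mult continuous_on_subset[OF c]) auto
qed

lemma rad_mm_continuous:
  assumes F: "continuous_on UNIV F" and S: "\<And>s. s \<notin> {a..b} \<Longrightarrow> F s = 0"
  shows "continuous_on A (\<lambda>p. mm p * rad F p)"
proof -
  have c: "continuous_on UNIV (rad (\<lambda>s. F s * exp (- 2 * kap * s)))"
    by (rule rad_continuous[of _ a b]) (auto simp: S intro!: continuous_intros F continuous_on_mult)
  have "mm p * rad F p = WW p * rad (\<lambda>s. F s * exp (- 2 * kap * s)) p" for p
    by (cases "p = 0") (auto simp: rad_def mm_def exp_minus exp_lg divide_simps)
  then have e: "(\<lambda>p. mm p * rad F p) = (\<lambda>p. WW p * rad (\<lambda>s. F s * exp (- 2 * kap * s)) p)" by blast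
  show ?thesis unfolding e
    by (intro continuous_on_mult continuous_on_subset[OF c] continuous_intros) auto
qed

end

section \<open>Integral identities for twice differentiable functions\<close>

lemma has_real_derivative_support:
  assumes "\<And>s. (F has_real_derivative F' s) (at s)" "\<And>s. s \<notin> {a..b} \<Longrightarrow> F s = 0" "s \<notin> {a..b::real}"
  shows "F' s = 0"
proof -
  have "\<forall>\<^sub>F x in nhds s. x \<in> - {a..b}"
    using assms(3) by (intro eventually_nhds_in_open) auto
  then have "\<forall>\<^sub>F x in nhds s. F x = 0" by eventually_elim (use assms(2) in auto)
  then have "(F has_real_derivative 0) (at s)"
    using DERIV_cong_ev[of s s F "\<lambda>_. 0" 0 0] by simp
  then show ?thesis using assms(1) DERIV_unique by blast
qed

context grushin begin

text \<open>The derivatives are carried along as explicit functions, \<open>h2 c d\<close> being the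
  derivative of \<open>h1 c\<close> in direction \<open>d\<close>, so that averaging can act on them
  term by term.\<close>

definition C2 :: "(('m, 'k) pt \<Rightarrow> real) \<Rightarrow> ('m + 'k \<Rightarrow> ('m, 'k) pt \<Rightarrow> real) \<Rightarrow>
    ('m + 'k \<Rightarrow> 'm + 'k \<Rightarrow> ('m, 'k) pt \<Rightarrow> real) \<Rightarrow> bool" where
  "C2 h h1 h2 \<longleftrightarrow> continuous_on UNIV h \<and> (\<forall>c. continuous_on UNIV (h1 c)) \<and>
     (\<forall>c d. continuous_on UNIV (h2 c d)) \<and> (\<forall>c. has_dd (bas c) h (h1 c)) \<and>
     (\<forall>c d. has_dd (bas d) (h1 c) (h2 c d))"

text \<open>With \<open>h1\<close>, \<open>h2\<close> the derivatives of h, \<open>ZZ\<close>,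
  \<open>BB\<close> and \<open>Gam\<close> are Z h, the Baouendi-Grushin operator applied to h, and
  |Xh|^2.\<close>

definition ZZ :: "('m + 'k \<Rightarrow> ('m, 'k) pt \<Rightarrow> real) \<Rightarrow> ('m, 'k) pt \<Rightarrow> real" where
  "ZZ h1 p = (\<Sum>c\<in>UNIV. dil c * (crd c p * h1 c p))"

definition BB :: "('m + 'k \<Rightarrow> 'm + 'k \<Rightarrow> ('m, 'k) pt \<Rightarrow> real) \<Rightarrow> ('m, 'k) pt \<Rightarrow> real" where
  "BB h2 p = (\<Sum>c\<in>UNIV. wgt c p * h2 c c p)"

definition Gam :: "('m + 'k \<Rightarrow> ('m, 'k) pt \<Rightarrow> real) \<Rightarrow> ('m, 'k) pt \<Rightarrow> real" where
  "Gam h1 p = (\<Sum>c\<in>UNIV. wgt c p * (h1 c p)\<^sup>2)"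

lemma C2D:
  assumes "C2 h h1 h2"
  shows "continuous_on A h" "continuous_on A (h1 c)" "continuous_on A (h2 c d)"
    "has_dd (bas c) h (h1 c)" "has_dd (bas d) (h1 c) (h2 c d)"
  using assms unfolding C2_def by (auto intro: continuous_on_subset)

lemma C2_sym: "C2 h h1 h2 \<Longrightarrow> h2 c d = h2 d c"
  by (rule mixed_directional_derivatives_commute[of "bas c" h "h1 c" "bas d" _ "h1 d"])
    (auto simp: C2_def)

lemma ZZ_continuous: "C2 h h1 h2 \<Longrightarrow> continuous_on A (ZZ h1)"
  unfolding ZZ_def by (intro continuous_intros C2D)

lemma BB_continuous: "C2 h h1 h2 \<Longrightarrow> continuous_on A (BB h2)"
  unfolding BB_def by (intro continuous_intros C2D)

lemma Gam_nonneg [simp]: "Gam h1 p \<ge> 0"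
  unfolding Gam_def by (intro sum_nonneg mult_nonneg_nonneg) (auto simp: wgt_def split: sum.split)

text \<open>The inner product of Xh with X ln \<rho>; the derivative of a radial weight always
  enters through this expression.\<close>

lemma sum_wgt_slg: "p \<noteq> 0 \<Longrightarrow> (\<Sum>c\<in>UNIV. slg c p * (wgt c p * h1 c p)) = mm p * ZZ h1 p"
  unfolding ZZ_def sum_distrib_left
proof (rule sum.cong[OF refl])
  fix c assume "p \<noteq> 0"
  from wgt_slg[OF this, of c] show "slg c p * (wgt c p * h1 c p) = mm p * (dil c * (crd c p * h1 c p))"
    by (metis mult.assoc mult.commute)
qed

text \<open>Cauchy--Schwarz for the degenerate inner product of the gradients of \<open>h\<close> and of the
  logarithm of the gauge.\<close>

lemma mm_ZZ_le_Gam: "mm p * (ZZ h1 p)\<^sup>2 \<le> Gam h1 p"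
proof (cases "p = 0 \<or> mm p = 0")
  case True
  then show ?thesis by (auto simp: mm_def)
next
  case False
  then have p: "p \<noteq> 0" and m: "mm p > 0" using mm_nonneg[of p] by (auto simp: less_le)
  let ?w = "\<lambda>c. sqrt (wgt c p)"
  have w: "wgt c p \<ge> 0" for c by (auto simp: wgt_def split: sum.split)
  have "(mm p * ZZ h1 p)\<^sup>2 = (\<Sum>c\<in>UNIV. (?w c * slg c p) * (?w c * h1 c p))\<^sup>2"
    unfolding sum_wgt_slg[OF p, symmetric]
    by (intro arg_cong[where f = "\<lambda>x. x\<^sup>2"] sum.cong refl)
      (metis (no_types, lifting) mult.assoc mult.commute mult.left_commute real_sqrt_mult_self abs_of_nonneg w)
  also have "\<dots> \<le> (\<Sum>c\<in>UNIV. (?w c * slg c p)\<^sup>2) * (\<Sum>c\<in>UNIV. (?w c * h1 c p)\<^sup>2)"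
    by (rule Cauchy_Schwarz_ineq_sum)
  also have "\<dots> = mm p * Gam h1 p"
    unfolding mm_le[OF p, symmetric] Gam_def by (simp add: power_mult_distrib w)
  finally have "mm p * (mm p * (ZZ h1 p)\<^sup>2) \<le> mm p * Gam h1 p"
    by (simp add: power2_eq_square mult_ac)
  then show ?thesis using m by simp
qed

lemma has_dd_wgt: "has_dd (bas c) (wgt c) (\<lambda>p. 0)"
proof (cases c)
  case (Inl i)
  then have "wgt c = (\<lambda>p. 1)" by (auto simp: wgt_def)
  then show ?thesis using has_dd_const by simp
next
  case (Inr j)
  then have "wgt c = WW" by (auto simp: wgt_def)
  then show ?thesis using has_dd_WW_Inr Inr by simp
qed

text \<open>Integrates the divergence of the field \<open>rad G * mm * h^2\<close> times Z. As
  \<open>mm\<close> has degree -2, the divergence of \<open>mm\<close> Z is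
  \<open>2 * qq * mm\<close>.\<close>

lemma zint_radial_square:
  assumes h: "C2 h h1 h2"
    and G: "\<And>s. (G has_real_derivative G' s) (at s)" "continuous_on UNIV G'"
    and S: "\<And>s. s \<notin> {a..b} \<Longrightarrow> G s = 0"
  shows "zint (\<lambda>p. mm p * (rad G p * (2 * h p * ZZ h1 p) + (h p)\<^sup>2 * (rad G' p + 2 * qq * rad G p)))"
proof -
  \<comment> \<open>\<open>H\<close> is \<open>G\<close> / \<open>DD\<close> in the radial variable,
    so \<open>mm * rad G = WW * rad H\<close>: the product rule then only meets
    \<open>WW * crd c\<close>, which is differentiable.\<close>
  define H where "H s = G s * exp (- 2 * kap * s)" for s
  define H' where "H' s = (G' s - 2 * kap * G s) * exp (- 2 * kap * s)" for s
  have Gc: "continuous_on UNIV G" using G(1) DERIV_isCont continuous_at_imp_continuous_on by blast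
  have H: "(H has_real_derivative H' s) (at s)" for s
    unfolding H_def H'_def by (rule derivative_eq_intros G(1) refl)+ (simp add: algebra_simps)
  have S': "s \<notin> {a..b} \<Longrightarrow> G' s = 0" for s
    using has_real_derivative_support[OF G(1) S] by blast
  have HS: "H s = 0" "H' s = 0" if "s \<notin> {a..b}" for s using S S' that by (auto simp: H_def H'_def)
  have rS: "p \<notin> shell a b \<Longrightarrow> rad H p = 0" for p using rad_support[of a b H] HS by blast
  have Hc: "continuous_on UNIV H" "continuous_on UNIV H'"
    unfolding H_def H'_def by (intro continuous_intros Gc G(2))+
  have "zint (\<lambda>p. (rad H' p * slg c p * (h p * h p) + rad H p * (h1 c p * h p + h p * h1 c p)) *
      (dil c * (WW p * crd c p)) + rad H p * (h p * h p) * (dil c * WX c p))" for c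
  proof (rule zint_has_dd[of "bas c" "\<lambda>p. rad H p * (h p * h p) * (dil c * (WW p * crd c p))" _ "shell a b"])
    show "has_dd (bas c) (\<lambda>p. rad H p * (h p * h p) * (dil c * (WW p * crd c p)))
     (\<lambda>p. (rad H' p * slg c p * (h p * h p) + rad H p * (h1 c p * h p + h p * h1 c p)) *
      (dil c * (WW p * crd c p)) + rad H p * (h p * h p) * (dil c * WX c p))"
      by (intro has_dd_mult has_dd_cmult has_dd_WX C2D(4)[OF h] has_dd_rad[of _ _ a b] H HS(1))
  qed (auto simp: rS HS shell_bounded intro!: continuous_intros C2D[OF h]
        rad_continuous[of _ a b] rad_slg_continuous[of _ a b] Hc)
  then have "zint (\<lambda>p. \<Sum>c\<in>UNIV. (rad H' p * slg c p * (h p * h p) + rad H p * (h1 c p * h p + h p * h1 c p)) *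
      (dil c * (WW p * crd c p)) + rad H p * (h p * h p) * (dil c * WX c p))"
    by (intro zint_sum)
  then show ?thesis
  proof (rule zint_cong)
    fix p :: "('m, 'k) pt"
    show "(\<Sum>c\<in>UNIV. (rad H' p * slg c p * (h p * h p) + rad H p * (h1 c p * h p + h p * h1 c p)) *
      (dil c * (WW p * crd c p)) + rad H p * (h p * h p) * (dil c * WX c p)) =
      mm p * (rad G p * (2 * h p * ZZ h1 p) + (h p)\<^sup>2 * (rad G' p + 2 * qq * rad G p))"
    proof (cases "p = 0")
      case False
      have "(\<Sum>c\<in>UNIV. (rad H' p * slg c p * (h p * h p) + rad H p * (h1 c p * h p + h p * h1 c p)) *
          (dil c * (WW p * crd c p)) + rad H p * (h p * h p) * (dil c * WX c p)) =
        (\<Sum>c\<in>UNIV. rad H' p * (h p)\<^sup>2 * WW p * (slg c p * (dil c * crd c p)) +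
            2 * rad H p * h p * WW p * (dil c * (crd c p * h1 c p)) + rad H p * (h p)\<^sup>2 * (dil c * WX c p))"
        by (intro sum.cong refl) (simp add: algebra_simps power2_eq_square)
      also have "\<dots> = rad H' p * (h p)\<^sup>2 * WW p + 2 * rad H p * h p * WW p * ZZ h1 p +
            rad H p * (h p)\<^sup>2 * ((2 * qq + 2 * kap) * WW p)"
        unfolding sum.distrib sum_distrib_left[symmetric] sum_slg[OF False] sum_WX ZZ_def by simp
      also have "\<dots> = mm p * (rad G p * (2 * h p * ZZ h1 p) + (h p)\<^sup>2 * (rad G' p + 2 * qq * rad G p))"
      proof -
        have "exp (- 2 * kap * lg p) = 1 / DD p"
          using exp_lg[OF False] by (simp add: exp_minus inverse_eq_divide)
        then have H: "rad H p = rad G p / DD p" and H': "rad H' p = (rad G' p - 2 * kap * rad G p) / DD p"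
          using False by (auto simp: rad_def H_def H'_def)
        show ?thesis unfolding H H' mm_def
          by (simp add: diff_divide_distrib add_divide_distrib algebra_simps)
      qed
      finally show ?thesis .
    qed (simp add: rad_def)
  qed
qed

text \<open>Integrates the divergence of \<open>rad C * h\<close> times the degenerate gradient of
  h.\<close>

lemma zint_radial_energy:
  assumes h: "C2 h h1 h2"
    and C: "\<And>s. (C has_real_derivative C' s) (at s)" "continuous_on UNIV C'"
    and S: "\<And>s. s \<notin> {a..b} \<Longrightarrow> C s = 0"
  shows "zint (\<lambda>p. rad C p * (h p * BB h2 p + Gam h1 p) + mm p * (rad C' p * (h p * ZZ h1 p)))"
proof -
  have Cc: "continuous_on UNIV C" using C(1) DERIV_isCont continuous_at_imp_continuous_on by blast
  have S': "s \<notin> {a..b} \<Longrightarrow> C' s = 0" for s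
    using has_real_derivative_support[OF C(1) S] by blast
  have rS: "p \<notin> shell a b \<Longrightarrow> rad C p = 0" for p using rad_support[of a b C] S by blast
  have "zint (\<lambda>p. (rad C' p * slg c p * h p + rad C p * h1 c p) * (wgt c p * h1 c p) +
      rad C p * h p * (0 * h1 c p + wgt c p * h2 c c p))" for c
  proof (rule zint_has_dd[of "bas c" "\<lambda>p. rad C p * h p * (wgt c p * h1 c p)" _ "shell a b"])
    show "has_dd (bas c) (\<lambda>p. rad C p * h p * (wgt c p * h1 c p))
     (\<lambda>p. (rad C' p * slg c p * h p + rad C p * h1 c p) * (wgt c p * h1 c p) +
      rad C p * h p * (0 * h1 c p + wgt c p * h2 c c p))"
      by (intro has_dd_mult has_dd_wgt C2D(4,5)[OF h] has_dd_rad[of _ _ a b] C S)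
  qed (auto simp: rS S S' shell_bounded intro!: continuous_intros C2D[OF h]
        rad_continuous[of _ a b] rad_slg_continuous[of _ a b] Cc C)
  then have "zint (\<lambda>p. \<Sum>c\<in>UNIV. (rad C' p * slg c p * h p + rad C p * h1 c p) * (wgt c p * h1 c p) +
      rad C p * h p * (0 * h1 c p + wgt c p * h2 c c p))"
    by (intro zint_sum)
  then show ?thesis
  proof (rule zint_cong)
    fix p :: "('m, 'k) pt"
    have "(\<Sum>c\<in>UNIV. (rad C' p * slg c p * h p + rad C p * h1 c p) * (wgt c p * h1 c p) +
      rad C p * h p * (0 * h1 c p + wgt c p * h2 c c p)) =
       (\<Sum>c\<in>UNIV. rad C' p * h p * (slg c p * (wgt c p * h1 c p)) + rad C p * (wgt c p * (h1 c p)\<^sup>2) +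
      rad C p * h p * (wgt c p * h2 c c p))"
      by (intro sum.cong refl) (simp add: algebra_simps power2_eq_square)
    also have "\<dots> = rad C' p * h p * (mm p * ZZ h1 p) + rad C p * Gam h1 p + rad C p * h p * BB h2 p"
      unfolding sum.distrib sum_distrib_left[symmetric] Gam_def[symmetric] BB_def[symmetric]
      by (cases "p = 0") (auto simp: rad_def sum_wgt_slg)
    finally show "(\<Sum>c\<in>UNIV. (rad C' p * slg c p * h p + rad C p * h1 c p) * (wgt c p * h1 c p) +
      rad C p * h p * (0 * h1 c p + wgt c p * h2 c c p)) =
      rad C p * (h p * BB h2 p + Gam h1 p) + mm p * (rad C' p * (h p * ZZ h1 p))"
      by (simp add: algebra_simps)
  qed
qed

text \<open>The Rellich-Pohozaev identity: the divergence of \<open>rad A\<close> times (2 Zh grad h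
  - |Xh|^2 Z), where grad is the degenerate gradient. Mixed second derivatives cancel by symmetry,
  and the divergence of Z together with its commutator with the operator leaves the factor
  \<open>2 * qq\<close>.\<close>

lemma zint_rellich:
  assumes h: "C2 h h1 h2"
    and A: "\<And>s. (A has_real_derivative A' s) (at s)" "continuous_on UNIV A'"
    and S: "\<And>s. s \<notin> {a..b} \<Longrightarrow> A s = 0"
  shows "zint (\<lambda>p. 2 * rad A p * ZZ h1 p * BB h2 p - Gam h1 p * (rad A' p + 2 * qq * rad A p)
      + 2 * mm p * rad A' p * (ZZ h1 p)\<^sup>2)"
proof -
  have Ac: "continuous_on UNIV A" using A(1) DERIV_isCont continuous_at_imp_continuous_on by blast
  have S': "s \<notin> {a..b} \<Longrightarrow> A' s = 0" for s
    using has_real_derivative_support[OF A(1) S] by blast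
  have rS: "p \<notin> shell a b \<Longrightarrow> rad A p = 0" for p using rad_support[of a b A] S by blast
  \<comment> \<open>\<open>Gam\<close> is split as P + WW T because \<open>WW\<close> may not be
    differentiated in z by itself; multiplied by a coordinate it may.\<close>
  define P where "P p = (\<Sum>i\<in>UNIV. h1 (Inl i) p * h1 (Inl i) p)" for p
  define T where "T p = (\<Sum>j\<in>UNIV. h1 (Inr j) p * h1 (Inr j) p)" for p
  define P' where "P' c p = (\<Sum>i\<in>UNIV. h2 (Inl i) c p * h1 (Inl i) p + h1 (Inl i) p * h2 (Inl i) c p)" for c p
  define T' where "T' c p = (\<Sum>j\<in>UNIV. h2 (Inr j) c p * h1 (Inr j) p + h1 (Inr j) p * h2 (Inr j) c p)" for c p
  define Y where "Y c p = (\<Sum>d\<in>UNIV. dil d * ((if d = c then 1 else 0) * h1 d p + crd d p * h2 d c p))" for c p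
  have dP: "has_dd (bas c) P (P' c)" and dT: "has_dd (bas c) T (T' c)" for c
    unfolding P_def[abs_def] T_def[abs_def] P'_def[abs_def] T'_def[abs_def]
    by (intro has_dd_sum has_dd_mult C2D[OF h])+
  have dY: "has_dd (bas c) (ZZ h1) (Y c)" for c
    unfolding ZZ_def[abs_def] Y_def[abs_def]
    by (intro has_dd_sum has_dd_cmult has_dd_mult has_dd_crd C2D[OF h])
  have cont: "continuous_on UNIV P" "continuous_on UNIV T" "continuous_on UNIV (P' c)"
    "continuous_on UNIV (T' c)" "continuous_on UNIV (Y c)" for c
    unfolding P_def[abs_def] T_def[abs_def] P'_def[abs_def] T'_def[abs_def] Y_def[abs_def]
    by (intro continuous_intros C2D[OF h])+
  define F1 where "F1 c p = (rad A' p * slg c p) * (ZZ h1 p * (wgt c p * h1 c p)) +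
      rad A p * (Y c p * (wgt c p * h1 c p) + ZZ h1 p * (0 * h1 c p + wgt c p * h2 c c p))" for c p
  define F2 where "F2 c p = (rad A' p * slg c p) * (dil c * (crd c p * P p + WW p * crd c p * T p)) +
      rad A p * (dil c * (((if c = c then 1 else 0) * P p + crd c p * P' c p) +
        (WX c p * T p + WW p * crd c p * T' c p)))" for c p
  have z1: "zint (F1 c)" for c
  proof (rule zint_has_dd[of "bas c" "\<lambda>p. rad A p * (ZZ h1 p * (wgt c p * h1 c p))" _ "shell a b"])
    show "has_dd (bas c) (\<lambda>p. rad A p * (ZZ h1 p * (wgt c p * h1 c p))) (F1 c)"
      unfolding F1_def[abs_def]
      by (intro has_dd_mult has_dd_wgt C2D(4,5)[OF h] has_dd_rad[of _ _ a b] A S dY)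
    show "continuous_on UNIV (F1 c)" unfolding F1_def[abs_def]
      by (intro continuous_intros C2D[OF h] ZZ_continuous[OF h] cont
        rad_continuous[of _ a b] rad_slg_continuous[of _ a b] Ac A S S')
    show "continuous_on UNIV (\<lambda>p. rad A p * (ZZ h1 p * (wgt c p * h1 c p)))"
      by (intro continuous_intros C2D[OF h] ZZ_continuous[OF h] rad_continuous[of _ a b] Ac S)
  qed (auto simp: rS S shell_bounded)
  have z2: "zint (F2 c)" for c
  proof (rule zint_has_dd[of "bas c" "\<lambda>p. rad A p * (dil c * (crd c p * P p + WW p * crd c p * T p))" _ "shell a b"])
    show "has_dd (bas c) (\<lambda>p. rad A p * (dil c * (crd c p * P p + WW p * crd c p * T p))) (F2 c)"
      unfolding F2_def[abs_def]
      by (intro has_dd_mult has_dd_cmult has_dd_add has_dd_rad[of _ _ a b] A S dP dT has_dd_crd has_dd_WX)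
    show "continuous_on UNIV (F2 c)" unfolding F2_def[abs_def]
      by (intro continuous_intros cont rad_continuous[of _ a b] rad_slg_continuous[of _ a b] Ac A S S')
    show "continuous_on UNIV (\<lambda>p. rad A p * (dil c * (crd c p * P p + WW p * crd c p * T p)))"
      by (intro continuous_intros cont rad_continuous[of _ a b] Ac S)
  qed (auto simp: rS S shell_bounded)
  have "zint (\<lambda>p. 2 * (\<Sum>c\<in>UNIV. F1 c p) - (\<Sum>c\<in>UNIV. F2 c p))"
    by (intro zint_diff zint_cmult zint_sum z1 z2)
  then show ?thesis
  proof (rule zint_cong)
    fix p :: "('m, 'k) pt"
    \<comment> \<open>\<open>M\<close> collects the mixed second order terms. They occur once in the
      sum of \<open>F1\<close> and, by symmetry of \<open>h2\<close>, twice in that of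
      \<open>F2\<close>, hence not in the combination.\<close>
    define M where "M = (\<Sum>c\<in>UNIV. \<Sum>d\<in>UNIV. dil d * crd d p * h2 d c p * (wgt c p * h1 c p))"
    have G: "Gam h1 p = P p + WW p * T p"
      unfolding Gam_def sum_Plus P_def T_def by (simp add: wgt_def power2_eq_square sum_distrib_left)
    have r1: "rad A' p * (\<Sum>c\<in>UNIV. slg c p * (wgt c p * h1 c p)) = rad A' p * (mm p * ZZ h1 p)"
      by (cases "p = 0") (auto simp: rad_def sum_wgt_slg)
    have r2: "rad A' p * (\<Sum>c\<in>UNIV. slg c p * (dil c * crd c p)) = rad A' p"
      by (cases "p = 0") (auto simp: rad_def sum_slg)
    have Yd: "Y c p = dil c * h1 c p + (\<Sum>d\<in>UNIV. dil d * crd d p * h2 d c p)" for c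
      unfolding Y_def by (simp add: distrib_left sum.distrib if_distrib[of "\<lambda>x. x * _"]
          if_distrib[of "\<lambda>x. _ * x"] mult_ac cong: if_cong)
    have w: "(\<Sum>c\<in>UNIV. dil c * h1 c p * (wgt c p * h1 c p)) = P p + kap * (WW p * T p)"
      unfolding sum_Plus P_def T_def by (simp add: dil_def wgt_def sum_distrib_left mult_ac)
    have "(\<Sum>c\<in>UNIV. F1 c p) = (\<Sum>c\<in>UNIV. ZZ h1 p * rad A' p * (slg c p * (wgt c p * h1 c p)) +
        rad A p * (dil c * h1 c p * (wgt c p * h1 c p)) +
        rad A p * (\<Sum>d\<in>UNIV. dil d * crd d p * h2 d c p * (wgt c p * h1 c p)) +
        rad A p * ZZ h1 p * (wgt c p * h2 c c p))"
      unfolding F1_def Yd sum_distrib_right[symmetric]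
      by (intro sum.cong refl) (simp add: algebra_simps)
    also have "\<dots> = ZZ h1 p * (rad A' p * (mm p * ZZ h1 p)) + rad A p * (P p + kap * (WW p * T p)) +
        rad A p * M + rad A p * ZZ h1 p * BB h2 p"
      unfolding sum.distrib sum_distrib_left[symmetric] w BB_def[symmetric] M_def
      using r1 by (simp add: mult.assoc)
    finally have s1: "(\<Sum>c\<in>UNIV. F1 c p) = ZZ h1 p * (rad A' p * (mm p * ZZ h1 p)) +
        rad A p * (P p + kap * (WW p * T p)) + rad A p * M + rad A p * ZZ h1 p * BB h2 p" .
    have PT: "P' c p + WW p * T' c p = 2 * (\<Sum>d\<in>UNIV. wgt d p * h1 d p * h2 d c p)" for c
      unfolding sum_Plus P'_def T'_def
      by (simp add: wgt_def sum_distrib_left sum.distrib algebra_simps)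
    have "(\<Sum>c\<in>UNIV. \<Sum>d\<in>UNIV. dil c * crd c p * (wgt d p * h1 d p * h2 d c p)) =
       (\<Sum>d\<in>UNIV. \<Sum>c\<in>UNIV. dil c * crd c p * (wgt d p * h1 d p * h2 d c p))"
      by (rule sum.swap)
    also have "\<dots> = M" unfolding M_def
    proof (intro sum.cong refl)
      fix c d
      have "h2 c d p = h2 d c p" using C2_sym[OF h] by metis
      then show "dil d * crd d p * (wgt c p * h1 c p * h2 c d p) = dil d * crd d p * h2 d c p * (wgt c p * h1 c p)"
        by simp
    qed
    finally have M2: "(\<Sum>c\<in>UNIV. \<Sum>d\<in>UNIV. dil c * crd c p * (wgt d p * h1 d p * h2 d c p)) = M" .
    have a1: "(\<Sum>c\<in>UNIV. (P p + WW p * T p) * rad A' p * (slg c p * (dil c * crd c p))) =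
        (P p + WW p * T p) * rad A' p"
      unfolding sum_distrib_left[symmetric] using r2 by (simp add: mult.assoc)
    have a2: "(\<Sum>c\<in>UNIV. rad A p * (dil c * crd c p * (P' c p + WW p * T' c p))) = rad A p * (2 * M)"
      unfolding M2[symmetric] PT by (simp add: sum_distrib_left mult_ac)
    have "(\<Sum>c\<in>UNIV. F2 c p) = (\<Sum>c\<in>UNIV. (P p + WW p * T p) * rad A' p * (slg c p * (dil c * crd c p)) +
        rad A p * P p * dil c + rad A p * T p * (dil c * WX c p) +
        rad A p * (dil c * crd c p * (P' c p + WW p * T' c p)))"
      unfolding F2_def by (intro sum.cong refl) (simp add: algebra_simps)
    also have "\<dots> = (P p + WW p * T p) * rad A' p + rad A p * P p * (2 * qq + 2) +
        rad A p * T p * ((2 * qq + 2 * kap) * WW p) + rad A p * (2 * M)"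
      unfolding sum.distrib a1 a2 unfolding sum_distrib_left[symmetric] sum_dil sum_WX by simp
    finally have s2: "(\<Sum>c\<in>UNIV. F2 c p) = (P p + WW p * T p) * rad A' p + rad A p * P p * (2 * qq + 2) +
        rad A p * T p * ((2 * qq + 2 * kap) * WW p) + rad A p * (2 * M)" .
    show "2 * (\<Sum>c\<in>UNIV. F1 c p) - (\<Sum>c\<in>UNIV. F2 c p) =
       2 * rad A p * ZZ h1 p * BB h2 p - Gam h1 p * (rad A' p + 2 * qq * rad A p)
      + 2 * mm p * rad A' p * (ZZ h1 p)\<^sup>2"
      unfolding s1 s2 G by (simp add: algebra_simps power2_eq_square)
  qed
qed

end

section \<open>A Carleman inequality\<close>

text \<open>Pointwise form of the inequality; \<open>m\<close>, \<open>\<Gamma>\<close> and \<open>B\<close> stand for the density, the squared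
  degenerate gradient and the operator applied to \<open>h\<close>, \<open>z\<close> for its derivative along dilations, and
  \<open>b\<close>, \<open>b1\<close> for the profile and its derivative, where \<open>b1' = b1\<close>.\<close>

lemma carleman_pointwise:
  fixes m \<Gamma> B h z e e1 e2 x xi xii E b b1 q :: real
  defines "A \<equiv> e * b * E"
    and "A1 \<equiv> e1 * b * E + e * (b1 - 2 * b\<^sup>2) * E"
    and "A2 \<equiv> e2 * b * E + 2 * e1 * (b1 - 2 * b\<^sup>2) * E
        + e * (b1 - 4 * b * b1) * E - 2 * b * e * (b1 - 2 * b\<^sup>2) * E"
    and "\<beta> \<equiv> 2 * b * (q - b) + b1"
    and "g \<equiv> - b1 / 2 - b * b1 + 2 * b ^ 3 + q * b1 - 2 * q * b\<^sup>2"
    and "g1 \<equiv> - b1 / 2 - b1\<^sup>2 - b * b1 + 6 * b\<^sup>2 * b1 + q * b1 - 4 * q * b * b1"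
  assumes pos: "m \<ge> 0" "e \<ge> 0" "E \<ge> 0" "b1 \<le> 0" "x \<ge> 0"
    and Gam: "m * z\<^sup>2 \<le> \<Gamma>"
    and x: "2 * \<bar>e1 * b * E\<bar> \<le> x" "\<bar>e1 * E * \<beta> + e2 * b * E + e1 * (b1 - 2 * b\<^sup>2) * E\<bar> \<le> 2 * x"
      "\<bar>e1 * E * g\<bar> \<le> x"
  shows "m * (e * E * (2 * b * z + \<beta> * h)\<^sup>2) + m * (e * E * (- 2 * b1) * (b\<^sup>2 - 1 / 4)) * h\<^sup>2 \<le>
     e * E * B * (2 * b * z + \<beta> * h)
     - (2 * A * z * B - \<Gamma> * (A1 + 2 * q * A) + 2 * m * A1 * z\<^sup>2)
     - ((A1 + 2 * q * A) * (h * B + \<Gamma>) + m * ((A2 + 2 * q * A1) * (h * z)))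
     - m * (e * E * g * (2 * h * z) + h\<^sup>2 * (e1 * E * g + e * E * (g1 - 2 * b * g) + 2 * q * (e * E * g)))
     + 2 * (x * (h * B + \<Gamma>) + m * (xi * (h * z)))
     - m * (xi * (2 * h * z) + h\<^sup>2 * (xii + 2 * q * xi))
     + 3 * (x * \<bar>h * B\<bar>) + m * (2 * x + \<bar>xii + 2 * q * xi\<bar>) * h\<^sup>2"
proof -
  define y where "y = e1 * E * \<beta> + e2 * b * E + e1 * (b1 - 2 * b\<^sup>2) * E"
  \<comment> \<open>The weight A' + 2 q A of the energy identity is the coefficient of
    \<open>\<Gamma>\<close> in the Rellich identity, so \<open>\<Gamma>\<close> disappears, and
    \<open>B\<close> survives only next to \<open>e1\<close>. The function \<open>g\<close> is the
    one for which the products of h and z match when the two squares are completed. Everything in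
    the last bracket contains a derivative of \<open>e\<close>.\<close>
  have id: "e * E * B * (2 * b * z + \<beta> * h)
     - (2 * A * z * B - \<Gamma> * (A1 + 2 * q * A) + 2 * m * A1 * z\<^sup>2)
     - ((A1 + 2 * q * A) * (h * B + \<Gamma>) + m * ((A2 + 2 * q * A1) * (h * z)))
     - m * (e * E * g * (2 * h * z) + h\<^sup>2 * (e1 * E * g + e * E * (g1 - 2 * b * g) + 2 * q * (e * E * g)))
    = - (e1 * b * E) * (h * B) + m * (e * E * (2 * b * z + \<beta> * h)\<^sup>2)
      + m * (2 * e * E * (- b1) * (z + (q - b) * h)\<^sup>2)
      + m * (e * E * (- 2 * b1) * (b\<^sup>2 - 1 / 4)) * h\<^sup>2
      - m * (h\<^sup>2 * (e1 * E * g) + 2 * (e1 * b * E) * z\<^sup>2 + y * (h * z))"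
    unfolding A_def A1_def A2_def \<beta>_def g_def g1_def y_def
    by (simp add: field_simps power2_eq_square power3_eq_cube)
  have sq: "m * (2 * e * E * (- b1) * (z + (q - b) * h)\<^sup>2) \<ge> 0"
    using pos by (intro mult_nonneg_nonneg) auto
  have r1: "h\<^sup>2 * (e1 * E * g) \<le> h\<^sup>2 * x" using x(3) by (intro mult_left_mono) auto
  have r2: "2 * (e1 * b * E) * z\<^sup>2 \<le> x * z\<^sup>2" using x(1) by (intro mult_right_mono) auto
  have "2 * \<bar>h * z\<bar> \<le> h\<^sup>2 + z\<^sup>2"
    using sum_squares_bound[of "\<bar>h\<bar>" "\<bar>z\<bar>"] by (simp add: abs_mult)
  then have "x * (2 * \<bar>h * z\<bar>) \<le> x * (h\<^sup>2 + z\<^sup>2)"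
    by (rule mult_left_mono[OF _ pos(5)])
  then have "2 * x * \<bar>h * z\<bar> \<le> x * (h\<^sup>2 + z\<^sup>2)" by (simp only: mult_ac)
  moreover have "y * (h * z) \<le> 2 * x * \<bar>h * z\<bar>"
  proof -
    have "y * (h * z) \<le> \<bar>y\<bar> * \<bar>h * z\<bar>" by (metis abs_ge_self abs_mult)
    also have "\<dots> \<le> 2 * x * \<bar>h * z\<bar>" using x(2) by (intro mult_right_mono) (auto simp: y_def)
    finally show ?thesis .
  qed
  ultimately have r3: "y * (h * z) \<le> x * h\<^sup>2 + x * z\<^sup>2" by (simp add: algebra_simps)
  have "m * (h\<^sup>2 * (e1 * E * g) + 2 * (e1 * b * E) * z\<^sup>2 + y * (h * z)) \<le> m * (2 * x * h\<^sup>2 + 2 * x * z\<^sup>2)"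
    using r1 r2 r3 by (intro mult_left_mono pos) (simp add: algebra_simps)
  also have "\<dots> = 2 * x * m * h\<^sup>2 + 2 * x * (m * z\<^sup>2)" by (simp add: algebra_simps)
  \<comment> \<open>The errors in z^2 are traded for \<open>\<Gamma>\<close>, which the identities
    weighted by \<open>x\<close> supply.\<close>
  also have "\<dots> \<le> 2 * x * m * h\<^sup>2 + 2 * x * \<Gamma>"
    using mult_left_mono[OF Gam, of "2 * x"] pos(5) by simp
  finally have r: "m * (h\<^sup>2 * (e1 * E * g) + 2 * (e1 * b * E) * z\<^sup>2 + y * (h * z)) \<le> 2 * x * m * h\<^sup>2 + 2 * x * \<Gamma>" .
  have t1: "e1 * b * E * (h * B) \<le> x * \<bar>h * B\<bar>"
  proof -
    have "e1 * b * E * (h * B) \<le> \<bar>e1 * b * E\<bar> * \<bar>h * B\<bar>" by (metis abs_ge_self abs_mult)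
    also have "\<dots> \<le> x * \<bar>h * B\<bar>" using x(1) by (intro mult_right_mono) auto
    finally show ?thesis .
  qed
  have t2: "- (2 * x * (h * B)) \<le> 2 * (x * \<bar>h * B\<bar>)"
    using mult_left_mono[of "- (h * B)" "\<bar>h * B\<bar>" "2 * x"] pos(5) by simp
  have t3: "m * (h\<^sup>2 * (xii + 2 * q * xi)) \<le> m * (h\<^sup>2 * \<bar>xii + 2 * q * xi\<bar>)"
    using pos(1) by (intro mult_left_mono) auto
  \<comment> \<open>Twice the energy identity minus the square identity: the mixed terms with
    \<open>xi\<close> drop out, as in Caccioppoli's inequality.\<close>
  have e1: "2 * (x * (h * B + \<Gamma>) + m * (xi * (h * z))) - m * (xi * (2 * h * z) + h\<^sup>2 * (xii + 2 * q * xi))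
     = 2 * x * (h * B) + 2 * x * \<Gamma> - m * (h\<^sup>2 * (xii + 2 * q * xi))"
    by (simp add: algebra_simps)
  have e2: "m * (2 * x + \<bar>xii + 2 * q * xi\<bar>) * h\<^sup>2 = 2 * x * m * h\<^sup>2 + m * (h\<^sup>2 * \<bar>xii + 2 * q * xi\<bar>)"
    by (simp add: algebra_simps)
  have t1': "- (x * \<bar>h * B\<bar>) \<le> - (e1 * b * E) * (h * B)" using t1 by simp
  \<comment> \<open>The final bookkeeping is linear once every product is treated as a single
    quantity.\<close>
  have gen: "X1 + X2 \<le> ID + U - U' + 3 * t + V"
    if "ID = P + X1 + sq + X2 - XR" "sq \<ge> 0" "XR \<le> r1 + r2" "- t \<le> P" "- w \<le> 2 * t" "u \<le> u'"
      "U - U' = w + r2 - u" "V = r1 + u'" for X1 X2 ID U U' t V P sq XR r1 r2 w u u' :: real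
    using that by linarith
  have e1': "2 * (x * (h * B + \<Gamma>) + m * (xi * (h * z))) - m * (xi * (2 * h * z) + h\<^sup>2 * (xii + 2 * q * xi))
     = 2 * x * (h * B) + 2 * x * \<Gamma> - m * (h\<^sup>2 * (xii + 2 * q * xi))" using e1 .
  show ?thesis by (rule gen[OF id sq r t1' _ t3 e1' e2]) (use t2 in simp)
qed

section \<open>The exponential profile and the integrated inequality\<close>

locale carleman_profile = grushin \<gamma> dims
  for \<gamma> :: real and dims :: "('m::finite \<times> 'k::finite) itself" +
  fixes al s0 :: real
  assumes al: "al \<ge> 0"
begin

text \<open>The exponential is chosen because \<open>bb1\<close> is the derivative of
  \<open>bb\<close> and also its own, so second derivatives of the weights bring no new
  function.\<close>

definition "bb s = al * (1 - exp (s - s0) / 2)"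
definition "bb1 s = - (al * exp (s - s0) / 2)"
text \<open>The exponent is -2 times an antiderivative of \<open>bb\<close>; the square root of
  \<open>EE\<close> is the Carleman weight.\<close>

definition "EE s = exp (- 2 * (al * (s - s0) - al / 2 * exp (s - s0)))"
definition "bet s = 2 * bb s * (qq - bb s) + bb1 s"
definition "gg s = - bb1 s / 2 - bb s * bb1 s + 2 * bb s ^ 3 + qq * bb1 s - 2 * qq * (bb s)\<^sup>2"

lemma EE_pos: "EE s > 0" by (simp add: EE_def)

lemma bb_deriv: "(bb has_real_derivative bb1 s) (at s)"
  unfolding bb_def[abs_def] bb1_def by (auto intro!: derivative_eq_intros)

lemma bb1_deriv: "(bb1 has_real_derivative bb1 s) (at s)"
  unfolding bb1_def[abs_def] by (auto intro!: derivative_eq_intros)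

lemma EE_deriv: "(EE has_real_derivative - 2 * bb s * EE s) (at s)"
  unfolding EE_def[abs_def] bb_def by (rule derivative_eq_intros refl)+ (simp add: algebra_simps)

lemma profile_continuous [continuous_intros]:
  "continuous_on A bb" "continuous_on A bb1" "continuous_on A EE" "continuous_on A bet" "continuous_on A gg"
  unfolding bb_def bb1_def EE_def bet_def gg_def by (auto intro!: continuous_intros)

text \<open>For w = \<open>EE\<close>^(1/2) \<rho>^\<open>qq\<close> h one has Z w =
  \<open>EE\<close>^(1/2) \<rho>^\<open>qq\<close> (Zh + (\<open>qq\<close> - \<open>bb\<close>) h),
  so \<open>TT\<close> is 2 b Z w + b' w divided by the common factor.\<close>

definition "TT h h1 p = 2 * bb (lg p) * ZZ h1 p + bet (lg p) * (h p :: real)"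

end

text \<open>\<open>eta\<close> cuts off, and \<open>zeta\<close> majorizes all terms in which
  \<open>eta\<close> has been differentiated; the three inequalities \<open>cutoff\<close> are those
  that \<open>carleman_pointwise\<close> asks of \<open>x\<close>.\<close>

locale carleman_weights = carleman_profile \<gamma> dims al s0
  for \<gamma> :: real and dims :: "('m::finite \<times> 'k::finite) itself" and al s0 :: real +
  fixes a b :: real and eta eta1 eta2 zeta zeta1 zeta2 :: "real \<Rightarrow> real"
  assumes eta: "(eta has_real_derivative eta1 s) (at s)" "(eta1 has_real_derivative eta2 s) (at s)"
      "continuous_on UNIV eta2" "s \<notin> {a..b} \<Longrightarrow> eta s = 0" "eta s \<ge> 0"
    and zeta: "(zeta has_real_derivative zeta1 s) (at s)" "(zeta1 has_real_derivative zeta2 s) (at s)"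
      "continuous_on UNIV zeta2" "s \<notin> {a..b} \<Longrightarrow> zeta s = 0" "zeta s \<ge> 0"
    and cutoff: "2 * \<bar>eta1 s * bb s * EE s\<bar> \<le> zeta s"
      "\<bar>eta1 s * EE s * bet s + eta2 s * bb s * EE s + eta1 s * (bb1 s - 2 * (bb s)\<^sup>2) * EE s\<bar> \<le> 2 * zeta s"
      "\<bar>eta1 s * EE s * gg s\<bar> \<le> zeta s"
begin

lemma cutoff_continuous [continuous_intros]:
  "continuous_on A eta" "continuous_on A eta1" "continuous_on A eta2"
  "continuous_on A zeta" "continuous_on A zeta1" "continuous_on A zeta2"
proof -
  have d: "continuous_on A f" if "\<And>s. (f has_real_derivative f' s) (at s)" for f f' :: "real \<Rightarrow> real"
    using that DERIV_isCont continuous_at_imp_continuous_on by blast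
  show "continuous_on A eta" "continuous_on A eta1" "continuous_on A zeta" "continuous_on A zeta1"
    using d[of eta] d[of eta1] d[of zeta] d[of zeta1] eta(1,2) zeta(1,2) by blast+
  show "continuous_on A eta2" "continuous_on A zeta2"
    using eta(3) zeta(3) continuous_on_subset by blast+
qed

lemma cutoff_support:
  assumes "s \<notin> {a..b}"
  shows "eta s = 0" "eta1 s = 0" "eta2 s = 0" "zeta s = 0" "zeta1 s = 0" "zeta2 s = 0"
proof -
  have e: "eta s = 0" "eta1 s = 0" if "s \<notin> {a..b}" for s
    using that eta(4) has_real_derivative_support[of eta eta1 a b s] eta(1) by auto
  have z: "zeta s = 0" "zeta1 s = 0" if "s \<notin> {a..b}" for s
    using that zeta(4) has_real_derivative_support[of zeta zeta1 a b s] zeta(1) by auto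
  show "eta s = 0" "eta1 s = 0" "zeta s = 0" "zeta1 s = 0" using e z assms by auto
  show "eta2 s = 0" using has_real_derivative_support[of eta1 eta2 a b s] eta(2) e(2) assms by auto
  show "zeta2 s = 0" using has_real_derivative_support[of zeta1 zeta2 a b s] zeta(2) z(2) assms by auto
qed

lemma rad_weight_continuous:
  "continuous_on UNIV F \<Longrightarrow> (\<And>s. s \<notin> {a..b} \<Longrightarrow> F s = 0) \<Longrightarrow> continuous_on A (rad F)"
  by (rule rad_continuous[of F a b])

lemma integrable_rad_weight:
  assumes "continuous_on UNIV F" "\<And>s. s \<notin> {a..b} \<Longrightarrow> F s = 0" "continuous_on UNIV f"
  shows "integrable lborel (\<lambda>p. rad F p * f p)"
proof (rule integrable_continuous_bounded_support[of _ "shell a b"])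
  show "continuous_on UNIV (\<lambda>p. rad F p * f p)"
    by (intro continuous_intros rad_weight_continuous assms)
  show "rad F p * f p = 0" if "p \<notin> shell a b" for p
    using rad_support[of a b F p] assms(2) that by simp
qed (rule shell_bounded)

lemma integrable_mm_rad_weight:
  assumes "continuous_on UNIV F" "\<And>s. s \<notin> {a..b} \<Longrightarrow> F s = 0" "continuous_on UNIV f"
  shows "integrable lborel (\<lambda>p. mm p * rad F p * f p)"
proof (rule integrable_continuous_bounded_support[of _ "shell a b"])
  show "continuous_on UNIV (\<lambda>p. mm p * rad F p * f p)"
    by (intro continuous_intros rad_mm_continuous[of _ a b] assms)
  show "mm p * rad F p * f p = 0" if "p \<notin> shell a b" for p
    using rad_support[of a b F p] assms(2) that by simp
qed (rule shell_bounded)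

text \<open>\<open>carleman_pointwise\<close> integrated: what it adds on the right beyond the terms
  kept here has integral zero. The gradient survives only in the square of \<open>TT\<close>, which
  is kept on the left to absorb the potential later.\<close>

lemma carleman_C2:
  assumes h: "C2 h h1 h2"
  shows "(LINT p|lborel. mm p * rad (\<lambda>s. eta s * EE s) p * (TT h h1 p)\<^sup>2)
      + (LINT p|lborel. mm p * rad (\<lambda>s. eta s * EE s * (- 2 * bb1 s) * ((bb s)\<^sup>2 - 1 / 4)) p * (h p)\<^sup>2)
    \<le> (LINT p|lborel. rad (\<lambda>s. eta s * EE s) p * BB h2 p * TT h h1 p)
      + (LINT p|lborel. rad zeta p * (3 * \<bar>h p * BB h2 p\<bar>))
      + (LINT p|lborel. mm p * rad (\<lambda>s. 2 * zeta s + \<bar>zeta2 s + 2 * qq * zeta1 s\<bar>) p * (h p)\<^sup>2)"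
    and "integrable lborel (\<lambda>p. mm p * rad (\<lambda>s. eta s * EE s) p * (TT h h1 p)\<^sup>2)"
    and "integrable lborel (\<lambda>p. rad (\<lambda>s. eta s * EE s) p * BB h2 p * TT h h1 p)"
proof -
  define g1 where "g1 s = - bb1 s / 2 - (bb1 s)\<^sup>2 - bb s * bb1 s + 6 * (bb s)\<^sup>2 * bb1 s + qq * bb1 s - 4 * qq * bb s * bb1 s" for s
  define A where "A s = eta s * bb s * EE s" for s
  define A1 where "A1 s = eta1 s * bb s * EE s + eta s * (bb1 s - 2 * (bb s)\<^sup>2) * EE s" for s
  define A2 where "A2 s = eta2 s * bb s * EE s + 2 * eta1 s * (bb1 s - 2 * (bb s)\<^sup>2) * EE s
        + eta s * (bb1 s - 4 * bb s * bb1 s) * EE s - 2 * bb s * eta s * (bb1 s - 2 * (bb s)\<^sup>2) * EE s" for s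
  define G where "G s = eta s * EE s * gg s" for s
  define G' where "G' s = eta1 s * EE s * gg s + eta s * EE s * (g1 s - 2 * bb s * gg s)" for s
  have dgg: "(gg has_real_derivative g1 s) (at s)" for s
    unfolding gg_def[abs_def] g1_def
    by (auto intro!: derivative_eq_intros bb_deriv bb1_deriv simp: power2_eq_square field_simps)
  have dA: "(A has_real_derivative A1 s) (at s)" for s
    unfolding A_def[abs_def] A1_def
    by (rule derivative_eq_intros eta bb_deriv EE_deriv refl)+ (simp add: power2_eq_square algebra_simps)
  have dA1: "(A1 has_real_derivative A2 s) (at s)" for s
    unfolding A1_def[abs_def] A2_def
    by (rule derivative_eq_intros eta bb_deriv bb1_deriv EE_deriv refl)+ (simp add: power2_eq_square algebra_simps)
  \<comment> \<open>The weight of the energy identity, prescribed by the coefficient of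
    \<open>Gam\<close> in the Rellich identity.\<close>
  have dC: "((\<lambda>s. A1 s + 2 * qq * A s) has_real_derivative A2 s + 2 * qq * A1 s) (at s)" for s
    by (rule derivative_eq_intros dA dA1 refl)+ simp
  have dG: "(G has_real_derivative G' s) (at s)" for s
    unfolding G_def[abs_def] G'_def
    by (rule derivative_eq_intros eta dgg EE_deriv refl)+ (simp add: algebra_simps)
  have cg1: "continuous_on UNIV g1" unfolding g1_def[abs_def] by (auto intro!: continuous_intros)
  have cA: "continuous_on UNIV A1" "continuous_on UNIV (\<lambda>s. A2 s + 2 * qq * A1 s)" "continuous_on UNIV G'"
    unfolding A1_def A2_def G'_def by (intro continuous_intros cg1)+
  have S: "A s = 0" "A1 s + 2 * qq * A s = 0" "G s = 0" if "s \<notin> {a..b}" for s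
    using cutoff_support[OF that] by (auto simp: A_def A1_def G_def)
  have Z1: "zint (\<lambda>p. 2 * rad A p * ZZ h1 p * BB h2 p - Gam h1 p * (rad A1 p + 2 * qq * rad A p)
      + 2 * mm p * rad A1 p * (ZZ h1 p)\<^sup>2)"
    by (rule zint_rellich[OF h dA cA(1)]) (rule S)
  have Z2: "zint (\<lambda>p. rad (\<lambda>s. A1 s + 2 * qq * A s) p * (h p * BB h2 p + Gam h1 p)
      + mm p * (rad (\<lambda>s. A2 s + 2 * qq * A1 s) p * (h p * ZZ h1 p)))"
    by (rule zint_radial_energy[OF h dC cA(2)]) (rule S)
  have Z3: "zint (\<lambda>p. mm p * (rad G p * (2 * h p * ZZ h1 p) + (h p)\<^sup>2 * (rad G' p + 2 * qq * rad G p)))"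
    by (rule zint_radial_square[OF h dG cA(3)]) (rule S)
  have Z4: "zint (\<lambda>p. rad zeta p * (h p * BB h2 p + Gam h1 p) + mm p * (rad zeta1 p * (h p * ZZ h1 p)))"
    by (rule zint_radial_energy[OF h zeta(1) cutoff_continuous(5)]) (rule zeta)
  have Z5: "zint (\<lambda>p. mm p * (rad zeta1 p * (2 * h p * ZZ h1 p) + (h p)\<^sup>2 * (rad zeta2 p + 2 * qq * rad zeta1 p)))"
    by (rule zint_radial_square[OF h zeta(2,3)]) (rule cutoff_support)
  \<comment> \<open>The five null integrals in the combination that occurs in
    \<open>carleman_pointwise\<close>.\<close>
  define R where "R p =
     - (2 * rad A p * ZZ h1 p * BB h2 p - Gam h1 p * (rad A1 p + 2 * qq * rad A p) + 2 * mm p * rad A1 p * (ZZ h1 p)\<^sup>2)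
     - (rad (\<lambda>s. A1 s + 2 * qq * A s) p * (h p * BB h2 p + Gam h1 p) + mm p * (rad (\<lambda>s. A2 s + 2 * qq * A1 s) p * (h p * ZZ h1 p)))
     - mm p * (rad G p * (2 * h p * ZZ h1 p) + (h p)\<^sup>2 * (rad G' p + 2 * qq * rad G p))
     + 2 * (rad zeta p * (h p * BB h2 p + Gam h1 p) + mm p * (rad zeta1 p * (h p * ZZ h1 p)))
     - mm p * (rad zeta1 p * (2 * h p * ZZ h1 p) + (h p)\<^sup>2 * (rad zeta2 p + 2 * qq * rad zeta1 p))" for p
  have R: "zint R" unfolding R_def[abs_def]
    using zint_diff[OF zint_add[OF zint_diff[OF zint_diff[OF zint_cmult[OF Z1, of "- 1"] Z2] Z3] zint_cmult[OF Z4, of 2]] Z5]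
    by simp
  let ?T1 = "\<lambda>p. mm p * rad (\<lambda>s. eta s * EE s) p * (TT h h1 p)\<^sup>2"
  let ?T2 = "\<lambda>p. mm p * rad (\<lambda>s. eta s * EE s * (- 2 * bb1 s) * ((bb s)\<^sup>2 - 1 / 4)) p * (h p)\<^sup>2"
  let ?T3 = "\<lambda>p. rad (\<lambda>s. eta s * EE s) p * BB h2 p * TT h h1 p"
  let ?T4 = "\<lambda>p. rad zeta p * (3 * \<bar>h p * BB h2 p\<bar>)"
  let ?T5 = "\<lambda>p. mm p * rad (\<lambda>s. 2 * zeta s + \<bar>zeta2 s + 2 * qq * zeta1 s\<bar>) p * (h p)\<^sup>2"
  have pw: "?T1 p + ?T2 p \<le> ?T3 p + R p + ?T4 p + ?T5 p" for p
  proof (cases "p = 0")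
    case False
    let ?s = "lg p"
    have b1: "bb1 ?s \<le> 0" using al by (simp add: bb1_def)
    have b: "2 * \<bar>eta1 ?s * bb ?s * EE ?s\<bar> \<le> zeta ?s"
      "\<bar>eta1 ?s * EE ?s * (2 * bb ?s * (qq - bb ?s) + bb1 ?s) + eta2 ?s * bb ?s * EE ?s + eta1 ?s * (bb1 ?s - 2 * (bb ?s)\<^sup>2) * EE ?s\<bar> \<le> 2 * zeta ?s"
      "\<bar>eta1 ?s * EE ?s * (- bb1 ?s / 2 - bb ?s * bb1 ?s + 2 * bb ?s ^ 3 + qq * bb1 ?s - 2 * qq * (bb ?s)\<^sup>2)\<bar> \<le> zeta ?s"
      using cutoff[of ?s] unfolding bet_def gg_def by auto
    have E: "EE ?s \<ge> 0" using EE_pos[of ?s] by linarith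
    from carleman_pointwise[OF mm_nonneg[of p] eta(5)[of ?s] E b1 zeta(5)[of ?s] mm_ZZ_le_Gam[of p h1] b,
        where h = "h p" and B = "BB h2 p" and xi = "zeta1 ?s" and xii = "zeta2 ?s"]
    show ?thesis using False
      unfolding R_def rad_def TT_def bet_def A_def A1_def A2_def G_def G'_def gg_def g1_def
      by (simp add: mult.assoc)
  qed (simp add: rad_def R_def mm_def)
  \<comment> \<open>\<open>TT\<close> involves \<open>lg\<close> and need not be continuous at the
    origin; expanding it leaves continuous functions times radial weights.\<close>
  have T1e: "?T1 = (\<lambda>p. mm p * rad (\<lambda>s. eta s * EE s * (4 * (bb s)\<^sup>2)) p * (ZZ h1 p)\<^sup>2
     + mm p * rad (\<lambda>s. eta s * EE s * (4 * bb s * bet s)) p * (h p * ZZ h1 p)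
     + mm p * rad (\<lambda>s. eta s * EE s * (bet s)\<^sup>2) p * (h p)\<^sup>2)"
    by (auto simp: fun_eq_iff rad_def TT_def algebra_simps power2_eq_square)
  have T3e: "?T3 = (\<lambda>p. rad (\<lambda>s. eta s * EE s * (2 * bb s)) p * (BB h2 p * ZZ h1 p)
     + rad (\<lambda>s. eta s * EE s * bet s) p * (BB h2 p * h p))"
    by (auto simp: fun_eq_iff rad_def TT_def algebra_simps)
  have cc: "continuous_on UNIV h" "continuous_on UNIV (ZZ h1)" "continuous_on UNIV (BB h2)"
    using C2D[OF h] ZZ_continuous[OF h] BB_continuous[OF h] by auto
  show i1: "integrable lborel ?T1" unfolding T1e
    by (intro Bochner_Integration.integrable_add integrable_mm_rad_weight continuous_intros cc) (auto simp: cutoff_support)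
  show i3: "integrable lborel ?T3" unfolding T3e
    by (intro Bochner_Integration.integrable_add integrable_rad_weight continuous_intros cc) (auto simp: cutoff_support)
  have i2: "integrable lborel ?T2"
    by (intro integrable_mm_rad_weight continuous_intros cc) (auto simp: cutoff_support)
  have i4: "integrable lborel ?T4"
    by (intro integrable_rad_weight continuous_intros cc) (auto simp: cutoff_support)
  have i5: "integrable lborel ?T5"
    by (intro integrable_mm_rad_weight continuous_intros cc) (auto simp: cutoff_support)
  have iR: "integrable lborel R" "integral\<^sup>L lborel R = 0" using R by (auto simp: zint_def)
  have "(LINT p|lborel. ?T1 p + ?T2 p) \<le> (LINT p|lborel. ?T3 p + R p + ?T4 p + ?T5 p)"
    by (intro integral_mono Bochner_Integration.integrable_add i1 i2 i3 i4 i5 iR pw)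
  then show "(LINT p|lborel. ?T1 p) + (LINT p|lborel. ?T2 p)
     \<le> (LINT p|lborel. ?T3 p) + (LINT p|lborel. ?T4 p) + (LINT p|lborel. ?T5 p)"
    using i1 i2 i3 i4 i5 iR by simp
qed

end

section \<open>Averages over finitely many translates\<close>

text \<open>Finite averages stand in for mollification: by linearity they commute with derivatives,
  and they need no integration in a parameter. Lists keep multiplicities, so that a composition of
  averages is again an average.\<close>

definition av :: "'a::real_normed_vector list \<Rightarrow> ('a \<Rightarrow> real) \<Rightarrow> 'a \<Rightarrow> real" where
  "av vs f p = (\<Sum>v\<leftarrow>vs. f (p + v)) / real (length vs)"

definition shifts_prod :: "'a::real_normed_vector list \<Rightarrow> 'a list \<Rightarrow> 'a list" where
  "shifts_prod vs ws = concat (map (\<lambda>v. map ((+) v) ws) vs)"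

lemma sum_list_divide: "(\<Sum>v\<leftarrow>vs. f v / c) = (\<Sum>v\<leftarrow>vs. f v) / (c :: real)"
  by (induction vs) (auto simp: add_divide_distrib)

lemma av_av: "av vs (av ws f) = av (shifts_prod vs ws) f"
proof
  fix p
  have l: "length (shifts_prod vs ws) = length vs * length ws"
    by (induction vs) (auto simp: shifts_prod_def)
  have s: "(\<Sum>v\<leftarrow>shifts_prod vs ws. f (p + v)) = (\<Sum>v\<leftarrow>vs. \<Sum>w\<leftarrow>ws. f (p + v + w))"
    by (induction vs) (auto simp: shifts_prod_def comp_def add.assoc)
  show "av vs (av ws f) p = av (shifts_prod vs ws) f p"
    by (simp add: av_def l s sum_list_divide mult.commute)
qed

lemma av_commute: "av vs (av ws f) = av ws (av vs f)"
proof
  fix p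
  have "(\<Sum>v\<leftarrow>vs. \<Sum>w\<leftarrow>ws. f (p + v + w)) = (\<Sum>w\<leftarrow>ws. \<Sum>v\<leftarrow>vs. f (p + w + v))"
    by (induction vs) (auto simp: sum_list_addf algebra_simps)
  then show "av vs (av ws f) p = av ws (av vs f) p"
    by (simp add: av_def sum_list_divide mult.commute)
qed

lemma av_add: "av vs (\<lambda>p. f p + g p) p = av vs f p + av vs g p"
  by (simp add: av_def sum_list_addf add_divide_distrib)

lemma av_diff: "av vs (\<lambda>p. f p - g p) p = av vs f p - av vs g p"
  by (simp add: av_def sum_list_subtractf diff_divide_distrib)

lemma av_cmult: "av vs (\<lambda>p. c * f p) p = c * av vs f p"
  by (simp add: av_def sum_list_const_mult)

lemma av_const: "vs \<noteq> [] \<Longrightarrow> av vs (\<lambda>p. c) p = c"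
  by (simp add: av_def sum_list_triv)

lemma av_sum: "finite I \<Longrightarrow> av vs (\<lambda>p. \<Sum>i\<in>I. f i p) p = (\<Sum>i\<in>I. av vs (f i) p)"
  by (induction I rule: finite_induct) (auto simp: av_add av_def)

lemma av_mono: "(\<And>v. v \<in> set vs \<Longrightarrow> f (p + v) \<le> g (p + v)) \<Longrightarrow> av vs f p \<le> av vs g p"
  unfolding av_def by (intro divide_right_mono sum_list_mono) auto

lemma av_cong: "(\<And>v. v \<in> set vs \<Longrightarrow> f (p + v) = g (p + v)) \<Longrightarrow> av vs f p = av vs g p"
  by (intro antisym av_mono) auto

lemma av_nonneg: "(\<And>q. f q \<ge> 0) \<Longrightarrow> av vs f p \<ge> 0"
  unfolding av_def by (intro divide_nonneg_nonneg sum_list_nonneg) auto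

text \<open>Jensen's inequality, obtained from the nonnegativity of a variance.\<close>

lemma av_sq_le: "(av vs f p)\<^sup>2 \<le> av vs (\<lambda>p. (f p)\<^sup>2) p"
proof (cases "vs = []")
  case False
  let ?c = "av vs f p"
  have "0 \<le> av vs (\<lambda>q. (f q - ?c)\<^sup>2) p" by (rule av_nonneg) simp
  also have "\<dots> = av vs (\<lambda>q. ((f q)\<^sup>2 - (2 * ?c) * f q) + ?c\<^sup>2) p"
    by (simp add: power2_eq_square algebra_simps)
  also have "\<dots> = av vs (\<lambda>p. (f p)\<^sup>2) p - 2 * ?c * ?c + ?c\<^sup>2"
    unfolding av_add av_diff av_cmult av_const[OF False] ..
  finally show ?thesis by (simp add: power2_eq_square)
qed (simp add: av_def)

lemma av_continuous: "continuous_on UNIV f \<Longrightarrow> continuous_on A (av vs f)"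
proof -
  assume f: "continuous_on UNIV f"
  have "continuous_on A (\<lambda>p. \<Sum>v\<leftarrow>vs. f (p + v))"
    by (induction vs) (auto intro!: continuous_intros continuous_on_compose2[OF f])
  then show ?thesis unfolding av_def[abs_def] by (cases "vs = []") (auto intro!: continuous_intros)
qed

lemma av_has_dd: "has_dd e f f' \<Longrightarrow> has_dd e (av vs f) (av vs f')"
proof -
  assume f: "has_dd e f f'"
  have "has_dd e (\<lambda>p. \<Sum>v\<leftarrow>vs. f (p + v)) (\<lambda>p. \<Sum>v\<leftarrow>vs. f' (p + v))"
    by (induction vs) (auto intro!: has_dd_const has_dd_add has_dd_shift f)
  from has_dd_cmult[OF this, of "1 / real (length vs)"] show ?thesis
    by (simp add: av_def[abs_def])
qed

lemma av_measurable [measurable]: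
  fixes f :: "'a::euclidean_space \<Rightarrow> real"
  assumes [measurable]: "f \<in> borel_measurable borel"
  shows "av vs f \<in> borel_measurable borel"
proof -
  have "(\<lambda>p. \<Sum>v\<leftarrow>vs. f (p + v)) \<in> borel_measurable borel" by (induction vs) auto
  then show ?thesis unfolding av_def[abs_def] by measurable
qed

lemma av_integral:
  fixes f :: "'a::euclidean_space \<Rightarrow> real"
  assumes f: "integrable lborel f"
  shows "integrable lborel (av vs f)"
    and "vs \<noteq> [] \<Longrightarrow> (LINT p|lborel. av vs f p) = (LINT p|lborel. f p)"
proof -
  have m: "f \<in> borel_measurable borel" using borel_measurable_integrable[OF f] by simp
  have i: "integrable lborel (\<lambda>p. \<Sum>v\<leftarrow>vs. f (p + v))"
    by (induction vs) (auto intro!: lborel_integrable_shift f)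
  then show "integrable lborel (av vs f)" unfolding av_def[abs_def] by simp
  have "(LINT p|lborel. (\<Sum>v\<leftarrow>vs. f (p + v))) = real (length vs) * (LINT p|lborel. f p)"
  proof (induction vs)
    case (Cons v vs)
    have "integrable lborel (\<lambda>p. \<Sum>v\<leftarrow>vs. f (p + v))"
      by (induction vs) (auto intro!: lborel_integrable_shift f)
    then show ?case using Cons lborel_integrable_shift[OF f, of v] lborel_integral_shift[OF m, of v]
      by (simp add: algebra_simps)
  qed simp
  then show "(LINT p|lborel. av vs f p) = (LINT p|lborel. f p)" if "vs \<noteq> []"
    using that by (simp add: av_def)
qed

text \<open>Each translate of \<open>S\<close> stays inside \<open>S'\<close>, so averaging costs
  nothing but an enlargement of the domain.\<close>

lemma integral_av_le:
  fixes f g :: "'a::euclidean_space \<Rightarrow> real"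
  assumes f: "integrable lborel (\<lambda>p. indicator S' p * f p)" "\<And>p. f p \<ge> 0"
    and vs: "vs \<noteq> []" "\<And>p v. p \<in> S \<Longrightarrow> v \<in> set vs \<Longrightarrow> p + v \<in> S'"
    and g: "\<And>p. p \<in> S \<Longrightarrow> g p \<le> av vs f p" "g \<in> borel_measurable borel" "\<And>p. g p \<ge> 0"
    and S: "S \<in> sets borel"
  shows "integrable lborel (\<lambda>p. indicator S p * g p)"
    "(LINT p|lborel. indicator S p * g p) \<le> (LINT p|lborel. indicator S' p * f p)"
proof -
  have b: "indicator S p * g p \<le> av vs (\<lambda>p. indicator S' p * f p) p" for p
  proof (cases "p \<in> S")
    case True
    have "g p \<le> av vs f p" using g True by blast
    also have "\<dots> = av vs (\<lambda>p. indicator S' p * f p) p"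
      using vs(2)[OF True] by (intro av_cong) (simp add: indicator_def)
    finally show ?thesis using True by simp
  next
    case False
    then show ?thesis by (simp add: av_nonneg f)
  qed
  note i = av_integral[OF f(1), of vs]
  have m: "(\<lambda>p. indicator S p * g p) \<in> borel_measurable lborel" using S g(2) by simp
  show j: "integrable lborel (\<lambda>p. indicator S p * g p)"
  proof (rule Bochner_Integration.integrable_bound[OF i(1) m])
    show "AE x in lborel. norm (indicator S x * g x) \<le> norm (av vs (\<lambda>p. indicator S' p * f p) x)"
      using b g(3) by (intro AE_I2) (simp add: av_nonneg f)
  qed
  show "(LINT p|lborel. indicator S p * g p) \<le> (LINT p|lborel. indicator S' p * f p)"
    unfolding i(2)[OF vs(1), symmetric] by (intro integral_mono j i b)
qed

section \<open>Grids of translates and difference quotients\<close>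

definition grid :: "nat \<Rightarrow> 'a::real_normed_vector \<Rightarrow> 'a list" where
  "grid N e = map (\<lambda>i. (real i / real N) *\<^sub>R e) [0..<N]"

lemma grid_norm: "v \<in> set (grid N e) \<Longrightarrow> norm v \<le> norm e"
proof -
  assume "v \<in> set (grid N e)"
  then obtain i where i: "i < N" "v = (real i / real N) *\<^sub>R e" by (auto simp: grid_def)
  then have "real i / real N \<le> 1" by simp
  then have "real i / real N * norm e \<le> 1 * norm e" by (rule mult_right_mono) simp
  then show ?thesis using i by simp
qed

lemma grid_span: "v \<in> set (grid N e) \<Longrightarrow> \<exists>r. v = r *\<^sub>R e"
  by (auto simp: grid_def)

lemma grid_nonempty: "N > 0 \<Longrightarrow> grid N e \<noteq> []"
  by (simp add: grid_def)

text \<open>The average is a left Riemann sum for the integral of \<open>f'\<close> over the segment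
  from p to p + e. Each term is compared with an increment of \<open>f\<close> by the mean value
  theorem and uniform continuity, and the increments telescope. In this way an averaged derivative
  is controlled by \<open>f\<close> alone.\<close>

lemma av_grid_derivative:
  fixes f f' :: "'a::euclidean_space \<Rightarrow> real"
  assumes d: "has_dd e f f'" and c: "continuous_on UNIV f'" and T: "bounded T" and w: "\<omega> > 0"
  obtains N0 where "N0 > 0"
    "\<And>N p. N \<ge> N0 \<Longrightarrow> p \<in> T \<Longrightarrow> \<bar>av (grid N e) f' p - (f (p + e) - f p)\<bar> \<le> \<omega>"
proof -
  obtain R where R: "\<And>p. p \<in> T \<Longrightarrow> norm p \<le> R" using T bounded_iff by metis
  have "uniformly_continuous_on (cball 0 (R + norm e)) f'"
    by (intro compact_uniformly_continuous continuous_on_subset[OF c]) auto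
  then obtain \<delta> where \<delta>: "\<delta> > 0" "\<And>x y. x \<in> cball 0 (R + norm e) \<Longrightarrow> y \<in> cball 0 (R + norm e) \<Longrightarrow>
      dist y x < \<delta> \<Longrightarrow> dist (f' y) (f' x) < \<omega>"
    using w unfolding uniformly_continuous_on_def by metis
  obtain N0 where N0: "N0 > 0" "norm e / real N0 < \<delta>"
  proof -
    obtain N where "norm e / \<delta> < real N" using reals_Archimedean2 by blast
    then show ?thesis using that[of "Suc N"] \<delta>(1) by (simp add: field_simps)
  qed
  have "\<bar>av (grid N e) f' p - (f (p + e) - f p)\<bar> \<le> \<omega>" if p: "p \<in> T" and NN: "N \<ge> N0" for p N
  proof -
    have "norm e / real N \<le> norm e / real N0" using NN N0(1) by (intro divide_left_mono) auto
    then have N: "N > 0" "norm e / real N < \<delta>" using NN N0 by auto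
    let ?q = "\<lambda>i. p + (real i / real N) *\<^sub>R e"
    have one: "\<bar>f' (?q i) / real N - (f (?q (Suc i)) - f (?q i))\<bar> \<le> \<omega> / real N" if i: "i < N" for i
    proof -
      have lt: "real i / real N < real (Suc i) / real N" using N(1) by (simp add: divide_strict_right_mono)
      obtain \<xi> where x: "real i / real N < \<xi>" "\<xi> < real (Suc i) / real N"
        "f (?q (Suc i)) - f (?q i) = (real (Suc i) / real N - real i / real N) * f' (p + \<xi> *\<^sub>R e)"
        using MVT2[of "real i / real N" "real (Suc i) / real N" "\<lambda>r. f (p + r *\<^sub>R e)" "\<lambda>r. f' (p + r *\<^sub>R e)", OF lt has_dd_line[OF d]]
        by blast
      have dd: "real (Suc i) / real N - real i / real N = 1 / real N"
        by (simp add: diff_divide_distrib[symmetric])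
      have le1: "real (Suc i) / real N \<le> 1" using i N(1) by simp
      have in_ball: "p + r *\<^sub>R e \<in> cball 0 (R + norm e)" if "0 \<le> r" "r \<le> 1" for r
        using norm_triangle_ineq[of p "r *\<^sub>R e"] R[OF p] mult_right_mono[of r 1 "norm e"] that by simp
      have r0: "0 \<le> real i / real N" by simp
      have "dist (p + \<xi> *\<^sub>R e) (?q i) = \<bar>\<xi> - real i / real N\<bar> * norm e"
        by (simp add: dist_norm scaleR_left_diff_distrib[symmetric])
      also have "\<dots> \<le> 1 / real N * norm e"
        using x dd by (intro mult_right_mono) auto
      finally have "dist (p + \<xi> *\<^sub>R e) (?q i) < \<delta>" using N(2) by simp
      then have "dist (f' (p + \<xi> *\<^sub>R e)) (f' (?q i)) < \<omega>"
        by (intro \<delta>(2) in_ball) (use x(1,2) le1 r0 lt in linarith)+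
      then have "\<bar>f' (?q i) - f' (p + \<xi> *\<^sub>R e)\<bar> / real N \<le> \<omega> / real N"
        by (intro divide_right_mono) (auto simp: dist_real_def)
      then show ?thesis unfolding x(3) dd by (simp add: diff_divide_distrib[symmetric] abs_divide)
    qed
    have t: "(\<Sum>i<N. f (?q (Suc i)) - f (?q i)) = f (p + e) - f p"
      using sum_lessThan_telescope[of "\<lambda>i. f (?q i)" N] N(1) by simp
    have a: "av (grid N e) f' p = (\<Sum>i<N. f' (?q i) / real N)"
      unfolding av_def grid_def
      by (simp add: comp_def interv_sum_list_conv_sum_set_nat atLeast0LessThan sum_divide_distrib)
    have "\<bar>av (grid N e) f' p - (f (p + e) - f p)\<bar> = \<bar>\<Sum>i<N. f' (?q i) / real N - (f (?q (Suc i)) - f (?q i))\<bar>"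
      unfolding a t[symmetric] sum_subtractf ..
    also have "\<dots> \<le> (\<Sum>i<N. \<omega> / real N)"
      by (rule order.trans[OF sum_abs]) (intro sum_mono one, simp)
    finally show ?thesis using N(1) by simp
  qed
  then show ?thesis using that N0(1) by blast
qed

text \<open>One list has to serve all directions at once. It consists of all sums with one vector
  from each grid; since averages commute, any chosen grid can be made the innermost one.\<close>

lemma multi_grid:
  fixes es :: "'a::real_normed_vector list"
  assumes "N > 0" "\<And>e. e \<in> set es \<Longrightarrow> norm e \<le> \<tau>" "subspace V" "set es \<subseteq> V" "\<tau> \<ge> 0"
  obtains vs where "vs \<noteq> []" "\<And>v. v \<in> set vs \<Longrightarrow> v \<in> V \<and> norm v \<le> real (length es) * \<tau>"
    "\<And>e. e \<in> set es \<Longrightarrow> \<exists>ws. ws \<noteq> [] \<and> (\<forall>w\<in>set ws. w \<in> V \<and> norm w \<le> real (length es) * \<tau>) \<and>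
        (\<forall>f. av vs f = av ws (av (grid N e) f))"
proof -
  have "\<exists>vs. vs \<noteq> [] \<and> (\<forall>v\<in>set vs. v \<in> V \<and> norm v \<le> real (length es) * \<tau>) \<and>
    (\<forall>e\<in>set es. \<exists>ws. ws \<noteq> [] \<and> (\<forall>w\<in>set ws. w \<in> V \<and> norm w \<le> real (length es) * \<tau>) \<and>
        (\<forall>f. av vs f = av ws (av (grid N e) f)))"
    using assms(2,4)
  proof (induction es)
    case Nil
    have "0 \<in> V" using assms(3) by (rule subspace_0)
    then show ?case by (intro exI[of _ "[0]"]) simp
  next
    case (Cons e es)
    from Cons.IH Cons.prems obtain vs where vs: "vs \<noteq> []"
      "\<And>v. v \<in> set vs \<Longrightarrow> v \<in> V \<and> norm v \<le> real (length es) * \<tau>"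
      "\<And>e. e \<in> set es \<Longrightarrow> \<exists>ws. ws \<noteq> [] \<and> (\<forall>w\<in>set ws. w \<in> V \<and> norm w \<le> real (length es) * \<tau>) \<and>
        (\<forall>f. av vs f = av ws (av (grid N e) f))" by auto
    have eV: "e \<in> V" "norm e \<le> \<tau>" using Cons.prems by auto
    have P: "shifts_prod ws (grid N e) \<noteq> [] \<and> (\<forall>w\<in>set (shifts_prod ws (grid N e)).
        w \<in> V \<and> norm w \<le> real (length (e # es)) * \<tau>)"
      if ws: "ws \<noteq> []" "\<forall>w\<in>set ws. w \<in> V \<and> norm w \<le> real (length es) * \<tau>" for ws
    proof (intro conjI ballI)
      show ne: "shifts_prod ws (grid N e) \<noteq> []"
        using ws(1) grid_nonempty[OF assms(1), of e] by (cases ws) (auto simp: shifts_prod_def)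
      fix w assume "w \<in> set (shifts_prod ws (grid N e))"
      then obtain v u where w: "w = v + u" "v \<in> set ws" "u \<in> set (grid N e)"
        by (auto simp: shifts_prod_def)
      show "w \<in> V" unfolding w(1) using ws(2) w(2) grid_span[OF w(3)] eV assms(3)
        by (auto intro!: subspace_add subspace_scale)
      have "norm w \<le> norm v + norm u" unfolding w(1) by (rule norm_triangle_ineq)
      also have "\<dots> \<le> real (length es) * \<tau> + \<tau>"
        using ws(2) w(2) grid_norm[OF w(3)] eV(2) by (intro add_mono) auto
      finally show "norm w \<le> real (length (e # es)) * \<tau>" by (simp add: algebra_simps)
    qed
    have le: "norm w \<le> real (length (e # es)) * \<tau>" if "norm w \<le> real (length es) * \<tau>" for w :: 'a
      using that assms(5) by (simp add: distrib_right)
    have Q: "\<exists>ws. ws \<noteq> [] \<and> (\<forall>w\<in>set ws. w \<in> V \<and> norm w \<le> real (length (e # es)) * \<tau>) \<and>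
        (\<forall>f. av (shifts_prod vs (grid N e)) f = av ws (av (grid N d) f))" if "d \<in> set (e # es)" for d
    proof -
      from that consider "d = e" | "d \<in> set es" by auto
      then show ?thesis
      proof cases
        case 1
        then show ?thesis using vs(1,2) le by (intro exI[of _ vs]) (auto simp: av_av)
      next
        case 2
        then obtain ws where ws: "ws \<noteq> []" "\<forall>w\<in>set ws. w \<in> V \<and> norm w \<le> real (length es) * \<tau>"
          "\<And>f. av vs f = av ws (av (grid N d) f)" using vs(3) by blast
        have "av (shifts_prod vs (grid N e)) f = av (shifts_prod ws (grid N e)) (av (grid N d) f)" for f
          by (metis av_av av_commute ws(3))
        then show ?thesis using P[OF ws(1,2)] by (intro exI[of _ "shifts_prod ws (grid N e)"]) blast
      qed
    qed
    show ?case using P[of vs] vs(1,2) Q by (intro exI[of _ "shifts_prod vs (grid N e)"]) blast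
  qed
  then show ?thesis using that by blast
qed

lemma has_dd_scaleR: "has_dd e f f' \<Longrightarrow> has_dd (c *\<^sub>R e) f (\<lambda>p. c * f' p)"
  unfolding has_dd_def
proof
  fix p assume f: "\<forall>p. ((\<lambda>r. f (p + r *\<^sub>R e)) has_real_derivative f' p) (at 0)"
  have "((\<lambda>r. f (p + (r * c) *\<^sub>R e)) has_real_derivative f' p * c) (at 0)"
    by (rule DERIV_chain2[of "\<lambda>r. f (p + r *\<^sub>R e)" "f' p" "\<lambda>r. r * c" 0])
      (use f in \<open>auto intro!: derivative_eq_intros\<close>)
  then show "((\<lambda>r. f (p + r *\<^sub>R c *\<^sub>R e)) has_real_derivative c * f' p) (at 0)"
    by (simp add: mult.commute)
qed

section \<open>Square integrability on a set\<close>

text \<open>Borel measurability is asked on the whole space, though only the values on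
  \<open>S\<close> are integrated, so that translates remain measurable.\<close>

definition sqi :: "'a::euclidean_space set \<Rightarrow> ('a \<Rightarrow> real) \<Rightarrow> bool" where
  "sqi S \<phi> \<longleftrightarrow> \<phi> \<in> borel_measurable borel \<and> integrable lborel (\<lambda>p. indicator S p * (\<phi> p)\<^sup>2)"

definition nsq :: "'a::euclidean_space set \<Rightarrow> ('a \<Rightarrow> real) \<Rightarrow> real" where
  "nsq S \<phi> = (LINT p|lborel. indicator S p * (\<phi> p)\<^sup>2)"

lemma nsq_nonneg [simp]: "nsq S \<phi> \<ge> 0"
  unfolding nsq_def by (intro integral_nonneg_AE) auto

lemma sqiD: "sqi S \<phi> \<Longrightarrow> \<phi> \<in> borel_measurable borel" "sqi S \<phi> \<Longrightarrow> integrable lborel (\<lambda>p. indicator S p * (\<phi> p)\<^sup>2)"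
  by (auto simp: sqi_def)

lemma power2_sum_le: "(x + y)\<^sup>2 \<le> 2 * x\<^sup>2 + 2 * y\<^sup>2" for x y :: real
  using sum_squares_bound[of x y] by (simp add: power2_sum)

lemma nsq_dominated:
  assumes S: "S \<in> sets borel" and F: "integrable lborel F" "\<And>p. p \<in> S \<Longrightarrow> (\<phi> p)\<^sup>2 \<le> F p" "\<And>p. p \<notin> S \<Longrightarrow> F p \<ge> 0"
    and m: "\<phi> \<in> borel_measurable borel"
  shows "sqi S \<phi>" "nsq S \<phi> \<le> integral\<^sup>L lborel F"
proof -
  have le: "indicator S p * (\<phi> p)\<^sup>2 \<le> F p" for p using F(2,3)[of p] by (cases "p \<in> S") auto
  have "integrable lborel (\<lambda>p. indicator S p * (\<phi> p)\<^sup>2)"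
  proof (rule Bochner_Integration.integrable_bound[OF F(1)])
    show "AE p in lborel. norm (indicator S p * (\<phi> p)\<^sup>2) \<le> norm (F p)"
      using le by (intro AE_I2) (smt (verit) indicator_pos_le mult_nonneg_nonneg real_norm_def zero_le_power2)
  qed (use S m in measurable)
  then show s: "sqi S \<phi>" using m by (simp add: sqi_def)
  show "nsq S \<phi> \<le> integral\<^sup>L lborel F"
    unfolding nsq_def by (intro integral_mono sqiD(2)[OF s] F(1) le)
qed

lemma sqi_add:
  assumes S: "S \<in> sets borel" and "sqi S \<phi>" "sqi S \<psi>"
  shows "sqi S (\<lambda>p. \<phi> p + \<psi> p)" "nsq S (\<lambda>p. \<phi> p + \<psi> p) \<le> 2 * nsq S \<phi> + 2 * nsq S \<psi>"
proof -
  let ?F = "\<lambda>p. 2 * (indicator S p * (\<phi> p)\<^sup>2) + 2 * (indicator S p * (\<psi> p)\<^sup>2)"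
  have i: "integrable lborel ?F" "integral\<^sup>L lborel ?F = 2 * nsq S \<phi> + 2 * nsq S \<psi>"
    using sqiD(2)[OF assms(2)] sqiD(2)[OF assms(3)] by (auto simp: nsq_def)
  have le: "(\<phi> p + \<psi> p)\<^sup>2 \<le> ?F p" if "p \<in> S" for p
    using that sum_squares_bound[of "\<phi> p" "\<psi> p"] by (simp add: power2_sum)
  have m: "(\<lambda>p. \<phi> p + \<psi> p) \<in> borel_measurable borel" using assms sqiD(1) by measurable
  show "sqi S (\<lambda>p. \<phi> p + \<psi> p)" "nsq S (\<lambda>p. \<phi> p + \<psi> p) \<le> 2 * nsq S \<phi> + 2 * nsq S \<psi>"
    using nsq_dominated[OF S i(1) le _ m] i(2) by auto
qed

lemma sqi_cmult: "sqi S \<phi> \<Longrightarrow> sqi S (\<lambda>p. c * \<phi> p)" "nsq S (\<lambda>p. c * \<phi> p) = c\<^sup>2 * nsq S \<phi>"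
proof -
  have e: "indicator S p * (c * \<phi> p)\<^sup>2 = c\<^sup>2 * (indicator S p * (\<phi> p)\<^sup>2)" for p
    by (simp add: power_mult_distrib)
  show "nsq S (\<lambda>p. c * \<phi> p) = c\<^sup>2 * nsq S \<phi>" unfolding nsq_def e by simp
  show "sqi S (\<lambda>p. c * \<phi> p)" if "sqi S \<phi>"
  proof -
    have [measurable]: "\<phi> \<in> borel_measurable borel" using that by (simp add: sqi_def)
    have "(\<lambda>p. c * \<phi> p) \<in> borel_measurable borel" by measurable
    then show ?thesis using that unfolding sqi_def e by simp
  qed
qed

lemma sqi_diff:
  assumes "S \<in> sets borel" "sqi S \<phi>" "sqi S \<psi>"
  shows "sqi S (\<lambda>p. \<phi> p - \<psi> p)" "nsq S (\<lambda>p. \<phi> p - \<psi> p) \<le> 2 * nsq S \<phi> + 2 * nsq S \<psi>"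
  using sqi_add[OF assms(1,2) sqi_cmult(1)[OF assms(3), of "-1"]] sqi_cmult(2)[of S "-1" \<psi>] by auto

lemma sqi_abs: "sqi S \<phi> \<Longrightarrow> sqi S (\<lambda>p. \<bar>\<phi> p\<bar>)" "nsq S (\<lambda>p. \<bar>\<phi> p\<bar>) = nsq S \<phi>"
  by (auto simp: sqi_def nsq_def)

lemma sqi_continuous:
  assumes "continuous_on UNIV \<phi>" "bounded S" "S \<in> sets borel"
  shows "sqi S \<phi>"
proof -
  obtain M where M: "M > 0" "\<And>p. p \<in> S \<Longrightarrow> \<bar>\<phi> p\<bar> \<le> M"
    using continuous_compact_bounded assms by metis
  have m: "\<phi> \<in> borel_measurable borel" using assms(1) by (rule borel_measurable_continuous_onI)
  have "integrable lborel (\<lambda>p. indicator S p * (\<phi> p)\<^sup>2)"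
  proof (rule integrable_bounded_support[of _ "M\<^sup>2" S])
    show "(\<lambda>p. indicator S p * (\<phi> p)\<^sup>2) \<in> borel_measurable borel" using m assms(3) by measurable
    show "\<bar>indicator S p * (\<phi> p)\<^sup>2\<bar> \<le> M\<^sup>2" for p
      using M power_mono[of "\<bar>\<phi> p\<bar>" M 2] by (cases "p \<in> S") auto
  qed (use assms in auto)
  then show ?thesis using m by (simp add: sqi_def)
qed

lemma sqi_subset:
  assumes "sqi S' \<phi>" "S \<subseteq> S'" "S \<in> sets borel"
  shows "sqi S \<phi>" "nsq S \<phi> \<le> nsq S' \<phi>"
proof -
  have le: "(\<phi> p)\<^sup>2 \<le> indicator S' p * (\<phi> p)\<^sup>2" if "p \<in> S" for p using that assms(2) by auto
  note D = nsq_dominated[OF assms(3) sqiD(2)[OF assms(1)] le _ sqiD(1)[OF assms(1)]]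
  show "sqi S \<phi>" by (rule D(1)) auto
  show "nsq S \<phi> \<le> nsq S' \<phi>" unfolding nsq_def[of S'] by (rule D(2)) auto
qed

lemma sqi_av:
  assumes "sqi S' \<phi>" "vs \<noteq> []" "\<And>p v. p \<in> S \<Longrightarrow> v \<in> set vs \<Longrightarrow> p + v \<in> S'" "S \<in> sets borel"
  shows "sqi S (av vs \<phi>)" "nsq S (av vs \<phi>) \<le> nsq S' \<phi>"
proof -
  have m: "(\<lambda>p. (av vs \<phi> p)\<^sup>2) \<in> borel_measurable borel" using sqiD(1)[OF assms(1)] by measurable
  have m': "av vs \<phi> \<in> borel_measurable borel" using sqiD(1)[OF assms(1)] by measurable
  note a = integral_av_le[of S' "\<lambda>p. (\<phi> p)\<^sup>2" vs S "\<lambda>p. (av vs \<phi> p)\<^sup>2",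
      OF sqiD(2)[OF assms(1)] zero_le_power2 assms(2,3) av_sq_le m zero_le_power2 assms(4)]
  show "sqi S (av vs \<phi>)" using a(1) m' by (simp add: sqi_def)
  show "nsq S (av vs \<phi>) \<le> nsq S' \<phi>" using a(2) by (simp add: nsq_def)
qed

text \<open>Young's inequality with a free parameter, used where one factor is small and the other
  merely bounded.\<close>

lemma integral_product_le:
  assumes "S \<in> sets borel" "sqi S \<phi>" "sqi S \<psi>" "c > 0"
  shows "integrable lborel (\<lambda>p. indicator S p * (\<bar>\<phi> p\<bar> * \<psi> p))"
    "(LINT p|lborel. indicator S p * (\<bar>\<phi> p\<bar> * \<psi> p)) \<le> c / 2 * nsq S \<phi> + 1 / (2 * c) * nsq S \<psi>"
proof -
  let ?F = "\<lambda>p. c / 2 * (indicator S p * (\<phi> p)\<^sup>2) + 1 / (2 * c) * (indicator S p * (\<psi> p)\<^sup>2)"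
  have i: "integrable lborel ?F" "integral\<^sup>L lborel ?F = c / 2 * nsq S \<phi> + 1 / (2 * c) * nsq S \<psi>"
    using sqiD(2)[OF assms(2)] sqiD(2)[OF assms(3)] by (auto simp: nsq_def)
  have y: "\<bar>x\<bar> * \<bar>y\<bar> \<le> c / 2 * x\<^sup>2 + 1 / (2 * c) * y\<^sup>2" for x y :: real
  proof -
    have "0 \<le> (c * \<bar>x\<bar> - \<bar>y\<bar>)\<^sup>2" by simp
    then have "2 * c * (\<bar>x\<bar> * \<bar>y\<bar>) \<le> c\<^sup>2 * x\<^sup>2 + y\<^sup>2" by (simp add: power2_diff power_mult_distrib mult_ac)
    then show ?thesis using assms(4) by (simp add: field_simps power2_eq_square)
  qed
  have le: "\<bar>indicator S p * (\<bar>\<phi> p\<bar> * \<psi> p)\<bar> \<le> ?F p" for p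
    using y[of "\<phi> p" "\<psi> p"] by (cases "p \<in> S") (auto simp: abs_mult)
  have m: "(\<lambda>p. indicator S p * (\<bar>\<phi> p\<bar> * \<psi> p)) \<in> borel_measurable lborel"
    using assms(1) sqiD(1)[OF assms(2)] sqiD(1)[OF assms(3)] by measurable
  show j: "integrable lborel (\<lambda>p. indicator S p * (\<bar>\<phi> p\<bar> * \<psi> p))"
  proof (rule Bochner_Integration.integrable_bound[OF i(1) m])
    show "AE p in lborel. norm (indicator S p * (\<bar>\<phi> p\<bar> * \<psi> p)) \<le> norm (?F p)"
      unfolding real_norm_def by (intro AE_I2 order_trans[OF le abs_ge_self])
  qed
  have "(LINT p|lborel. indicator S p * (\<bar>\<phi> p\<bar> * \<psi> p)) \<le> integral\<^sup>L lborel ?F"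
    by (rule integral_mono[OF j i(1) order_trans[OF abs_ge_self le]])
  then show "(LINT p|lborel. indicator S p * (\<bar>\<phi> p\<bar> * \<psi> p)) \<le> c / 2 * nsq S \<phi> + 1 / (2 * c) * nsq S \<psi>"
    unfolding i(2) .
qed

lemma uniform_shift:
  fixes \<phi> :: "'a::euclidean_space \<Rightarrow> real"
  assumes "continuous_on UNIV \<phi>" "bounded S" "\<omega> > 0"
  obtains r where "r > 0" "\<And>p v. p \<in> S \<Longrightarrow> norm v \<le> r \<Longrightarrow> \<bar>\<phi> (p + v) - \<phi> p\<bar> \<le> \<omega>"
proof -
  obtain R where R: "\<And>p. p \<in> S \<Longrightarrow> norm p \<le> R" using assms(2) bounded_iff by metis
  have "uniformly_continuous_on (cball 0 (R + 1)) \<phi>"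
    by (intro compact_uniformly_continuous continuous_on_subset[OF assms(1)]) auto
  then obtain d where d: "d > 0" "\<And>x y. x \<in> cball 0 (R + 1) \<Longrightarrow> y \<in> cball 0 (R + 1) \<Longrightarrow>
      dist y x < d \<Longrightarrow> dist (\<phi> y) (\<phi> x) < \<omega>"
    using assms(3) unfolding uniformly_continuous_on_def by metis
  show ?thesis
  proof (rule that[of "min (d / 2) 1"])
    fix p v :: 'a assume pv: "p \<in> S" "norm v \<le> min (d / 2) 1"
    have "dist (\<phi> (p + v)) (\<phi> p) < \<omega>"
    proof (rule d(2))
      show "p \<in> cball 0 (R + 1)" using R[OF pv(1)] by simp
      show "p + v \<in> cball 0 (R + 1)" using R[OF pv(1)] pv(2) norm_triangle_ineq[of p v] by simp
      show "dist (p + v) p < d" using pv(2) d(1) by (simp add: dist_norm)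
    qed
    then show "\<bar>\<phi> (p + v) - \<phi> p\<bar> \<le> \<omega>" by (simp add: dist_real_def)
  qed (use d in simp)
qed

section \<open>Approximation by averages in \<open>t\<close>\<close>

lemma av_shift: "av ws (\<lambda>q. f (q + e)) p = av (map ((+) e) ws) f p"
  by (simp add: av_def comp_def algebra_simps)

context grushin begin

lemma C2_av: "C2 h h1 h2 \<Longrightarrow> C2 (av vs h) (\<lambda>c. av vs (h1 c)) (\<lambda>c d. av vs (h2 c d))"
  unfolding C2_def by (auto intro!: av_continuous av_has_dd)

text \<open>The coefficients depend on |z| only, so translations in t commute with the
  operator.\<close>

lemma BB_av:
  assumes "\<And>v. v \<in> set vs \<Longrightarrow> fst v = 0"
  shows "BB (\<lambda>c d. av vs (h2 c d)) p = av vs (BB h2) p"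
proof -
  have "av vs (\<lambda>q. wgt c q * h2 c c q) p = wgt c p * av vs (h2 c c) p" for c
  proof -
    have "av vs (\<lambda>q. wgt c q * h2 c c q) p = av vs (\<lambda>q. wgt c p * h2 c c q) p"
      using assms by (intro av_cong) (auto simp: wgt_def WW_def split: sum.split)
    then show ?thesis by (simp add: av_cmult)
  qed
  then show ?thesis unfolding BB_def[abs_def] by (simp add: av_sum)
qed

lemma norm_bas: "norm (bas c) = 1"
  by (cases c) (auto simp: bas_def)

text \<open>The norm in \<open>S22\<close> does not control the derivatives in \<open>t\<close> where \<open>z\<close> vanishes, but
  those of an average over small translates in \<open>t\<close> are controlled by difference quotients.\<close>

lemma averaged_approximation:
  fixes f :: "nat \<Rightarrow> ('m, 'k) pt \<Rightarrow> real"
  assumes S: "bounded S" "S \<in> sets borel" "bounded S'" "S' \<in> sets borel"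
    and r0: "r0 > 0" "\<And>p v. p \<in> S \<Longrightarrow> norm v \<le> r0 \<Longrightarrow> p + v \<in> S'"
    and f: "\<And>n. C2 (f n) (f1 n) (f2 n)"
    and u: "sqi S' u" and g: "sqi S' g"
    and fu: "(\<lambda>n. nsq S' (\<lambda>p. f n p - u p)) \<longlonglongrightarrow> 0"
    and fg: "(\<lambda>n. nsq S' (\<lambda>p. BB (f2 n) p - g p)) \<longlonglongrightarrow> 0"
    and M: "\<And>n i. nsq S' (f1 n (Inl i)) \<le> M"
    and \<delta>: "\<delta> > 0"
  obtains h h1 h2 vs where "C2 h h1 h2" "vs \<noteq> []" "\<And>v. v \<in> set vs \<Longrightarrow> fst v = 0 \<and> norm v \<le> \<delta>"
    "nsq S (\<lambda>p. h p - u p) \<le> \<delta>"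
    "(LINT p|lborel. indicator S p * (\<bar>BB h2 p - av vs g p\<bar> * (\<bar>h p\<bar> + \<bar>ZZ h1 p\<bar>))) \<le> \<delta>"
proof -
  have SS: "S \<subseteq> S'" using r0(2)[of _ 0] r0(1) by force
  define vol where "vol = (LINT p|lborel. indicator S p :: real)"
  have voli: "integrable lborel (\<lambda>p. indicator S p :: real)"
    by (rule integrable_bounded_support[of _ 1 S]) (use S in \<open>auto simp: indicator_def\<close>)
  have vol: "vol \<ge> 0" unfolding vol_def by (intro integral_nonneg_AE) auto
  have fs: "sqi S' (f n)" "sqi S' (f1 n c)" "sqi S' (BB (f2 n))" for n c
    by (intro sqi_continuous C2D[OF f] BB_continuous[OF f] S)+
  \<comment> \<open>The three errors in the comparison of \<open>h\<close> with \<open>u\<close> add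
    up to at most 22 times this quantity.\<close>
  define \<epsilon> where "\<epsilon> = \<delta> / 32"
  have \<epsilon>: "\<epsilon> > 0" using \<delta> by (simp add: \<epsilon>_def)
  obtain n1 where n1: "\<And>n. n \<ge> n1 \<Longrightarrow> nsq S' (\<lambda>p. f n p - u p) \<le> \<epsilon>"
    using order_tendstoD(2)[OF fu \<epsilon>] unfolding eventually_sequentially by (meson less_imp_le)
  define \<omega> where "\<omega> = sqrt (\<epsilon> / (vol + 1))"
  have \<omega>: "\<omega> > 0" "\<omega>\<^sup>2 * vol \<le> \<epsilon>"
    using \<epsilon> vol by (auto simp: \<omega>_def field_simps)
  obtain r1 where r1: "r1 > 0" "\<And>p v. p \<in> S \<Longrightarrow> norm v \<le> r1 \<Longrightarrow> \<bar>f n1 (p + v) - f n1 p\<bar> \<le> \<omega>"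
    using uniform_shift[OF C2D(1)[OF f] S(1) \<omega>(1)] by metis
  \<comment> \<open>A sum of one grid vector per direction of t, plus one further step, then stays
    within \<open>\<delta>\<close>, \<open>r0\<close> and \<open>r1\<close>.\<close>
  define \<tau> where "\<tau> = min \<delta> (min r0 r1) / (real CARD('k) + 1)"
  have \<tau>: "\<tau> > 0" using \<delta> r0 r1 by (simp add: \<tau>_def)
  have \<tau>e: "real CARD('k) * \<tau> + \<tau> = min \<delta> (min r0 r1)"
  proof -
    have "real CARD('k) * \<tau> + \<tau> = (real CARD('k) + 1) * \<tau>" by (simp add: algebra_simps)
    then show ?thesis unfolding \<tau>_def by (simp add: add_nonneg_eq_0_iff)
  qed
  define U where "U = 2 * \<epsilon> + 2 * nsq S' u"
  have U: "nsq S' (f n) \<le> U" if "n \<ge> n1" for n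
    using sqi_add(2)[OF S(4) sqi_diff(1)[OF S(4) fs(1)[of n] u] u] n1[OF that] by (simp add: U_def)
  obtain RS where RS: "\<And>p. p \<in> S \<Longrightarrow> norm p \<le> RS" using S(1) bounded_iff by metis
  define Rc where "Rc = kap * \<bar>RS\<bar>"
  have Rc: "(dil c * crd c p)\<^sup>2 \<le> Rc\<^sup>2" if "p \<in> S" for c p
  proof -
    have "norm (fst p) \<le> norm p" "norm (snd p) \<le> norm p"
      using norm_fst_le[of "fst p" "snd p"] norm_snd_le[of "snd p" "fst p"] by simp_all
    then have "\<bar>crd c p\<bar> \<le> norm p"
      using component_le_norm_cart[of "fst p"] component_le_norm_cart[of "snd p"] order_trans
      by (cases c) (simp_all add: crd_def, blast+)
    also have "\<dots> \<le> \<bar>RS\<bar>" using RS[OF that] by linarith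
    finally have "\<bar>dil c\<bar> * \<bar>crd c p\<bar> \<le> kap * \<bar>RS\<bar>"
      using kap by (intro mult_mono) (auto simp: dil_def split: sum.split)
    then have "\<bar>dil c * crd c p\<bar> \<le> \<bar>Rc\<bar>" unfolding Rc_def using kap by (simp add: abs_mult)
    then show ?thesis using abs_le_square_iff by blast
  qed
  \<comment> \<open>This bounds the first derivatives of the average. It depends on
    \<open>\<tau>\<close>, hence on \<open>n1\<close>, but neither on the index \<open>n\<close> nor
    on the fineness \<open>N\<close>, which are chosen afterwards.\<close>
  define M' where "M' = \<bar>M\<bar> + 2 * vol + 8 * U / \<tau>\<^sup>2"
  define C where "C = real CARD('m + 'k)"
  define Q where "Q = 2 * U + 2 * (C * Rc\<^sup>2 * (C * M')) + 1"
  have U0: "U \<ge> 0" using \<epsilon> by (simp add: U_def)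
  have M'0: "M' \<ge> 0" using U0 vol by (simp add: M'_def)
  have Q: "Q > 0" using U0 M'0 unfolding Q_def C_def by (intro add_nonneg_pos add_nonneg_nonneg) auto
  have "\<delta>\<^sup>2 / Q > 0" using \<delta> Q by simp
  \<comment> \<open>Only now is the index taken so large that the error of the operator beats the
    bound \<open>Q\<close> on h and Zh.\<close>
  then obtain n2 where n2: "\<And>n. n \<ge> n2 \<Longrightarrow> nsq S' (\<lambda>p. BB (f2 n) p - g p) \<le> \<delta>\<^sup>2 / Q"
    using order_tendstoD(2)[OF fg] unfolding eventually_sequentially by (meson less_imp_le)
  define n where "n = max n1 n2"
  have n: "n \<ge> n1" "n \<ge> n2" by (auto simp: n_def)
  define e where "e j = \<tau> *\<^sub>R bas (Inr j)" for j
  have ne: "norm (e j) = \<tau>" for j using \<tau> by (simp add: e_def norm_bas)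
  define d where "d j p = \<tau> * f1 n (Inr j) p" for j p
  have dd: "has_dd (e j) (f n) (d j)" "continuous_on UNIV (d j)" for j
    unfolding e_def d_def[abs_def] by (auto intro!: has_dd_scaleR continuous_intros C2D[OF f])
  have "\<exists>N0. N0 > 0 \<and> (\<forall>N\<ge>N0. \<forall>p\<in>S'. \<bar>av (grid N (e j)) (d j) p - (f n (p + e j) - f n p)\<bar> \<le> \<tau>)" for j
  proof -
    obtain N0 where "N0 > 0"
      "\<And>N p. N \<ge> N0 \<Longrightarrow> p \<in> S' \<Longrightarrow> \<bar>av (grid N (e j)) (d j) p - (f n (p + e j) - f n p)\<bar> \<le> \<tau>"
      using av_grid_derivative[OF dd(1)[of j] dd(2)[of j] S(3) \<tau>] by blast
    then show ?thesis by blast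
  qed
  then obtain N0 where N0: "\<And>j. N0 j > 0"
    "\<And>j N p. N \<ge> N0 j \<Longrightarrow> p \<in> S' \<Longrightarrow> \<bar>av (grid N (e j)) (d j) p - (f n (p + e j) - f n p)\<bar> \<le> \<tau>"
    by metis
  \<comment> \<open>The fineness comes last, as it depends on the modulus of continuity of the
    derivatives of \<open>f n\<close>.\<close>
  define N where "N = (\<Sum>j\<in>UNIV. N0 j)"
  have NN: "N \<ge> N0 j" for j unfolding N_def by (rule member_le_sum) auto
  have N: "N > 0" using NN N0(1) by (metis gr0I le_zero_eq)
  obtain js :: "'k list" where js': "set js = UNIV" "distinct js"
    using finite_distinct_list[of "UNIV :: 'k set"] by auto
  have js: "set js = UNIV" "length js = CARD('k)" using distinct_card[OF js'(2)] js'(1) by auto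
  have V: "subspace {v :: ('m, 'k) pt. fst v = 0}" by (auto simp: subspace_def)
  obtain vs where vs: "vs \<noteq> []"
    "\<And>v. v \<in> set vs \<Longrightarrow> v \<in> {v. fst v = 0} \<and> norm v \<le> real (length (map e js)) * \<tau>"
    "\<And>x. x \<in> set (map e js) \<Longrightarrow> \<exists>ws. ws \<noteq> [] \<and>
        (\<forall>w\<in>set ws. w \<in> {v. fst v = 0} \<and> norm w \<le> real (length (map e js)) * \<tau>) \<and>
        (\<forall>f. av vs f = av ws (av (grid N x) f))"
    by (rule multi_grid[OF N _ V, of "map e js" \<tau>]) (use \<tau> in \<open>auto simp: ne e_def[unfolded bas_def]\<close>)
  have vsn: "fst v = 0" "norm v \<le> \<delta>" "norm v \<le> r0" "norm v \<le> r1" if "v \<in> set vs" for v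
    using vs(2)[OF that] js(2) \<tau>e \<tau> by auto
  define h where "h = av vs (f n)"
  define h1 where "h1 c = av vs (f1 n c)" for c
  define h2 where "h2 c d = av vs (f2 n c d)" for c d
  have h: "C2 h h1 h2" unfolding h_def h1_def[abs_def] h2_def[abs_def] by (rule C2_av[OF f])
  have inS': "p + v \<in> S'" if "p \<in> S" "v \<in> set vs" for p v using r0(2) that vsn by blast
  have avS: "sqi S (av vs \<phi>)" "nsq S (av vs \<phi>) \<le> nsq S' \<phi>" if "sqi S' \<phi>" for \<phi>
    using sqi_av[OF that vs(1) inS' S(2)] by auto
  have hs: "sqi S h" "sqi S (h1 c)" "sqi S (BB h2)" "sqi S (ZZ h1)" for c
    by (intro sqi_continuous C2D[OF h] BB_continuous[OF h] ZZ_continuous[OF h] S)+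
  have nh: "nsq S h \<le> U" unfolding h_def using avS(2)[OF fs(1)] U[OF n(1)] by (rule order_trans)
  have "nsq S (h1 c) \<le> M'" for c
  proof (cases c)
    case (Inl i)
    have "nsq S (h1 c) \<le> M" unfolding h1_def Inl using avS(2)[OF fs(2)] M by (rule order_trans)
    then show ?thesis using U0 vol by (simp add: M'_def add_increasing2)
  next
    case (Inr j)
    obtain ws where ws: "ws \<noteq> []" "\<And>w. w \<in> set ws \<Longrightarrow> norm w \<le> real CARD('k) * \<tau>"
      "\<And>f. av vs f = av ws (av (grid N (e j)) f)"
      using vs(3)[of "e j"] js by auto
    have wS: "p + w \<in> S'" if "p \<in> S" "w \<in> set ws" for p w
      using r0(2)[OF that(1)] ws(2)[OF that(2)] \<tau>e \<tau> by auto
    have wS2: "p + w \<in> S'" if pw: "p \<in> S" "w \<in> set (map ((+) (e j)) ws)" for p w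
    proof -
      obtain w' where w': "w = e j + w'" "w' \<in> set ws" using pw(2) by auto
      have "norm w \<le> \<tau> + real CARD('k) * \<tau>"
        unfolding w'(1) using norm_triangle_ineq[of "e j" w'] ws(2)[OF w'(2)] ne[of j] by linarith
      then show ?thesis using r0(2)[OF pw(1)] \<tau>e by auto
    qed
    let ?F = "\<lambda>q. (f n q)\<^sup>2"
    have Fi: "integrable lborel (\<lambda>p. indicator S' p * ?F p)" using sqiD(2)[OF fs(1)] .
    have Fm: "?F \<in> borel_measurable borel" using sqiD(1)[OF fs(1)] by measurable
    have Am: "av ws ?F \<in> borel_measurable borel" for ws using Fm by measurable
    have An: "av ws ?F p \<ge> 0" for ws p by (rule av_nonneg) simp
    have ws': "map ((+) (e j)) ws \<noteq> []" using ws(1) by simp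
    note A1 = integral_av_le[of S' ?F ws S "av ws ?F", OF Fi zero_le_power2 ws(1) wS order_refl Am An S(2)]
    note A2 = integral_av_le[of S' ?F "map ((+) (e j)) ws" S "av (map ((+) (e j)) ws) ?F",
        OF Fi zero_le_power2 ws' wS2 order_refl Am An S(2)]
    have B1: "integrable lborel (\<lambda>p. indicator S p * av ws ?F p)"
      "(LINT p|lborel. indicator S p * av ws ?F p) \<le> U"
      using A1 U[OF n(1)] unfolding nsq_def by (blast, linarith)
    have B2: "integrable lborel (\<lambda>p. indicator S p * av (map ((+) (e j)) ws) ?F p)"
      "(LINT p|lborel. indicator S p * av (map ((+) (e j)) ws) ?F p) \<le> U"
      using A2 U[OF n(1)] unfolding nsq_def by (blast, linarith)
    let ?G = "\<lambda>p. 2 * indicator S p + (4 / \<tau>\<^sup>2) * (indicator S p * av (map ((+) (e j)) ws) ?F p)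
       + (4 / \<tau>\<^sup>2) * (indicator S p * av ws ?F p)"
    have Gi: "integrable lborel ?G" using voli B1(1) B2(1) by auto
    have GI: "integral\<^sup>L lborel ?G \<le> 2 * vol + (4 / \<tau>\<^sup>2) * U + (4 / \<tau>\<^sup>2) * U"
    proof -
      have "integral\<^sup>L lborel ?G = 2 * vol
          + (4 / \<tau>\<^sup>2) * (LINT p|lborel. indicator S p * av (map ((+) (e j)) ws) ?F p)
          + (4 / \<tau>\<^sup>2) * (LINT p|lborel. indicator S p * av ws ?F p)"
        using voli B1(1) B2(1) by (simp add: vol_def)
      moreover have "4 / \<tau>\<^sup>2 \<ge> 0" by simp
      ultimately show ?thesis
        using mult_left_mono[OF B1(2), of "4 / \<tau>\<^sup>2"] mult_left_mono[OF B2(2), of "4 / \<tau>\<^sup>2"] by linarith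
    qed
    \<comment> \<open>Up to an error \<open>\<tau>\<close>, the difference of \<open>f n\<close>
      over a step of length \<open>\<tau>\<close> is \<open>\<tau>\<close> times the averaged
      derivative; dividing by \<open>\<tau>\<close> gives 2 and the factors 4 /
      \<open>\<tau>\<close>^2.\<close>
    have key: "(h1 c p)\<^sup>2 \<le> ?G p" if p: "p \<in> S" for p
    proof -
      have "h1 c p = av ws (av (grid N (e j)) (f1 n (Inr j))) p"
        unfolding h1_def Inr ws(3) ..
      then have "(h1 c p)\<^sup>2 \<le> av ws (\<lambda>q. (av (grid N (e j)) (f1 n (Inr j)) q)\<^sup>2) p"
        using av_sq_le by metis
      also have "\<dots> \<le> av ws (\<lambda>q. 2 + (4 / \<tau>\<^sup>2) * (f n (q + e j))\<^sup>2 + (4 / \<tau>\<^sup>2) * (f n q)\<^sup>2) p"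
      proof (rule av_mono)
        fix w assume w: "w \<in> set ws"
        let ?q = "p + w"
        let ?a = "av (grid N (e j)) (f1 n (Inr j)) ?q"
        have "av (grid N (e j)) (d j) ?q = \<tau> * ?a" unfolding d_def[abs_def] by (rule av_cmult)
        then have "\<bar>\<tau> * ?a - (f n (?q + e j) - f n ?q)\<bar> \<le> \<tau>"
          using N0(2)[OF NN wS[OF p w]] by metis
        then have "\<bar>\<tau> * ?a\<bar> \<le> \<tau> + (\<bar>f n (?q + e j)\<bar> + \<bar>f n ?q\<bar>)" by linarith
        then have "(\<tau> * ?a)\<^sup>2 \<le> (\<tau> + (\<bar>f n (?q + e j)\<bar> + \<bar>f n ?q\<bar>))\<^sup>2"
          by (metis abs_ge_zero power2_abs power_mono)
        also have "\<dots> \<le> 2 * \<tau>\<^sup>2 + 2 * (\<bar>f n (?q + e j)\<bar> + \<bar>f n ?q\<bar>)\<^sup>2"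
          by (rule power2_sum_le)
        also have "(\<bar>f n (?q + e j)\<bar> + \<bar>f n ?q\<bar>)\<^sup>2 \<le> 2 * (f n (?q + e j))\<^sup>2 + 2 * (f n ?q)\<^sup>2"
          using power2_sum_le[of "\<bar>f n (?q + e j)\<bar>" "\<bar>f n ?q\<bar>"] by simp
        finally have "\<tau>\<^sup>2 * ?a\<^sup>2 \<le> 2 * \<tau>\<^sup>2 + 4 * (f n (?q + e j))\<^sup>2 + 4 * (f n ?q)\<^sup>2"
          by (simp add: power_mult_distrib)
        then show "?a\<^sup>2 \<le> 2 + (4 / \<tau>\<^sup>2) * (f n (?q + e j))\<^sup>2 + (4 / \<tau>\<^sup>2) * (f n ?q)\<^sup>2"
          using \<tau> by (simp add: field_simps)
      qed
      also have "\<dots> = ?G p"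
        unfolding av_add av_cmult av_const[OF ws(1)] av_shift[of ws ?F] using p by simp
      finally show ?thesis .
    qed
    have "nsq S (h1 c) \<le> integral\<^sup>L lborel ?G"
      by (rule nsq_dominated(2)[OF S(2) Gi key _ sqiD(1)[OF hs(2)]]) auto
    then show ?thesis using GI by (simp add: M'_def)
  qed
  note nh1 = this
  have nZ: "nsq S (ZZ h1) \<le> C * Rc\<^sup>2 * (C * M')"
  proof -
    let ?G = "\<lambda>p. C * Rc\<^sup>2 * (\<Sum>c\<in>UNIV. indicator S p * (h1 c p)\<^sup>2)"
    have Gi: "integrable lborel ?G"
      by (intro integrable_mult_right Bochner_Integration.integrable_sum sqiD(2)[OF hs(2)])
    have "nsq S (ZZ h1) \<le> integral\<^sup>L lborel ?G"
    proof (rule nsq_dominated(2)[OF S(2) Gi _ _ sqiD(1)[OF hs(4)]])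
      fix p assume p: "p \<in> S"
      have "(ZZ h1 p)\<^sup>2 = (\<Sum>c\<in>UNIV. (dil c * crd c p) * h1 c p)\<^sup>2"
        unfolding ZZ_def by (simp add: mult.assoc)
      also have "\<dots> \<le> (\<Sum>c\<in>UNIV. (dil c * crd c p)\<^sup>2) * (\<Sum>c\<in>UNIV. (h1 c p)\<^sup>2)"
        by (rule Cauchy_Schwarz_ineq_sum)
      also have "\<dots> \<le> (\<Sum>c\<in>(UNIV :: ('m + 'k) set). Rc\<^sup>2) * (\<Sum>c\<in>UNIV. (h1 c p)\<^sup>2)"
        by (intro mult_right_mono sum_mono Rc[OF p] sum_nonneg) auto
      finally have "(ZZ h1 p)\<^sup>2 \<le> C * Rc\<^sup>2 * (\<Sum>c\<in>UNIV. (h1 c p)\<^sup>2)" by (simp add: C_def)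
      moreover have "(\<Sum>c\<in>UNIV. indicator S p * (h1 c p)\<^sup>2) = (\<Sum>c\<in>UNIV. (h1 c p)\<^sup>2)"
        using p by (intro sum.cong) auto
      ultimately show "(ZZ h1 p)\<^sup>2 \<le> ?G p" by simp
    next
      fix p show "0 \<le> ?G p" unfolding C_def
        by (intro mult_nonneg_nonneg sum_nonneg) auto
    qed
    also have "integral\<^sup>L lborel ?G = C * Rc\<^sup>2 * (\<Sum>c\<in>UNIV. nsq S (h1 c))"
      unfolding nsq_def integral_mult_right_zero
      by (subst Bochner_Integration.integral_sum) (use sqiD(2)[OF hs(2)] in auto)
    also have "\<dots> \<le> C * Rc\<^sup>2 * (\<Sum>c\<in>(UNIV :: ('m + 'k) set). M')"
      by (intro mult_left_mono sum_mono nh1) (simp add: C_def)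
    finally show ?thesis by (simp add: C_def)
  qed
  have b: "sqi S (\<lambda>p. \<bar>h p\<bar> + \<bar>ZZ h1 p\<bar>)" "nsq S (\<lambda>p. \<bar>h p\<bar> + \<bar>ZZ h1 p\<bar>) \<le> Q"
    using sqi_add[OF S(2) sqi_abs(1)[OF hs(1)] sqi_abs(1)[OF hs(4)]] nh nZ
    by (auto simp: sqi_abs(2) Q_def)
  have BBh: "BB h2 = av vs (BB (f2 n))"
    unfolding h2_def[abs_def] using BB_av[of vs "f2 n"] vsn(1) by blast
  have Bg: "(\<lambda>p. BB h2 p - av vs g p) = av vs (\<lambda>p. BB (f2 n) p - g p)"
    unfolding BBh by (simp add: fun_eq_iff av_diff)
  have Bgs: "sqi S (\<lambda>p. BB h2 p - av vs g p)" "nsq S (\<lambda>p. BB h2 p - av vs g p) \<le> \<delta>\<^sup>2 / Q"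
    unfolding Bg using avS[OF sqi_diff(1)[OF S(4) fs(3) g]] n2[OF n(2)] order_trans by blast+
  have main: "(LINT p|lborel. indicator S p * (\<bar>BB h2 p - av vs g p\<bar> * (\<bar>h p\<bar> + \<bar>ZZ h1 p\<bar>))) \<le> \<delta>"
  proof -
    have "(LINT p|lborel. indicator S p * (\<bar>BB h2 p - av vs g p\<bar> * (\<bar>h p\<bar> + \<bar>ZZ h1 p\<bar>)))
      \<le> (Q / \<delta>) / 2 * nsq S (\<lambda>p. BB h2 p - av vs g p) + 1 / (2 * (Q / \<delta>)) * nsq S (\<lambda>p. \<bar>h p\<bar> + \<bar>ZZ h1 p\<bar>)"
      using Q \<delta> by (intro integral_product_le(2)[OF S(2) Bgs(1) b(1)]) simp
    also have "\<dots> \<le> (Q / \<delta>) / 2 * (\<delta>\<^sup>2 / Q) + 1 / (2 * (Q / \<delta>)) * Q"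
      using Q \<delta> by (intro add_mono mult_left_mono Bgs(2) b(2)) auto
    also have "\<dots> = \<delta>" using Q \<delta> by (simp add: field_simps power2_eq_square)
    finally show ?thesis .
  qed
  \<comment> \<open>The detour through \<open>f n1\<close> is forced: the translates were made short
    enough for this fixed function before \<open>n\<close> was known.\<close>
  have hu: "nsq S (\<lambda>p. h p - u p) \<le> \<delta>"
  proof -
    have s1: "sqi S' (\<lambda>p. f n p - f n1 p)" "nsq S' (\<lambda>p. f n p - f n1 p) \<le> 4 * \<epsilon>"
      using sqi_diff[OF S(4) sqi_diff(1)[OF S(4) fs(1)[of n] u] sqi_diff(1)[OF S(4) fs(1)[of n1] u]]
        n1[OF n(1)] n1[OF order_refl] by auto
    note a1 = avS[OF s1(1)]
    have a2: "sqi S (\<lambda>p. av vs (f n1) p - f n1 p)" "nsq S (\<lambda>p. av vs (f n1) p - f n1 p) \<le> \<epsilon>"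
    proof -
      have m: "(\<lambda>p. av vs (f n1) p - f n1 p) \<in> borel_measurable borel"
        using sqiD(1)[OF fs(1)] by measurable
      have i: "integrable lborel (\<lambda>p. \<omega>\<^sup>2 * indicator S p)" using voli by simp
      have le: "(av vs (f n1) p - f n1 p)\<^sup>2 \<le> \<omega>\<^sup>2 * indicator S p" if p: "p \<in> S" for p
      proof -
        have "(av vs (\<lambda>q. f n1 q - f n1 p) p)\<^sup>2 \<le> av vs (\<lambda>q. (f n1 q - f n1 p)\<^sup>2) p" by (rule av_sq_le)
        also have "\<dots> \<le> av vs (\<lambda>q. \<omega>\<^sup>2) p"
          using r1(2)[OF p] vsn(4) \<omega>(1) by (intro av_mono) (metis abs_le_square_iff abs_of_pos)
        finally show ?thesis using p by (simp add: av_diff av_const[OF vs(1)])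
      qed
      note D = nsq_dominated[OF S(2) i le _ m]
      show "sqi S (\<lambda>p. av vs (f n1) p - f n1 p)" using D(1) by simp
      show "nsq S (\<lambda>p. av vs (f n1) p - f n1 p) \<le> \<epsilon>" using D(2) \<omega>(2) by (simp add: vol_def)
    qed
    have a3: "sqi S (\<lambda>p. f n1 p - u p)" "nsq S (\<lambda>p. f n1 p - u p) \<le> \<epsilon>"
      using sqi_subset[OF sqi_diff(1)[OF S(4) fs(1)[of n1] u] SS S(2)] n1[OF order_refl] by auto
    have e: "(\<lambda>p. h p - u p) = (\<lambda>p. (av vs (\<lambda>p. f n p - f n1 p) p + (av vs (f n1) p - f n1 p)) + (f n1 p - u p))"
      unfolding h_def by (simp add: fun_eq_iff av_diff)
    note b1 = sqi_add[OF S(2) a1(1) a2(1)]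
    note b2 = sqi_add(2)[OF S(2) b1(1) a3(1)]
    have "x \<le> 22 * E" if "x \<le> 2 * y + 2 * z" "y \<le> 2 * a + 2 * b" "a \<le> c" "b \<le> E" "z \<le> E" "c \<le> 4 * E"
      for x y z a b c E :: real using that by linarith
    from this[OF b2 b1(2) a1(2) a2(2) a3(2) s1(2)]
    have "nsq S (\<lambda>p. h p - u p) \<le> 22 * \<epsilon>" unfolding e .
    then show ?thesis using \<delta> by (simp add: \<epsilon>_def)
  qed
  show thesis
    by (rule that[OF h vs(1) _ hu main]) (use vsn in blast)
qed

end

section \<open>The Carleman inequality for solutions\<close>

lemma integral_sum_list:
  fixes f :: "'b \<Rightarrow> 'a::euclidean_space \<Rightarrow> real"
  assumes "\<And>v. v \<in> set vs \<Longrightarrow> integrable lborel (f v)"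
  shows "integrable lborel (\<lambda>p. \<Sum>v\<leftarrow>vs. f v p)"
    and "(LINT p|lborel. (\<Sum>v\<leftarrow>vs. f v p)) = (\<Sum>v\<leftarrow>vs. LINT p|lborel. f v p)"
proof -
  have "integrable lborel (\<lambda>p. \<Sum>v\<leftarrow>vs. f v p) \<and>
    (LINT p|lborel. (\<Sum>v\<leftarrow>vs. f v p)) = (\<Sum>v\<leftarrow>vs. LINT p|lborel. f v p)"
    using assms by (induction vs) auto
  then show "integrable lborel (\<lambda>p. \<Sum>v\<leftarrow>vs. f v p)"
    "(LINT p|lborel. (\<Sum>v\<leftarrow>vs. f v p)) = (\<Sum>v\<leftarrow>vs. LINT p|lborel. f v p)" by auto
qed

lemma integrable_mult_bounded:
  fixes F y :: "'a::euclidean_space \<Rightarrow> real"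
  assumes "F \<in> borel_measurable borel" "\<And>p. \<bar>F p\<bar> \<le> C" "integrable lborel y"
  shows "integrable lborel (\<lambda>p. F p * y p)"
proof (rule Bochner_Integration.integrable_bound)
  show "integrable lborel (\<lambda>p. C * y p)" using assms(3) by simp
  have [measurable]: "y \<in> borel_measurable borel" using borel_measurable_integrable[OF assms(3)] by simp
  have [measurable]: "F \<in> borel_measurable borel" using assms(1) .
  show "(\<lambda>p. F p * y p) \<in> borel_measurable lborel" by measurable
  show "AE p in lborel. norm (F p * y p) \<le> norm (C * y p)"
  proof (rule AE_I2)
    fix p
    have "\<bar>F p\<bar> * \<bar>y p\<bar> \<le> \<bar>C\<bar> * \<bar>y p\<bar>" using assms(2)[of p] by (intro mult_right_mono) auto
    then show "norm (F p * y p) \<le> norm (C * y p)" by (simp add: abs_mult)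
  qed
qed

text \<open>Translations are moved from the integrable factor to the continuous one.\<close>

lemma integral_weight_av_le:
  fixes F y :: "'a::euclidean_space \<Rightarrow> real"
  assumes F: "F \<in> borel_measurable borel" "\<And>p. \<bar>F p\<bar> \<le> C"
    and y: "integrable lborel y" "\<And>p. y p \<ge> 0" "\<And>p. p \<notin> S' \<Longrightarrow> y p = 0"
    and w: "\<And>p v. p \<in> S' \<Longrightarrow> v \<in> set vs \<Longrightarrow> \<bar>F (p - v) - F p\<bar> \<le> \<omega>" and vs: "vs \<noteq> []"
  shows "integrable lborel (\<lambda>p. F p * av vs y p)"
    "(LINT p|lborel. F p * av vs y p) \<le> (LINT p|lborel. F p * y p) + \<omega> * (LINT p|lborel. y p)"
proof -
  have i: "integrable lborel (\<lambda>p. F p * y (p + v))" for v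
    by (rule integrable_mult_bounded[OF F lborel_integrable_shift[OF y(1)]])
  have iF: "integrable lborel (\<lambda>p. F p * y p)"
    by (rule integrable_mult_bounded[OF F y(1)])
  have [measurable]: "y \<in> borel_measurable borel" "F \<in> borel_measurable borel"
    using borel_measurable_integrable[OF y(1)] F(1) by simp_all
  have b: "(LINT p|lborel. F p * y (p + v)) \<le> (LINT p|lborel. F p * y p) + \<omega> * (LINT p|lborel. y p)"
    if v: "v \<in> set vs" for v
  proof -
    have "(\<lambda>p. F (p - v) * y p) \<in> borel_measurable borel" by measurable
    from lborel_integral_shift[OF this, of v]
    have "(LINT p|lborel. F p * y (p + v)) = (LINT p|lborel. F (p - v) * y p)" by simp
    also have "\<dots> \<le> (LINT p|lborel. F p * y p + \<omega> * y p)"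
    proof (rule integral_mono)
      show "integrable lborel (\<lambda>p. F (p - v) * y p)"
        by (rule integrable_mult_bounded[of _ C]) (use F y in auto)
      show "integrable lborel (\<lambda>p. F p * y p + \<omega> * y p)" using iF y(1) by simp
      fix p
      show "F (p - v) * y p \<le> F p * y p + \<omega> * y p"
      proof (cases "p \<in> S'")
        case True
        have "F (p - v) \<le> F p + \<omega>" using w[OF True v] by linarith
        from mult_right_mono[OF this y(2)[of p]] show ?thesis by (simp add: distrib_right)
      qed (simp add: y(3))
    qed
    also have "\<dots> = (LINT p|lborel. F p * y p) + \<omega> * (LINT p|lborel. y p)" using iF y(1) by simp
    finally show ?thesis .
  qed
  let ?B = "(LINT p|lborel. F p * y p) + \<omega> * (LINT p|lborel. y p)"
  have e: "F p * av vs y p = (\<Sum>v\<leftarrow>vs. F p * y (p + v)) / real (length vs)" for p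
    by (simp add: av_def sum_list_const_mult)
  show "integrable lborel (\<lambda>p. F p * av vs y p)"
    unfolding e using integral_sum_list(1)[of vs "\<lambda>v p. F p * y (p + v)"] i by simp
  have "(LINT p|lborel. F p * av vs y p) = (\<Sum>v\<leftarrow>vs. LINT p|lborel. F p * y (p + v)) / real (length vs)"
    unfolding e using integral_sum_list(2)[of vs "\<lambda>v p. F p * y (p + v)"] i by simp
  also have "\<dots> \<le> (\<Sum>v\<leftarrow>vs. ?B) / real (length vs)"
    by (intro divide_right_mono sum_list_mono b) auto
  also have "\<dots> = ?B" using vs by (simp add: sum_list_triv)
  finally show "(LINT p|lborel. F p * av vs y p) \<le> ?B" .
qed

text \<open>The difference of the squares factors into h - u, which is small, and (h - u) + 2 u,
  which is bounded; balancing the two in Young's inequality gives the order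
  \<open>sqrt \<delta>\<close>.\<close>

lemma integral_weight_square_le:
  fixes F h u :: "'a::euclidean_space \<Rightarrow> real"
  assumes S: "S \<in> sets borel" and F: "F \<in> borel_measurable borel" "\<And>p. \<bar>F p\<bar> \<le> C * indicator S p" "C \<ge> 0"
    and h: "sqi S h" and u: "sqi S u" and d: "nsq S (\<lambda>p. h p - u p) \<le> \<delta>" "\<delta> > 0"
  shows "(LINT p|lborel. F p * (u p)\<^sup>2) \<le> (LINT p|lborel. F p * (h p)\<^sup>2) + C * (sqrt \<delta> * (1 / 2 + \<delta> + 4 * nsq S u))"
proof -
  have Fb: "\<bar>F p\<bar> \<le> C" for p using F(2)[of p] F(3) by (cases "p \<in> S") auto
  have i: "integrable lborel (\<lambda>p. F p * (w p)\<^sup>2)" if "sqi S w" for w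
  proof -
    have "integrable lborel (\<lambda>p. F p * (indicator S p * (w p)\<^sup>2))"
      by (rule integrable_mult_bounded[OF F(1) Fb sqiD(2)[OF that]])
    moreover have "F p * (indicator S p * (w p)\<^sup>2) = F p * (w p)\<^sup>2" for p
      using F(2)[of p] by (cases "p \<in> S") auto
    ultimately show ?thesis by simp
  qed
  have hp: "sqi S (\<lambda>p. h p - u p)" "sqi S (\<lambda>p. (h p - u p) + 2 * u p)"
    "nsq S (\<lambda>p. (h p - u p) + 2 * u p) \<le> 2 * \<delta> + 8 * nsq S u"
    using sqi_diff[OF S h u] sqi_add[OF S sqi_diff(1)[OF S h u] sqi_cmult(1)[OF u, of 2]] d(1)
      sqi_cmult(2)[of S 2 u] by auto
  let ?P = "\<lambda>p. indicator S p * (\<bar>h p - u p\<bar> * \<bar>(h p - u p) + 2 * u p\<bar>)"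
  have sd: "sqrt \<delta> > 0" using d by simp
  note ip = integral_product_le[OF S hp(1) sqi_abs(1)[OF hp(2)], of "1 / sqrt \<delta>"]
  have ip1: "integrable lborel ?P" using ip(1) sd by simp
  have "(LINT p|lborel. ?P p) \<le> (1 / sqrt \<delta>) / 2 * nsq S (\<lambda>p. h p - u p)
      + 1 / (2 * (1 / sqrt \<delta>)) * nsq S (\<lambda>p. (h p - u p) + 2 * u p)"
    using ip(2) sd by (simp add: sqi_abs(2))
  also have "\<dots> \<le> (1 / sqrt \<delta>) / 2 * \<delta> + 1 / (2 * (1 / sqrt \<delta>)) * (2 * \<delta> + 8 * nsq S u)"
    using sd by (intro add_mono mult_left_mono d(1) hp(3)) auto
  also have "\<dots> = sqrt \<delta> * (1 / 2 + \<delta> + 4 * nsq S u)"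
  proof -
    have "\<delta> / sqrt \<delta> = sqrt \<delta>" using d(2) by (simp add: real_div_sqrt)
    then have "(1 / sqrt \<delta>) / 2 * \<delta> = sqrt \<delta> / 2" by (simp add: field_simps)
    then show ?thesis using sd by (simp add: algebra_simps)
  qed
  finally have P: "(LINT p|lborel. ?P p) \<le> sqrt \<delta> * (1 / 2 + \<delta> + 4 * nsq S u)" .
  have le: "F p * (u p)\<^sup>2 \<le> F p * (h p)\<^sup>2 + C * ?P p" for p
  proof -
    have "F p * (u p)\<^sup>2 - F p * (h p)\<^sup>2 = - F p * ((h p - u p) * ((h p - u p) + 2 * u p))"
      by (simp add: algebra_simps power2_eq_square)
    also have "\<dots> \<le> \<bar>F p\<bar> * (\<bar>h p - u p\<bar> * \<bar>(h p - u p) + 2 * u p\<bar>)"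
      by (metis abs_ge_self abs_minus_cancel abs_mult)
    also have "\<dots> \<le> (C * indicator S p) * (\<bar>h p - u p\<bar> * \<bar>(h p - u p) + 2 * u p\<bar>)"
      by (intro mult_right_mono F) auto
    finally show ?thesis by (simp add: mult.assoc)
  qed
  have "(LINT p|lborel. F p * (u p)\<^sup>2) \<le> (LINT p|lborel. F p * (h p)\<^sup>2 + C * ?P p)"
    by (rule integral_mono[OF i[OF u] _ le]) (use i[OF h] ip1 in simp)
  also have "\<dots> = (LINT p|lborel. F p * (h p)\<^sup>2) + C * (LINT p|lborel. ?P p)"
    using i[OF h] ip1 by simp
  also have "\<dots> \<le> (LINT p|lborel. F p * (h p)\<^sup>2) + C * (sqrt \<delta> * (1 / 2 + \<delta> + 4 * nsq S u))"
    using mult_left_mono[OF P F(3)] by simp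
  finally show ?thesis .
qed

text \<open>Young's inequality for a \<open>G\<close> known only through its square. The weight
  \<open>m\<close> stays with t^2, where the Carleman inequality can absorb it.\<close>

lemma product_le_of_square_le:
  fixes G m Y t c :: real
  assumes "G\<^sup>2 \<le> m * Y" "m \<ge> 0" "Y \<ge> 0" "c > 0"
  shows "\<bar>G\<bar> * \<bar>t\<bar> \<le> c * m * t\<^sup>2 + Y / (4 * c)"
proof -
  have "\<bar>G\<bar> \<le> sqrt (m * Y)" using assms(1) by (simp add: real_le_rsqrt)
  then have "\<bar>G\<bar> * \<bar>t\<bar> \<le> (sqrt m * \<bar>t\<bar>) * sqrt Y"
    by (metis abs_ge_zero mult.assoc mult.commute mult_right_mono real_sqrt_mult)
  moreover have "0 \<le> (2 * c * (sqrt m * \<bar>t\<bar>) - sqrt Y)\<^sup>2" by simp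
  then have "4 * c * ((sqrt m * \<bar>t\<bar>) * sqrt Y) \<le> 4 * c\<^sup>2 * (m * t\<^sup>2) + Y"
    using assms by (simp add: power2_diff power_mult_distrib mult_ac)
  then have "(sqrt m * \<bar>t\<bar>) * sqrt Y \<le> c * m * t\<^sup>2 + Y / (4 * c)"
    using assms(4) by (simp add: field_simps power2_eq_square)
  ultimately show ?thesis by linarith
qed

context grushin begin

lemma shell_shift:
  assumes "a' < a" "b < b'"
  obtains r where "r > 0" "\<And>p v. p \<in> shell a b \<Longrightarrow> norm v \<le> r \<Longrightarrow> p + v \<in> shell a' b'"
proof -
  define \<omega> where "\<omega> = min (exp (2 * kap * a) - exp (2 * kap * a')) (exp (2 * kap * b') - exp (2 * kap * b))"
  have w: "\<omega> > 0" using assms kap by (simp add: \<omega>_def)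
  obtain r where r: "r > 0" "\<And>p v. p \<in> shell a b \<Longrightarrow> norm v \<le> r \<Longrightarrow> \<bar>DD (p + v) - DD p\<bar> \<le> \<omega>"
    using uniform_shift[OF DD_continuous shell_bounded w] by metis
  have "p + v \<in> shell a' b'" if "p \<in> shell a b" "norm v \<le> r" for p v
    using r(2)[OF that] that(1) unfolding shell_DD \<omega>_def by linarith
  then show ?thesis using that r(1) by blast
qed

lemma lg_measurable [measurable]: "lg \<in> borel_measurable borel"
proof -
  have [measurable]: "DD \<in> borel_measurable borel"
    by (rule borel_measurable_continuous_onI) (rule DD_continuous)
  show ?thesis unfolding lg_def[abs_def] by measurable
qed

lemma WW_measurable [measurable]: "WW \<in> borel_measurable borel"
  by (rule borel_measurable_continuous_onI) (rule WW_continuous)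

lemma shell_measurable [measurable]: "shell a b \<in> sets borel"
  by (simp add: shell_closed borel_closed)

lemma WW_mm: "WW p = mm p * DD p"
  by (cases "p = 0") (use gam in \<open>auto simp: mm_def WW_def\<close>)

lemma WW_bounded_shell:
  obtains C where "C > 0" "\<And>p. p \<in> shell a b \<Longrightarrow> WW p \<le> C"
  using continuous_compact_bounded[OF WW_continuous shell_bounded] by (metis WW_nonneg abs_of_nonneg)

end

section \<open>From averages to the solution\<close>

context carleman_weights begin

lemma weight_bounded:
  fixes F :: "('m, 'k) pt \<Rightarrow> real"
  assumes "continuous_on UNIV F" "\<And>p. p \<notin> shell a b \<Longrightarrow> F p = 0"
  obtains C where "C > 0" "\<And>p. \<bar>F p\<bar> \<le> C * indicator (shell a b) p"
proof -
  obtain C where C: "C > 0" "\<And>p. p \<in> shell a b \<Longrightarrow> \<bar>F p\<bar> \<le> C"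
    using continuous_compact_bounded[OF assms(1) shell_bounded] by metis
  have "\<bar>F p\<bar> \<le> C * indicator (shell a b) p" for p
    using C(2)[of p] assms(2)[of p] by (cases "p \<in> shell a b") auto
  then show ?thesis using that C(1) by blast
qed

text \<open>The weights left after Young's inequality: 1/4 comes from splitting the potential
  against the square of \<open>TT\<close>, and each 3/2 from splitting \<open>3 * zeta\<close> times
  |h B| with parameter e^(2 s) / 2.\<close>

definition "wmain s = eta s * EE s * (- 2 * bb1 s) * ((bb s)\<^sup>2 - 1 / 4)"
definition "wpot s = eta s * EE s / 4 + 3 / 2 * zeta s * exp (- 2 * s)"
definition "wcut s = 3 / 2 * zeta s * exp (2 * s) + (2 * zeta s + \<bar>zeta2 s + 2 * qq * zeta1 s\<bar>)"

lemma w_continuous: "continuous_on A wmain" "continuous_on A wpot" "continuous_on A wcut"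
  unfolding wmain_def wpot_def wcut_def by (intro continuous_intros; simp)+

lemma w_support: "s \<notin> {a..b} \<Longrightarrow> wmain s = 0" "s \<notin> {a..b} \<Longrightarrow> wpot s = 0" "s \<notin> {a..b} \<Longrightarrow> wcut s = 0"
  using cutoff_support[of s] by (auto simp: wmain_def wpot_def wcut_def)

text \<open>\<open>carleman_C2\<close> is applied to averages \<open>h\<close>, whose operator is
  close to \<open>av vs g\<close> when tested against |h| + |Zh|. The potential enters through the
  square of \<open>av vs g\<close>, and the averages are removed in the limit of short
  translates.\<close>

lemma carleman_solution:
  fixes f :: "nat \<Rightarrow> ('m, 'k) pt \<Rightarrow> real"
  assumes ab: "a' < a" "b < b'"
    and f: "\<And>n. C2 (f n) (f1 n) (f2 n)"
    and u: "sqi (shell a' b') u" and g: "sqi (shell a' b') g"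
    and fu: "(\<lambda>n. nsq (shell a' b') (\<lambda>p. f n p - u p)) \<longlonglongrightarrow> 0"
    and fg: "(\<lambda>n. nsq (shell a' b') (\<lambda>p. BB (f2 n) p - g p)) \<longlonglongrightarrow> 0"
    and M: "\<And>n i. nsq (shell a' b') (f1 n (Inl i)) \<le> M"
    and V: "\<And>p. p \<in> shell a' b' \<Longrightarrow> \<bar>g p\<bar> \<le> K * (WW p * exp (- 2 * \<gamma> * lg p)) * \<bar>u p\<bar>"
    and K: "K \<ge> 0"
  shows "(LINT p|lborel. (mm p * rad wmain p - mm p * rad wcut p) * (u p)\<^sup>2)
    \<le> K\<^sup>2 * (LINT p|lborel. mm p * rad (\<lambda>s. wpot s * exp (4 * s)) p * (u p)\<^sup>2)"
proof -
  let ?S = "shell a b" and ?S' = "shell a' b'"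
  obtain r0 where r0: "r0 > 0" "\<And>p v. p \<in> ?S \<Longrightarrow> norm v \<le> r0 \<Longrightarrow> p + v \<in> ?S'"
    using shell_shift[OF ab] by metis
  have SS: "?S \<subseteq> ?S'" using r0(2)[of _ 0] r0(1) by force
  have uS: "sqi ?S u" using sqi_subset(1)[OF u SS shell_measurable] .
  define F where "F p = mm p * rad wmain p - mm p * rad wcut p" for p
  \<comment> \<open>This is \<open>wpot\<close> times \<open>DD\<close>, continuous and hence nearly
    invariant under short translations.\<close>
  define F2 where "F2 = rad (\<lambda>s. wpot s * exp (2 * kap * s))"
  \<comment> \<open>This is \<psi>^2 u^2 with one factor \<open>WW\<close> split off. That factor is
    constant along the translates; the rest, with \<open>lg\<close> in it, is not, and is
    averaged.\<close>
  define y where "y p = indicator ?S' p * (WW p * exp (- 4 * \<gamma> * lg p) * (u p)\<^sup>2)" for p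
  have Fc: "continuous_on UNIV F" unfolding F_def[abs_def]
    by (intro continuous_intros rad_mm_continuous[of _ a b] w_continuous w_support)
  have F0: "F p = 0" if "p \<notin> ?S" for p
    using rad_support[of a b wmain p] rad_support[of a b wcut p] w_support that by (simp add: F_def)
  have F2c: "continuous_on UNIV F2" unfolding F2_def
    by (rule rad_continuous[of _ a b]) (auto intro!: continuous_intros w_continuous simp: w_support)
  have F20: "F2 p = 0" if "p \<notin> ?S" for p
    unfolding F2_def by (rule rad_support[of a b]) (use that in \<open>auto simp: w_support\<close>)
  have wpos: "wpot s \<ge> 0" for s
    using eta(5)[of s] zeta(5)[of s] EE_pos[of s] by (simp add: wpot_def)
  have F2pos: "F2 p \<ge> 0" for p by (simp add: F2_def rad_def wpos)
  obtain CF where CF: "CF > 0" "\<And>p. \<bar>F p\<bar> \<le> CF * indicator ?S p"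
    using weight_bounded[OF Fc F0] by metis
  obtain C2' where C2': "C2' > 0" "\<And>p. \<bar>F2 p\<bar> \<le> C2' * indicator ?S p"
    using weight_bounded[OF F2c F20] by metis
  have F2b: "\<bar>F2 p\<bar> \<le> C2'" for p using C2'(2)[of p] C2'(1) by (cases "p \<in> ?S") auto
  have F2m: "F2 \<in> borel_measurable borel" by (rule borel_measurable_continuous_onI[OF F2c])
  obtain Ca where Ca: "Ca > 0" "\<And>p. \<bar>rad (\<lambda>s. eta s * EE s * (2 * bb s)) p\<bar> \<le> Ca * indicator ?S p"
    by (rule weight_bounded[of "rad (\<lambda>s. eta s * EE s * (2 * bb s))"])
      (auto intro!: rad_continuous[of _ a b] continuous_intros rad_support[of a b] simp: cutoff_support)
  obtain Cb where Cb: "Cb > 0" "\<And>p. \<bar>rad (\<lambda>s. eta s * EE s * bet s) p\<bar> \<le> Cb * indicator ?S p"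
    by (rule weight_bounded[of "rad (\<lambda>s. eta s * EE s * bet s)"])
      (auto intro!: rad_continuous[of _ a b] continuous_intros rad_support[of a b] simp: cutoff_support)
  obtain Cc where Cc: "Cc > 0" "\<And>p. \<bar>rad zeta p\<bar> \<le> Cc * indicator ?S p"
    by (rule weight_bounded[of "rad zeta"])
      (auto intro!: rad_continuous[of _ a b] continuous_intros rad_support[of a b] simp: cutoff_support)
  define Ce where "Ce = Ca + Cb + 3 * Cc"
  have Ce: "Ce > 0" using Ca Cb Cc by (simp add: Ce_def)
  have um [measurable]: "u \<in> borel_measurable borel" using sqiD(1)[OF u] .
  have yi: "integrable lborel y"
  proof -
    obtain CW where CW: "CW > 0" "\<And>p. p \<in> ?S' \<Longrightarrow> WW p \<le> CW" using WW_bounded_shell by metis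
    have b: "\<bar>indicator ?S' p * (WW p * exp (- 4 * \<gamma> * lg p))\<bar> \<le> CW * exp (- 4 * \<gamma> * a')" for p
    proof (cases "p \<in> ?S'")
      case True
      then have "a' \<le> lg p" by (simp add: shell_def)
      then have "exp (- 4 * \<gamma> * lg p) \<le> exp (- 4 * \<gamma> * a')" using gam by simp
      then have "WW p * exp (- 4 * \<gamma> * lg p) \<le> CW * exp (- 4 * \<gamma> * a')"
        using CW(2)[OF True] CW(1) by (intro mult_mono) auto
      then show ?thesis using True by simp
    qed (use CW in simp)
    have "integrable lborel (\<lambda>p. (indicator ?S' p * (WW p * exp (- 4 * \<gamma> * lg p))) * (indicator ?S' p * (u p)\<^sup>2))"
      by (rule integrable_mult_bounded[OF _ b sqiD(2)[OF u]]) measurable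
    moreover have "(indicator ?S' p * (WW p * exp (- 4 * \<gamma> * lg p))) * (indicator ?S' p * (u p)\<^sup>2) = y p" for p
      by (cases "p \<in> ?S'") (auto simp: y_def)
    ultimately show ?thesis by simp
  qed
  have y0: "y p \<ge> 0" for p by (simp add: y_def)
  have yo: "p \<notin> ?S' \<Longrightarrow> y p = 0" for p by (simp add: y_def)
  have F2y: "(LINT p|lborel. F2 p * y p) = (LINT p|lborel. mm p * rad (\<lambda>s. wpot s * exp (4 * s)) p * (u p)\<^sup>2)"
  proof (rule Bochner_Integration.integral_cong[OF refl])
    fix p :: "('m, 'k) pt"
    show "F2 p * y p = mm p * rad (\<lambda>s. wpot s * exp (4 * s)) p * (u p)\<^sup>2"
    proof (cases "p \<in> ?S")
      case False
      then show ?thesis using F20[OF False] w_support(2)[of "lg p"] by (auto simp: shell_def rad_def)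
    next
      case True
      then have p: "p \<noteq> 0" "p \<in> ?S'" using SS by (auto simp: shell_def)
      have "F2 p * y p = mm p * (wpot (lg p) * (exp (2 * kap * lg p) * DD p * exp (- 4 * \<gamma> * lg p))) * (u p)\<^sup>2"
        using p by (simp add: F2_def rad_def y_def WW_mm)
      \<comment> \<open>The exponents add up to 4 \<open>kap\<close> - 4 \<gamma> = 4, the power of
        \<rho> next to K^2.\<close>
      also have "exp (2 * kap * lg p) * DD p * exp (- 4 * \<gamma> * lg p) = exp (4 * lg p)"
        unfolding exp_lg[OF p(1), symmetric] exp_add[symmetric] by (simp add: kap_def algebra_simps)
      finally show ?thesis using p by (simp add: rad_def)
    qed
  qed
  have main: "(LINT p|lborel. F p * (u p)\<^sup>2) \<le> K\<^sup>2 * (LINT p|lborel. F2 p * y p)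
      + K\<^sup>2 * \<omega> * (LINT p|lborel. y p) + Ce * \<delta> + CF * (sqrt \<delta> * (1 / 2 + \<delta> + 4 * nsq ?S u))"
    if d: "\<delta> > 0" "\<delta> \<le> r0" "\<omega> > 0" and w: "\<And>p v. p \<in> ?S' \<Longrightarrow> norm v \<le> \<delta> \<Longrightarrow> \<bar>F2 (p + v) - F2 p\<bar> \<le> \<omega>" for \<delta> \<omega>
  proof -
    obtain h h1 h2 vs where h: "C2 h h1 h2" "vs \<noteq> []" "\<And>v. v \<in> set vs \<Longrightarrow> fst v = 0 \<and> norm v \<le> \<delta>"
      "nsq ?S (\<lambda>p. h p - u p) \<le> \<delta>"
      "(LINT p|lborel. indicator ?S p * (\<bar>BB h2 p - av vs g p\<bar> * (\<bar>h p\<bar> + \<bar>ZZ h1 p\<bar>))) \<le> \<delta>"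
    proof (rule averaged_approximation[OF shell_bounded[of a b] shell_measurable[of a b]
          shell_bounded[of a' b'] shell_measurable[of a' b'] r0(1) _ f u g fu fg M d(1)])
      show "p + v \<in> ?S'" if "p \<in> ?S" "norm v \<le> r0" for p v using r0(2)[OF that] .
    qed (rule that)
    have hc: "continuous_on UNIV h" "continuous_on UNIV (ZZ h1)" "continuous_on UNIV (BB h2)"
      using C2D[OF h(1)] ZZ_continuous[OF h(1)] BB_continuous[OF h(1)] by auto
    have inS': "p + v \<in> ?S'" if "p \<in> ?S" "v \<in> set vs" for p v
      using r0(2)[OF that(1)] h(3)[OF that(2)] d by auto
    \<comment> \<open>As \<open>mm * DD = WW\<close>, the square of \<open>av vs g\<close> is at
      most \<open>mm * Y\<close>, the form that \<open>product_le_of_square_le\<close>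
      needs.\<close>
    define Y where "Y p = K\<^sup>2 * (DD p * av vs y p)" for p
    have Y0: "Y p \<ge> 0" for p unfolding Y_def by (intro mult_nonneg_nonneg av_nonneg y0) auto
    have GY: "(av vs g p)\<^sup>2 \<le> mm p * Y p" if p: "p \<in> ?S" for p
    proof -
      have "(av vs g p)\<^sup>2 \<le> av vs (\<lambda>q. (g q)\<^sup>2) p" by (rule av_sq_le)
      also have "\<dots> \<le> av vs (\<lambda>q. (K\<^sup>2 * WW p) * y q) p"
      proof (rule av_mono)
        fix v assume v: "v \<in> set vs"
        have q: "p + v \<in> ?S'" by (rule inS'[OF p v])
        have W: "WW (p + v) = WW p" using h(3)[OF v] by (simp add: WW_def)
        have "(g (p + v))\<^sup>2 \<le> (K * (WW p * exp (- 2 * \<gamma> * lg (p + v))) * \<bar>u (p + v)\<bar>)\<^sup>2"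
          using V[OF q] W by (metis abs_ge_zero power2_abs power_mono)
        also have "\<dots> = (K\<^sup>2 * WW p) * (WW p * (exp (- 2 * \<gamma> * lg (p + v)))\<^sup>2 * (u (p + v))\<^sup>2)"
          by (simp add: power_mult_distrib power2_eq_square)
        also have "(exp (- 2 * \<gamma> * lg (p + v)))\<^sup>2 = exp (- 4 * \<gamma> * lg (p + v))"
          by (simp add: power2_eq_square exp_add[symmetric])
        finally show "(g (p + v))\<^sup>2 \<le> (K\<^sup>2 * WW p) * y (p + v)"
          using q W by (simp add: y_def)
      qed
      also have "\<dots> = mm p * Y p" by (simp add: av_cmult Y_def WW_mm)
      finally show ?thesis .
    qed
    define er where "er p = indicator ?S p * (\<bar>BB h2 p - av vs g p\<bar> * (\<bar>h p\<bar> + \<bar>ZZ h1 p\<bar>))" for p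
    have eri: "integrable lborel er"
      unfolding er_def[abs_def]
    proof (rule integral_product_le(1)[OF shell_measurable, where c = 1])
      have "sqi ?S (av vs g)" by (rule sqi_av(1)[OF g h(2) inS' shell_measurable])
      then show "sqi ?S (\<lambda>p. BB h2 p - av vs g p)"
        by (intro sqi_diff(1) shell_measurable sqi_continuous[of "BB h2"] hc shell_bounded)
      show "sqi ?S (\<lambda>p. \<bar>h p\<bar> + \<bar>ZZ h1 p\<bar>)"
        by (intro sqi_continuous continuous_intros hc shell_bounded shell_measurable)
    qed simp
    let ?T1 = "\<lambda>p. mm p * rad (\<lambda>s. eta s * EE s) p * (TT h h1 p)\<^sup>2"
    let ?T2 = "\<lambda>p. mm p * rad wmain p * (h p)\<^sup>2"
    let ?T3 = "\<lambda>p. rad (\<lambda>s. eta s * EE s) p * BB h2 p * TT h h1 p"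
    let ?T4 = "\<lambda>p. rad zeta p * (3 * \<bar>h p * BB h2 p\<bar>)"
    let ?T5 = "\<lambda>p. mm p * rad (\<lambda>s. 2 * zeta s + \<bar>zeta2 s + 2 * qq * zeta1 s\<bar>) p * (h p)\<^sup>2"
    let ?T6 = "\<lambda>p. mm p * rad wcut p * (h p)\<^sup>2"
    let ?T7 = "\<lambda>p. F2 p * av vs y p"
    note C = carleman_C2[OF h(1)]
    have pw: "?T3 p + ?T4 p + ?T5 p \<le> ?T1 p + Ce * er p + K\<^sup>2 * ?T7 p + ?T6 p" for p
    proof (cases "p \<in> ?S")
      case False
      have z: "rad F p = 0" if "\<And>s. s \<notin> {a..b} \<Longrightarrow> F s = 0" for F using rad_support[OF that False] .
      have "rad (\<lambda>s. eta s * EE s) p = 0" "rad zeta p = 0"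
        "rad (\<lambda>s. 2 * zeta s + \<bar>zeta2 s + 2 * qq * zeta1 s\<bar>) p = 0" "rad wcut p = 0"
        by (rule z; simp add: cutoff_support w_support)+
      then show ?thesis using False F20 by (simp add: er_def)
    next
      case True
      then have p: "p \<noteq> 0" by (simp add: shell_def)
      let ?s = "lg p" and ?G = "av vs g p"
      have r: "rad X p = X ?s" for X using p by (simp add: rad_def)
      have eE: "eta ?s * EE ?s \<ge> 0" using eta(5)[of ?s] EE_pos[of ?s] by simp
      have D: "F2 p * av vs y p * K\<^sup>2 = wpot ?s * Y p"
        unfolding F2_def r Y_def exp_lg[OF p] by simp
      note Yp = product_le_of_square_le[OF GY[OF True] mm_nonneg Y0]
      \<comment> \<open>With parameter 1 the first term, weighted by \<open>eta * EE\<close>, is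
        exactly the square kept on the left of \<open>carleman_C2\<close>.\<close>
      have a1: "?G * TT h h1 p \<le> mm p * (TT h h1 p)\<^sup>2 + Y p / 4"
        using Yp[of 1 "TT h h1 p"] abs_ge_self[of "?G * TT h h1 p"] by (simp add: abs_mult)
      have a2: "\<bar>?G\<bar> * \<bar>h p\<bar> \<le> exp (2 * ?s) / 2 * mm p * (h p)\<^sup>2 + exp (- 2 * ?s) / 2 * Y p"
        using Yp[of "exp (2 * ?s) / 2" "h p"] by (simp add: exp_minus field_simps)
      have t: "eta ?s * EE ?s * \<bar>TT h h1 p\<bar> \<le> (Ca + Cb) * (\<bar>h p\<bar> + \<bar>ZZ h1 p\<bar>)"
      proof -
        have "eta ?s * EE ?s * \<bar>TT h h1 p\<bar> = \<bar>(eta ?s * EE ?s * (2 * bb ?s)) * ZZ h1 p + (eta ?s * EE ?s * bet ?s) * h p\<bar>"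
          using eE unfolding TT_def by (subst abs_of_nonneg[OF eE, symmetric], subst abs_mult[symmetric]) (simp add: algebra_simps)
        also have "\<dots> \<le> \<bar>eta ?s * EE ?s * (2 * bb ?s)\<bar> * \<bar>ZZ h1 p\<bar> + \<bar>eta ?s * EE ?s * bet ?s\<bar> * \<bar>h p\<bar>"
          by (rule order_trans[OF abs_triangle_ineq]) (simp add: abs_mult)
        also have "\<dots> \<le> Ca * \<bar>ZZ h1 p\<bar> + Cb * \<bar>h p\<bar>"
          using Ca(2)[of p] Cb(2)[of p] True unfolding r by (intro add_mono mult_right_mono) auto
        also have "\<dots> \<le> (Ca + Cb) * (\<bar>h p\<bar> + \<bar>ZZ h1 p\<bar>)"
          using Ca(1) Cb(1) by (simp add: algebra_simps)
        finally show ?thesis .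
      qed
      have z: "zeta ?s * \<bar>h p\<bar> \<le> Cc * (\<bar>h p\<bar> + \<bar>ZZ h1 p\<bar>)"
      proof -
        have "zeta ?s \<le> Cc" using Cc(2)[of p] True zeta(5)[of ?s] unfolding r by simp
        then have "zeta ?s * \<bar>h p\<bar> \<le> Cc * \<bar>h p\<bar>" by (rule mult_right_mono) simp
        also have "\<dots> \<le> Cc * (\<bar>h p\<bar> + \<bar>ZZ h1 p\<bar>)" using Cc(1) by (intro mult_left_mono) auto
        finally show ?thesis .
      qed
      let ?E = "\<bar>BB h2 p - ?G\<bar>"
      have b3: "?T3 p \<le> (Ca + Cb) * (\<bar>h p\<bar> + \<bar>ZZ h1 p\<bar>) * ?E + ?T1 p + eta ?s * EE ?s / 4 * Y p"
      proof -
        have "?T3 p = eta ?s * EE ?s * (TT h h1 p * (BB h2 p - ?G)) + eta ?s * EE ?s * (?G * TT h h1 p)"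
          unfolding r by (simp add: algebra_simps)
        also have "eta ?s * EE ?s * (TT h h1 p * (BB h2 p - ?G)) \<le> eta ?s * EE ?s * (\<bar>TT h h1 p\<bar> * ?E)"
          by (intro mult_left_mono eE) (metis abs_ge_self abs_mult)
        also have "eta ?s * EE ?s * (\<bar>TT h h1 p\<bar> * ?E) \<le> (Ca + Cb) * (\<bar>h p\<bar> + \<bar>ZZ h1 p\<bar>) * ?E"
          using mult_right_mono[OF t abs_ge_zero[of "BB h2 p - ?G"]] by (simp add: mult.assoc)
        also have "eta ?s * EE ?s * (?G * TT h h1 p) \<le> eta ?s * EE ?s * (mm p * (TT h h1 p)\<^sup>2 + Y p / 4)"
          by (intro mult_left_mono eE a1)
        finally show ?thesis unfolding r by (simp add: algebra_simps)
      qed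
      have b4: "?T4 p \<le> 3 * Cc * (\<bar>h p\<bar> + \<bar>ZZ h1 p\<bar>) * ?E
          + 3 / 2 * zeta ?s * exp (2 * ?s) * mm p * (h p)\<^sup>2 + 3 / 2 * zeta ?s * exp (- 2 * ?s) * Y p"
      proof -
        have "\<bar>h p * BB h2 p\<bar> \<le> \<bar>h p\<bar> * ?E + \<bar>?G\<bar> * \<bar>h p\<bar>"
        proof -
          have "\<bar>BB h2 p\<bar> \<le> ?E + \<bar>?G\<bar>" by linarith
          from mult_left_mono[OF this abs_ge_zero[of "h p"]] show ?thesis
            by (simp add: abs_mult algebra_simps)
        qed
        also have "\<dots> \<le> \<bar>h p\<bar> * ?E + (exp (2 * ?s) / 2 * mm p * (h p)\<^sup>2 + exp (- 2 * ?s) / 2 * Y p)"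
          using a2 by simp
        finally have "3 * zeta ?s * \<bar>h p * BB h2 p\<bar> \<le> 3 * zeta ?s *
            (\<bar>h p\<bar> * ?E + (exp (2 * ?s) / 2 * mm p * (h p)\<^sup>2 + exp (- 2 * ?s) / 2 * Y p))"
          using zeta(5)[of ?s] by (intro mult_left_mono) auto
        moreover have "3 * (zeta ?s * \<bar>h p\<bar>) * ?E \<le> 3 * (Cc * (\<bar>h p\<bar> + \<bar>ZZ h1 p\<bar>)) * ?E"
          using z by (intro mult_right_mono) auto
        ultimately show ?thesis unfolding r by (simp add: algebra_simps)
      qed
      have er: "Ce * er p = (Ca + Cb) * (\<bar>h p\<bar> + \<bar>ZZ h1 p\<bar>) * ?E + 3 * Cc * (\<bar>h p\<bar> + \<bar>ZZ h1 p\<bar>) * ?E"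
        using True by (simp add: er_def Ce_def algebra_simps)
      have b7: "K\<^sup>2 * ?T7 p = eta ?s * EE ?s / 4 * Y p + 3 / 2 * zeta ?s * exp (- 2 * ?s) * Y p"
        using D by (simp add: wpot_def algebra_simps)
      have b6: "?T6 p = ?T5 p + 3 / 2 * zeta ?s * exp (2 * ?s) * mm p * (h p)\<^sup>2"
        unfolding r wcut_def by (simp add: algebra_simps)
      show ?thesis using b3 b4 er b7 b6 by linarith
    qed
    have i2: "integrable lborel ?T2" and i6: "integrable lborel ?T6"
      by (intro integrable_mm_rad_weight w_continuous w_support continuous_intros hc; simp)+
    have i4: "integrable lborel ?T4"
      by (intro integrable_rad_weight continuous_intros hc) (auto simp: cutoff_support)
    have i5: "integrable lborel ?T5"
      by (intro integrable_mm_rad_weight continuous_intros hc) (auto simp: cutoff_support)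
    have w': "\<bar>F2 (p - v) - F2 p\<bar> \<le> \<omega>" if "p \<in> ?S'" "v \<in> set vs" for p v
      using w[OF that(1), of "- v"] h(3)[OF that(2)] by simp
    have A: "integrable lborel (\<lambda>p. F2 p * av vs y p)"
      "(LINT p|lborel. F2 p * av vs y p) \<le> (LINT p|lborel. F2 p * y p) + \<omega> * (LINT p|lborel. y p)"
      using integral_weight_av_le[OF F2m F2b yi y0 yo w' h(2)] by auto
    have C1: "(LINT p|lborel. ?T1 p) + (LINT p|lborel. ?T2 p)
        \<le> (LINT p|lborel. ?T3 p) + (LINT p|lborel. ?T4 p) + (LINT p|lborel. ?T5 p)"
      using C(1) unfolding wmain_def[abs_def] .
    have "(LINT p|lborel. ?T3 p + ?T4 p + ?T5 p) \<le> (LINT p|lborel. ?T1 p + Ce * er p + K\<^sup>2 * ?T7 p + ?T6 p)"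
      by (rule integral_mono[OF _ _ pw]) (use C(2,3) i4 i5 i6 eri A(1) in auto)
    then have "(LINT p|lborel. ?T3 p) + (LINT p|lborel. ?T4 p) + (LINT p|lborel. ?T5 p) \<le>
      (LINT p|lborel. ?T1 p) + Ce * (LINT p|lborel. er p) + K\<^sup>2 * (LINT p|lborel. ?T7 p) + (LINT p|lborel. ?T6 p)"
      using C(2,3) i4 i5 i6 eri A(1) by simp
    then have X: "(LINT p|lborel. ?T2 p) - (LINT p|lborel. ?T6 p) \<le> Ce * (LINT p|lborel. er p) + K\<^sup>2 * (LINT p|lborel. ?T7 p)"
      using C1 by linarith
    have "(LINT p|lborel. F p * (h p)\<^sup>2) = (LINT p|lborel. ?T2 p) - (LINT p|lborel. ?T6 p)"
      unfolding F_def left_diff_distrib by (rule Bochner_Integration.integral_diff[OF i2 i6])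
    moreover have "Ce * (LINT p|lborel. er p) \<le> Ce * \<delta>"
      using h(5) Ce unfolding er_def[symmetric] by (intro mult_left_mono) auto
    moreover have "K\<^sup>2 * (LINT p|lborel. ?T7 p) \<le> K\<^sup>2 * ((LINT p|lborel. F2 p * y p) + \<omega> * (LINT p|lborel. y p))"
      by (intro mult_left_mono A(2)) simp
    moreover have "(LINT p|lborel. F p * (u p)\<^sup>2) \<le> (LINT p|lborel. F p * (h p)\<^sup>2) + CF * (sqrt \<delta> * (1 / 2 + \<delta> + 4 * nsq ?S u))"
      by (rule integral_weight_square_le[OF shell_measurable borel_measurable_continuous_onI[OF Fc] CF(2) _ _ uS h(4) d(1)])
        (use CF(1) sqi_continuous[OF hc(1) shell_bounded shell_measurable] in auto)
    ultimately show ?thesis using X by (simp add: distrib_left mult.assoc)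
  qed
  have "(LINT p|lborel. F p * (u p)\<^sup>2) \<le> K\<^sup>2 * (LINT p|lborel. F2 p * y p)"
  proof (rule field_le_epsilon)
    fix \<epsilon> :: real assume e: "\<epsilon> > 0"
    define Iy where "Iy = (LINT p|lborel. y p)"
    have Iy: "Iy \<ge> 0" unfolding Iy_def by (intro integral_nonneg_AE) (simp add: y0)
    define \<omega> where "\<omega> = \<epsilon> / (2 * (K\<^sup>2 * Iy + 1))"
    have KI: "K\<^sup>2 * Iy \<ge> 0" using Iy by simp
    have w: "\<omega> > 0" "K\<^sup>2 * \<omega> * Iy \<le> \<epsilon> / 2"
    proof -
      show "\<omega> > 0" using e KI by (simp add: \<omega>_def add_nonneg_pos)
      have "K\<^sup>2 * \<omega> * Iy = (\<epsilon> / 2) * (K\<^sup>2 * Iy / (K\<^sup>2 * Iy + 1))" by (simp add: \<omega>_def)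
      also have "\<dots> \<le> (\<epsilon> / 2) * 1" using e KI by (intro mult_left_mono) auto
      finally show "K\<^sup>2 * \<omega> * Iy \<le> \<epsilon> / 2" by simp
    qed
    obtain r1 where r1: "r1 > 0" "\<And>p v. p \<in> ?S' \<Longrightarrow> norm v \<le> r1 \<Longrightarrow> \<bar>F2 (p + v) - F2 p\<bar> \<le> \<omega>"
      using uniform_shift[OF F2c shell_bounded w(1)] by metis
    \<comment> \<open>\<open>Ce\<close>, \<open>CF\<close> and \<open>\<omega>\<close> are fixed by
      now, so the length of the translates can be sent to 0.\<close>
    have "((\<lambda>\<delta>. Ce * \<delta> + CF * (sqrt \<delta> * (1 / 2 + \<delta> + 4 * nsq ?S u))) \<longlongrightarrow>
        Ce * 0 + CF * (sqrt 0 * (1 / 2 + 0 + 4 * nsq ?S u))) (at_right 0)"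
      by (intro tendsto_intros)
    then have "\<forall>\<^sub>F \<delta> in at_right 0. Ce * \<delta> + CF * (sqrt \<delta> * (1 / 2 + \<delta> + 4 * nsq ?S u)) < \<epsilon> / 2"
      using e by (intro order_tendstoD(2)) auto
    moreover have "\<forall>\<^sub>F \<delta> in at_right 0. 0 < \<delta> \<and> \<delta> < min r0 r1"
      using r0(1) r1(1) eventually_at_right_less[of "0::real"] eventually_at_right_field
      by (auto simp: eventually_at_right_field intro!: exI[of _ "min r0 r1"])
    ultimately have "\<forall>\<^sub>F \<delta> in at_right (0::real). Ce * \<delta> + CF * (sqrt \<delta> * (1 / 2 + \<delta> + 4 * nsq ?S u)) < \<epsilon> / 2 \<and>
        0 < \<delta> \<and> \<delta> < min r0 r1" by eventually_elim auto
    then obtain \<delta> where d: "Ce * \<delta> + CF * (sqrt \<delta> * (1 / 2 + \<delta> + 4 * nsq ?S u)) < \<epsilon> / 2"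
        "0 < \<delta>" "\<delta> < min r0 r1"
      using eventually_happens'[OF trivial_limit_at_right_real] by blast
    have "(LINT p|lborel. F p * (u p)\<^sup>2) \<le> K\<^sup>2 * (LINT p|lborel. F2 p * y p)
      + K\<^sup>2 * \<omega> * (LINT p|lborel. y p) + Ce * \<delta> + CF * (sqrt \<delta> * (1 / 2 + \<delta> + 4 * nsq ?S u))"
      by (rule main) (use d w r1 in auto)
    then show "(LINT p|lborel. F p * (u p)\<^sup>2) \<le> K\<^sup>2 * (LINT p|lborel. F2 p * y p) + \<epsilon>"
      using d(1) w(2) unfolding Iy_def by linarith
  qed
  then show ?thesis unfolding F2y F_def .
qed

end

section \<open>Cutoff functions\<close>

text \<open>At the two ends the increments of the clamped function are at most those of
  \<open>P\<close>, whose difference quotients tend to 0 there.\<close>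

lemma has_real_derivative_clamp:
  fixes P P' :: "real \<Rightarrow> real"
  assumes P: "\<And>s. (P has_real_derivative P' s) (at s)" and z: "P' 0 = 0" "P' 1 = 0"
  shows "((\<lambda>s. P (max 0 (min 1 s))) has_real_derivative P' (max 0 (min 1 s))) (at s)"
proof -
  have edge: "((\<lambda>s. P (max 0 (min 1 s))) has_real_derivative 0) (at c)" if c: "c = 0 \<or> c = 1" for c
  proof -
    have "P' c = 0" using c z by auto
    then have "((\<lambda>h. (P (c + h) - P c) / h) \<longlongrightarrow> 0) (at 0)"
      using P[of c] by (simp add: DERIV_def)
    then have l: "((\<lambda>h. \<bar>(P (c + h) - P c) / h\<bar>) \<longlongrightarrow> 0) (at 0)" by (rule tendsto_rabs_zero)
    have "((\<lambda>h. (P (max 0 (min 1 (c + h))) - P (max 0 (min 1 c))) / h) \<longlongrightarrow> 0) (at 0)"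
    proof (rule Lim_null_comparison[OF _ l])
      have "\<forall>\<^sub>F h in at (0::real). h \<in> {-1<..<1}"
        by (rule eventually_at_in_open') auto
      then show "\<forall>\<^sub>F h in at 0. norm ((P (max 0 (min 1 (c + h))) - P (max 0 (min 1 c))) / h) \<le> \<bar>(P (c + h) - P c) / h\<bar>"
      proof eventually_elim
        case (elim h)
        then have "max 0 (min 1 (c + h)) = c \<or> max 0 (min 1 (c + h)) = c + h" "max 0 (min 1 c) = c"
          using c by (auto simp: max_def min_def)
        then show ?case by (elim disjE) simp_all
      qed
    qed
    then show ?thesis by (simp add: DERIV_def)
  qed
  consider "s < 0" | "s = 0" | "0 < s" "s < 1" | "s = 1" | "s > 1" by linarith
  then show ?thesis
  proof cases
    case 1
    have "\<forall>\<^sub>F x in nhds s. x \<in> {..<0}" using 1 by (intro eventually_nhds_in_open) auto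
    then have "\<forall>\<^sub>F x in nhds s. P (max 0 (min 1 x)) = P 0" by eventually_elim auto
    then show ?thesis using DERIV_cong_ev[OF refl, of "\<lambda>s. P (max 0 (min 1 s))" "\<lambda>_. P 0" s 0 0] 1 z by simp
  next
    case 5
    have "\<forall>\<^sub>F x in nhds s. x \<in> {1<..}" using 5 by (intro eventually_nhds_in_open) auto
    then have "\<forall>\<^sub>F x in nhds s. P (max 0 (min 1 x)) = P 1" by eventually_elim auto
    then show ?thesis using DERIV_cong_ev[OF refl, of "\<lambda>s. P (max 0 (min 1 s))" "\<lambda>_. P 1" s 0 0] 5 z by simp
  next
    case 3
    have "\<forall>\<^sub>F x in nhds s. x \<in> {0<..<1}" using 3 by (intro eventually_nhds_in_open) auto
    then have "\<forall>\<^sub>F x in nhds s. P (max 0 (min 1 x)) = P x" by eventually_elim (auto simp: max_def min_def)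
    then show ?thesis
      using DERIV_cong_ev[OF refl, of "\<lambda>s. P (max 0 (min 1 s))" P s "P' s" "P' s"] P[of s] 3 by simp
  qed (use edge[of s] z in auto)
qed

definition clamp01 :: "real \<Rightarrow> real" where "clamp01 s = max 0 (min 1 s)"
text \<open>The quintic smoothstep 10 r^3 - 15 r^4 + 6 r^5: its first two derivatives vanish at both
  ends, so its extension by constants is twice continuously differentiable.\<close>

definition step :: "real \<Rightarrow> real" where "step s = (clamp01 s) ^ 3 * (10 - 15 * clamp01 s + 6 * (clamp01 s)\<^sup>2)"
definition step1 :: "real \<Rightarrow> real" where "step1 s = 30 * ((clamp01 s)\<^sup>2 * (1 - clamp01 s)\<^sup>2)"
definition step2 :: "real \<Rightarrow> real" where "step2 s = 60 * (clamp01 s * (1 - clamp01 s) * (1 - 2 * clamp01 s))"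

lemma clamp01: "0 \<le> clamp01 s" "clamp01 s \<le> 1" "s \<le> 0 \<Longrightarrow> clamp01 s = 0" "s \<ge> 1 \<Longrightarrow> clamp01 s = 1"
  by (auto simp: clamp01_def)

lemma clamp01_continuous [continuous_intros]: "continuous_on A f \<Longrightarrow> continuous_on A (\<lambda>x. clamp01 (f x))"
  unfolding clamp01_def by (intro continuous_intros)

lemma step_deriv: "(step has_real_derivative step1 s) (at s)" "(step1 has_real_derivative step2 s) (at s)"
proof -
  have "((\<lambda>r. r ^ 3 * (10 - 15 * r + 6 * r\<^sup>2)) has_real_derivative 30 * (s\<^sup>2 * (1 - s)\<^sup>2)) (at s)" for s :: real
    by (auto intro!: derivative_eq_intros simp: power2_eq_square power3_eq_cube algebra_simps)
  from has_real_derivative_clamp[OF this, of s] show "(step has_real_derivative step1 s) (at s)"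
    by (simp add: step_def[abs_def] step1_def clamp01_def)
  have "((\<lambda>r. 30 * (r\<^sup>2 * (1 - r)\<^sup>2)) has_real_derivative 60 * (s * (1 - s) * (1 - 2 * s))) (at s)" for s :: real
    by (auto intro!: derivative_eq_intros simp: power2_eq_square algebra_simps)
  from has_real_derivative_clamp[OF this, of s] show "(step1 has_real_derivative step2 s) (at s)"
    by (simp add: step1_def[abs_def] step2_def clamp01_def)
qed

lemma step_bounds: "0 \<le> step s" "step s \<le> 1" "\<bar>step1 s\<bar> \<le> 30" "\<bar>step2 s\<bar> \<le> 60"
proof -
  let ?r = "clamp01 s"
  have r: "0 \<le> ?r" "?r \<le> 1" by (rule clamp01)+
  have "10 - 15 * ?r + 6 * ?r\<^sup>2 = 6 * (?r - 5 / 4)\<^sup>2 + 5 / 8" by (simp add: power2_eq_square algebra_simps)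
  then show "0 \<le> step s" unfolding step_def using r by (intro mult_nonneg_nonneg) auto
  have "1 - step s = (1 - ?r) ^ 3 * (1 + 3 * ?r + 6 * ?r\<^sup>2)"
    by (simp add: step_def power2_eq_square power3_eq_cube algebra_simps)
  moreover have "\<dots> \<ge> 0" using r by (intro mult_nonneg_nonneg add_nonneg_nonneg zero_le_power) auto
  ultimately show "step s \<le> 1" by linarith
  have "?r\<^sup>2 \<le> 1" "(1 - ?r)\<^sup>2 \<le> 1" using r by (auto intro!: power_le_one)
  then have "?r\<^sup>2 * (1 - ?r)\<^sup>2 \<le> 1 * 1" by (intro mult_mono) auto
  then show "\<bar>step1 s\<bar> \<le> 30" by (simp add: step1_def)
  have "\<bar>?r\<bar> * \<bar>1 - ?r\<bar> * \<bar>1 - 2 * ?r\<bar> \<le> 1 * 1 * 1" using r by (intro mult_mono) auto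
  then show "\<bar>step2 s\<bar> \<le> 60" by (simp add: step2_def abs_mult)
qed

lemma step_values: "s \<le> 0 \<Longrightarrow> step s = 0" "s \<ge> 1 \<Longrightarrow> step s = 1" "s \<notin> {0<..<1} \<Longrightarrow> step1 s = 0" "s \<notin> {0<..<1} \<Longrightarrow> step2 s = 0"
proof -
  have c: "s \<le> 0 \<or> s \<ge> 1" if "s \<notin> {0<..<1}" using that by auto
  show "s \<le> 0 \<Longrightarrow> step s = 0" "s \<ge> 1 \<Longrightarrow> step s = 1" by (auto simp: step_def clamp01)
  show "s \<notin> {0<..<1} \<Longrightarrow> step1 s = 0" "s \<notin> {0<..<1} \<Longrightarrow> step2 s = 0"
    using c clamp01(3,4)[of s] by (auto simp: step1_def step2_def)
qed

lemma step_continuous: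
  assumes "continuous_on A f"
  shows "continuous_on A (\<lambda>x. step (f x))" "continuous_on A (\<lambda>x. step1 (f x))" "continuous_on A (\<lambda>x. step2 (f x))"
  unfolding step_def step1_def step2_def by (intro continuous_intros assms)+

text \<open>A plateau in the variable s = ln \<rho>, with ramps on [p, p + 1] and [q - 1, q]. Ramps
  of unit length in the logarithm keep the derivative bounds independent of the radii.\<close>

definition trap :: "real \<Rightarrow> real \<Rightarrow> real \<Rightarrow> real" where
  "trap p q s = step (s - p) * step (q - s)"
definition trap1 :: "real \<Rightarrow> real \<Rightarrow> real \<Rightarrow> real" where
  "trap1 p q s = step1 (s - p) * step (q - s) - step (s - p) * step1 (q - s)"
definition trap2 :: "real \<Rightarrow> real \<Rightarrow> real \<Rightarrow> real" where
  "trap2 p q s = step2 (s - p) * step (q - s) - 2 * (step1 (s - p) * step1 (q - s)) + step (s - p) * step2 (q - s)"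

lemma trap_deriv: "(trap p q has_real_derivative trap1 p q s) (at s)" "(trap1 p q has_real_derivative trap2 p q s) (at s)"
proof -
  have d: "((\<lambda>s. step (s - p)) has_real_derivative step1 (s - p)) (at s)"
    "((\<lambda>s. step1 (s - p)) has_real_derivative step2 (s - p)) (at s)"
    "((\<lambda>s. step (q - s)) has_real_derivative - step1 (q - s)) (at s)"
    "((\<lambda>s. step1 (q - s)) has_real_derivative - step2 (q - s)) (at s)"
  proof -
    have i: "((\<lambda>s. s - p) has_real_derivative 1) (at s)" "((\<lambda>s. q - s) has_real_derivative - 1) (at s)"
      by (auto intro!: derivative_eq_intros)
    show "((\<lambda>s. step (s - p)) has_real_derivative step1 (s - p)) (at s)"
      "((\<lambda>s. step1 (s - p)) has_real_derivative step2 (s - p)) (at s)"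
      using DERIV_chain2[OF step_deriv(1)[of "s - p"] i(1)] DERIV_chain2[OF step_deriv(2)[of "s - p"] i(1)] by simp_all
    show "((\<lambda>s. step (q - s)) has_real_derivative - step1 (q - s)) (at s)"
      "((\<lambda>s. step1 (q - s)) has_real_derivative - step2 (q - s)) (at s)"
      using DERIV_chain2[OF step_deriv(1)[of "q - s"] i(2)] DERIV_chain2[OF step_deriv(2)[of "q - s"] i(2)] by simp_all
  qed
  show "(trap p q has_real_derivative trap1 p q s) (at s)"
    unfolding trap_def[abs_def] trap1_def by (rule derivative_eq_intros d refl)+ (simp add: algebra_simps)
  show "(trap1 p q has_real_derivative trap2 p q s) (at s)"
    unfolding trap1_def[abs_def] trap2_def by (rule derivative_eq_intros d refl)+ (simp add: algebra_simps)
qed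

lemma trap_continuous: "continuous_on A (trap p q)" "continuous_on A (trap1 p q)" "continuous_on A (trap2 p q)"
  unfolding trap_def[abs_def] trap1_def[abs_def] trap2_def[abs_def]
  by (intro continuous_intros step_continuous)+

lemma trap_bounds: "0 \<le> trap p q s" "trap p q s \<le> 1" "\<bar>trap1 p q s\<bar> \<le> 60" "\<bar>trap2 p q s\<bar> \<le> 1920"
proof -
  note b = step_bounds[of "s - p"] step_bounds[of "q - s"]
  show "0 \<le> trap p q s" using b by (simp add: trap_def)
  show "trap p q s \<le> 1" unfolding trap_def using b by (intro mult_le_one) auto
  have m: "\<bar>step1 (s - p)\<bar> * \<bar>step (q - s)\<bar> \<le> 30 * 1" "\<bar>step (s - p)\<bar> * \<bar>step1 (q - s)\<bar> \<le> 1 * 30"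
    "\<bar>step2 (s - p)\<bar> * \<bar>step (q - s)\<bar> \<le> 60 * 1" "\<bar>step (s - p)\<bar> * \<bar>step2 (q - s)\<bar> \<le> 1 * 60"
    "\<bar>step1 (s - p)\<bar> * \<bar>step1 (q - s)\<bar> \<le> 30 * 30"
    using b by (intro mult_mono; simp)+
  \<comment> \<open>1920 is 60 + 2 * 30 * 30 + 60.\<close>
  show "\<bar>trap1 p q s\<bar> \<le> 60" "\<bar>trap2 p q s\<bar> \<le> 1920"
    using m unfolding trap1_def trap2_def by (simp_all add: abs_mult[symmetric])
qed

lemma trap_support: "s \<notin> {p..q} \<Longrightarrow> trap p q s = 0"
  by (cases "s < p") (auto simp: trap_def step_values)

lemma trap_one: "p + 1 \<le> s \<Longrightarrow> s \<le> q - 1 \<Longrightarrow> trap p q s = 1"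
  by (simp add: trap_def step_values)

lemma trap12_zero:
  assumes "s \<notin> {p<..<p + 1}" "s \<notin> {q - 1<..<q}"
  shows "trap1 p q s = 0" "trap2 p q s = 0"
proof -
  have "s - p \<notin> {0<..<1}" "q - s \<notin> {0<..<1}" using assms by auto
  then show "trap1 p q s = 0" "trap2 p q s = 0" by (simp_all add: trap1_def trap2_def step_values)
qed

lemma trap12_support:
  assumes "s \<notin> {p..q}"
  shows "trap1 p q s = 0" "trap2 p q s = 0"
proof -
  have "s - p \<le> 0 \<or> q - s \<le> 0" using assms by auto
  then show "trap1 p q s = 0" "trap2 p q s = 0"
    using step_values[of "s - p"] step_values[of "q - s"] by (auto simp: trap1_def trap2_def)
qed

section \<open>Representatives of solutions\<close>

context grushin begin

text \<open>Caccioppoli's inequality: the energy identity with a plateau as weight, minus half of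
  the square identity, which removes the products of h and Zh. Only the derivatives in z come out,
  as their coefficient in \<open>Gam\<close> is 1.\<close>

lemma gradient_bound:
  obtains c where "c \<ge> 0" "\<And>h h1 h2 i. C2 h h1 h2 \<Longrightarrow>
    nsq (shell a b) (h1 (Inl i)) \<le> c * (nsq (shell (a - 1) (b + 1)) h + nsq (shell (a - 1) (b + 1)) (BB h2))"
proof -
  let ?S = "shell a b" and ?S' = "shell (a - 1) (b + 1)" and ?t = "trap (a - 1) (b + 1)"
    and ?t1 = "trap1 (a - 1) (b + 1)" and ?t2 = "trap2 (a - 1) (b + 1)"
  note tc = trap_continuous[of UNIV "a - 1" "b + 1"]
  have wc: "continuous_on UNIV (\<lambda>p. mm p * rad (\<lambda>s. ?t2 s + 2 * qq * ?t1 s) p)"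
    by (rule rad_mm_continuous[of _ "a - 1" "b + 1"]) (auto intro!: continuous_intros trap_continuous simp: trap12_support)
  obtain C where C: "C > 0" "\<And>p. p \<in> ?S' \<Longrightarrow> \<bar>mm p * rad (\<lambda>s. ?t2 s + 2 * qq * ?t1 s) p\<bar> \<le> C"
    using continuous_compact_bounded[OF wc shell_bounded] by blast
  have "nsq ?S (h1 (Inl i)) \<le> (1 + C) * (nsq ?S' h + nsq ?S' (BB h2))" if h: "C2 h h1 h2" for h h1 h2 i
  proof -
    have t0: "?t s = 0" "?t1 s = 0" if "s \<notin> {a - 1..b + 1}" for s using trap_support[OF that] trap12_support[OF that] by auto
    have Z1: "zint (\<lambda>p. rad ?t p * (h p * BB h2 p + Gam h1 p) + mm p * (rad ?t1 p * (h p * ZZ h1 p)))"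
      by (rule zint_radial_energy[OF h trap_deriv(1) tc(2)]) (rule t0)
    have Z2: "zint (\<lambda>p. mm p * (rad ?t1 p * (2 * h p * ZZ h1 p) + (h p)\<^sup>2 * (rad ?t2 p + 2 * qq * rad ?t1 p)))"
      by (rule zint_radial_square[OF h trap_deriv(2) tc(3)]) (rule t0)
    let ?A = "\<lambda>p. rad ?t p * (h p * BB h2 p + Gam h1 p) + mm p * (rad ?t1 p * (h p * ZZ h1 p))
        - 1 / 2 * (mm p * (rad ?t1 p * (2 * h p * ZZ h1 p) + (h p)\<^sup>2 * (rad ?t2 p + 2 * qq * rad ?t1 p)))"
    have Z: "zint ?A" by (intro zint_diff zint_cmult Z1 Z2)
    have hs: "sqi ?S' h" "sqi ?S' (BB h2)" "sqi ?S (h1 (Inl i))"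
      by (intro sqi_continuous C2D[OF h] BB_continuous[OF h] shell_bounded shell_measurable)+
    let ?F = "\<lambda>p. ?A p + ((1 / 2 + C / 2) * (indicator ?S' p * (h p)\<^sup>2) + 1 / 2 * (indicator ?S' p * (BB h2 p)\<^sup>2))"
    have Fi: "integrable lborel ?F" using Z sqiD(2)[OF hs(1)] sqiD(2)[OF hs(2)] by (auto simp: zint_def)
    have le: "rad ?t p * Gam h1 p \<le> ?F p" for p
    proof (cases "p \<in> ?S'")
      case False
      have "rad ?t p = 0" "rad ?t1 p = 0" "rad ?t2 p = 0"
        using False rad_support[of "a - 1" "b + 1" _ p] trap_support trap12_support by auto
      then show ?thesis using False by simp
    next
      case True
      then have p: "p \<noteq> 0" by (simp add: shell_def)
      have r: "rad X p = X (lg p)" for X using p by (simp add: rad_def)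
      let ?t' = "?t (lg p)" and ?B = "BB h2 p"
      have t: "0 \<le> ?t'" "?t' \<le> 1" using trap_bounds by auto
      have "2 * (- (h p * ?B)) \<le> (h p)\<^sup>2 + ?B\<^sup>2" using zero_le_power2[of "h p + ?B"] by (simp add: power2_sum)
      then have "?t' * (2 * (- (h p * ?B))) \<le> ?t' * ((h p)\<^sup>2 + ?B\<^sup>2)" using t by (intro mult_left_mono) auto
      also have "\<dots> \<le> 1 * ((h p)\<^sup>2 + ?B\<^sup>2)" using t by (intro mult_right_mono) auto
      finally have 1: "- (?t' * (h p * ?B)) \<le> (h p)\<^sup>2 / 2 + ?B\<^sup>2 / 2" by (simp add: mult_ac)
      have "(mm p * rad (\<lambda>s. ?t2 s + 2 * qq * ?t1 s) p) * (h p)\<^sup>2 \<le> C * (h p)\<^sup>2"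
        using C(2)[OF True] by (intro mult_right_mono) auto
      then have 2: "mm p * ((h p)\<^sup>2 * (?t2 (lg p) + 2 * qq * ?t1 (lg p))) \<le> C * (h p)\<^sup>2"
        unfolding r by (simp add: mult_ac)
      have "?A p = ?t' * (h p * ?B) + ?t' * Gam h1 p - mm p * ((h p)\<^sup>2 * (?t2 (lg p) + 2 * qq * ?t1 (lg p))) / 2"
        unfolding r by (simp add: algebra_simps)
      then show ?thesis using 1 2 True unfolding r by (simp add: algebra_simps)
    qed
    have "nsq ?S (h1 (Inl i)) \<le> integral\<^sup>L lborel ?F"
    proof (rule nsq_dominated(2)[OF shell_measurable Fi _ _ sqiD(1)[OF hs(3)]])
      fix p assume p: "p \<in> ?S"
      then have "rad ?t p = 1" using trap_one[of "a - 1" "lg p" "b + 1"] by (simp add: shell_def rad_def)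
      moreover have "(h1 (Inl i) p)\<^sup>2 \<le> Gam h1 p"
        unfolding Gam_def using member_le_sum[of "Inl i" UNIV "\<lambda>c. wgt c p * (h1 c p)\<^sup>2"]
        by (auto simp: wgt_def split: sum.splits)
      ultimately show "(h1 (Inl i) p)\<^sup>2 \<le> ?F p" using le[of p] by simp
    next
      fix p
      have "0 \<le> rad ?t p * Gam h1 p" by (intro mult_nonneg_nonneg) (auto simp: rad_def trap_bounds)
      then show "0 \<le> ?F p" using le[of p] by linarith
    qed
    also have "integral\<^sup>L lborel ?F = (1 / 2 + C / 2) * nsq ?S' h + 1 / 2 * nsq ?S' (BB h2)"
      using Z sqiD(2)[OF hs(1)] sqiD(2)[OF hs(2)] unfolding zint_def nsq_def by simp
    also have "\<dots> \<le> (1 + C) * nsq ?S' h + (1 + C) * nsq ?S' (BB h2)"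
      using C(1) by (intro add_mono mult_right_mono) auto
    finally show ?thesis by (simp add: distrib_left)
  qed
  then show ?thesis using that[of "1 + C"] C(1) by auto
qed

section \<open>Smooth functions and their derivatives along the vector fields\<close>

lemma bas_Basis: "bas c \<in> Basis"
  by (cases c) (auto simp: bas_def Basis_prod_def axis_in_Basis_iff Basis_vec_def)

lemma smooth_C2:
  fixes f :: "('m, 'k) pt \<Rightarrow> real"
  assumes "smooth f"
  obtains f1 f2 where "C2 f f1 f2"
proof -
  have dd: "has_dd e f (\<lambda>p. frechet_derivative f (at p) e)" if "\<forall>x. f differentiable (at x)"
    for f :: "('m, 'k) pt \<Rightarrow> real" and e
    unfolding has_dd_def
  proof
    fix p
    have d: "(f has_derivative frechet_derivative f (at p)) (at (p + 0 *\<^sub>R e))"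
      using that[rule_format, of p] frechet_derivative_works[of f "at p"] by simp
    have "((\<lambda>r. p + r *\<^sub>R e) has_derivative (\<lambda>r. r *\<^sub>R e)) (at 0)"
      by (auto intro!: derivative_eq_intros)
    from has_derivative_compose[OF this d]
    have "((\<lambda>r. f (p + r *\<^sub>R e)) has_derivative (\<lambda>r. frechet_derivative f (at p) (r *\<^sub>R e))) (at 0)" .
    moreover have "frechet_derivative f (at p) (r *\<^sub>R e) = frechet_derivative f (at p) e * r" for r
    proof -
      have "linear (frechet_derivative f (at p))"
        by (rule linear_frechet_derivative) (use that in blast)
      then show ?thesis by (simp add: linear_scale)
    qed
    ultimately show "((\<lambda>r. f (p + r *\<^sub>R e)) has_real_derivative frechet_derivative f (at p) e) (at 0)"
      by (simp add: has_field_derivative_def)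
  qed
  have diff_cont: "continuous_on UNIV f" if "\<forall>x. f differentiable (at x)" for f :: "('m, 'k) pt \<Rightarrow> real"
    using that by (simp add: continuous_at_imp_continuous_on differentiable_imp_continuous_within)
  define f1 where "f1 c p = frechet_derivative f (at p) (bas c)" for c p
  define f2 where "f2 c d p = frechet_derivative (f1 c) (at p) (bas d)" for c d p
  have "Ck 2 f" using assms by (simp add: smooth_def)
  then have f: "\<forall>x. f differentiable (at x)" and "\<forall>b\<in>Basis. Ck 1 (\<lambda>x. frechet_derivative f (at x) b)"
    by (auto simp: numeral_2_eq_2)
  then have "Ck 1 (f1 c)" for c using bas_Basis[of c] by (simp add: f1_def[abs_def])
  then have f1: "\<forall>x. f1 c differentiable (at x)" and "\<forall>b\<in>Basis. Ck 0 (\<lambda>x. frechet_derivative (f1 c) (at x) b)" for c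
    by (auto simp del: Ck.simps(1))
  then have f2: "continuous_on UNIV (f2 c d)" for c d using bas_Basis[of d] by (simp add: f2_def[abs_def])
  have "C2 f f1 f2" unfolding C2_def
  proof (intro conjI allI)
    show "has_dd (bas c) f (f1 c)" for c unfolding f1_def[abs_def] by (rule dd[OF f])
    show "has_dd (bas d) (f1 c) (f2 c d)" for c d unfolding f2_def[abs_def] by (rule dd[OF f1])
  qed (use f f1 f2 diff_cont in auto)
  then show ?thesis using that by blast
qed

text \<open>The operator contains only repeated derivatives X_i X_i, in which the coefficient
  |z|^\<gamma> is differentiated along t alone; the formulas therefore hold on z = 0 as
  well.\<close>

lemma C2_X:
  assumes "C2 f f1 f2"
  shows "X \<gamma> (Inl i) f = f1 (Inl i)" "X \<gamma> (Inr j) f = (\<lambda>p. norm (fst p) powr \<gamma> * f1 (Inr j) p)"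
    "Grushin \<gamma> f = BB f2"
proof -
  have Xl: "X \<gamma> (Inl i) h = h'" if "has_dd (bas (Inl i)) h h'" for h h' i
  proof
    fix p :: "('m, 'k) pt"
    show "X \<gamma> (Inl i) h p = h' p"
      using has_ddD[OF that, of p] by (cases p) (auto simp: bas_def intro!: DERIV_imp_deriv)
  qed
  have Xr: "X \<gamma> (Inr j) h = (\<lambda>p. norm (fst p) powr \<gamma> * h' p)" if "has_dd (bas (Inr j)) h h'" for h h' j
  proof
    fix p :: "('m, 'k) pt"
    show "X \<gamma> (Inr j) h p = norm (fst p) powr \<gamma> * h' p"
      using DERIV_imp_deriv[OF has_ddD[OF that, of p]] by (cases p) (auto simp: bas_def)
  qed
  note d = C2D(4,5)[OF assms]
  show l: "X \<gamma> (Inl i) f = f1 (Inl i)" for i by (rule Xl[OF d(1)])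
  show r: "X \<gamma> (Inr j) f = (\<lambda>p. norm (fst p) powr \<gamma> * f1 (Inr j) p)" for j by (rule Xr[OF d(1)])
  have rr: "X \<gamma> (Inr j) (X \<gamma> (Inr j) f) p = WW p * f2 (Inr j) (Inr j) p" for j p
  proof -
    have n: "has_dd (bas (Inr j)) (\<lambda>p::('m, 'k) pt. norm (fst p) powr \<gamma>) (\<lambda>p. 0)"
      unfolding has_dd_def by (intro allI) simp
    have "X \<gamma> (Inr j) (\<lambda>p. norm (fst p) powr \<gamma> * f1 (Inr j) p)
        = (\<lambda>p. norm (fst p) powr \<gamma> * (0 * f1 (Inr j) p + norm (fst p) powr \<gamma> * f2 (Inr j) (Inr j) p))"
      by (rule Xr[OF has_dd_mult[OF n d(2)]])
    then have "X \<gamma> (Inr j) (X \<gamma> (Inr j) f) p = norm (fst p) powr \<gamma> * (norm (fst p) powr \<gamma> * f2 (Inr j) (Inr j) p)"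
      unfolding r by simp
    also have "\<dots> = (norm (fst p) powr \<gamma> * norm (fst p) powr \<gamma>) * f2 (Inr j) (Inr j) p" by simp
    also have "norm (fst p) powr \<gamma> * norm (fst p) powr \<gamma> = WW p"
      unfolding WW_def powr_add[symmetric] by simp
    finally show ?thesis .
  qed
  show "Grushin \<gamma> f = BB f2"
  proof
    fix p
    have "Grushin \<gamma> f p = (\<Sum>i\<in>UNIV. X \<gamma> (Inl i) (X \<gamma> (Inl i) f) p) + (\<Sum>j\<in>UNIV. X \<gamma> (Inr j) (X \<gamma> (Inr j) f) p)"
      unfolding Grushin_def by (rule sum_Plus)
    also have "\<dots> = BB f2 p"
      unfolding BB_def sum_Plus rr by (simp add: wgt_def l Xl[OF d(2)] del: X.simps)
    finally show "Grushin \<gamma> f p = BB f2 p" .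
  qed
qed

end

section \<open>From Lebesgue classes to Borel functions defined everywhere\<close>

lemma lebesgue_on_borel_representative:
  fixes f :: "'a::euclidean_space \<Rightarrow> real"
  assumes "f \<in> borel_measurable (lebesgue_on \<Omega>)" "\<Omega> \<in> sets borel"
  obtains f' where "f' \<in> borel_measurable borel" "AE p in lebesgue. p \<in> \<Omega> \<longrightarrow> f' p = f p"
proof -
  have S: "\<Omega> \<inter> space lebesgue \<in> sets lebesgue" using assms(2) by auto
  have "(\<lambda>p. indicator \<Omega> p *\<^sub>R f p) \<in> borel_measurable (completion lborel)"
    using borel_measurable_restrict_space_iff[OF S, of f] assms(1) by simp
  then obtain f' where f': "f' \<in> borel_measurable lborel" "AE p in lborel. indicator \<Omega> p *\<^sub>R f p = f' p"
    using completion_ex_borel_measurable_real by blast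
  have "AE p in lebesgue. p \<in> \<Omega> \<longrightarrow> f' p = f p"
    using AE_completion[OF f'(2)] by eventually_elim auto
  then show ?thesis using that f'(1) by auto
qed

lemma lebesgue_on_integral_representative:
  fixes f f' :: "'a::euclidean_space \<Rightarrow> real"
  assumes \<Omega>: "\<Omega> \<in> sets borel" and f: "f \<in> borel_measurable (lebesgue_on \<Omega>)"
    and f': "f' \<in> borel_measurable borel" "AE p in lebesgue. p \<in> \<Omega> \<longrightarrow> f' p = f p"
  shows "(LINT p|lebesgue_on \<Omega>. f p) = (LINT p|lborel. indicator \<Omega> p * f' p)"
    "integrable (lebesgue_on \<Omega>) f \<longleftrightarrow> integrable lborel (\<lambda>p. indicator \<Omega> p * f' p)"
proof -
  have S: "\<Omega> \<inter> space lebesgue \<in> sets lebesgue" using \<Omega> by auto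
  have m: "(\<lambda>p. indicator \<Omega> p * f p) \<in> borel_measurable lebesgue"
    using borel_measurable_restrict_space_iff[OF S, of f] f by simp
  have m': "(\<lambda>p. indicator \<Omega> p * f' p) \<in> borel_measurable lborel" using f' \<Omega> by simp
  have mc: "(\<lambda>p. indicator \<Omega> p * f' p) \<in> borel_measurable lebesgue" by (rule measurable_completion[OF m'])
  have ae: "AE p in lebesgue. indicator \<Omega> p * f p = indicator \<Omega> p * f' p"
    using f'(2) by eventually_elim (auto simp: indicator_def)
  have "(LINT p|lebesgue_on \<Omega>. f p) = (LINT p|lebesgue. indicator \<Omega> p * f p)"
    using integral_restrict_space[OF S, of f] by simp
  also have "\<dots> = (LINT p|lebesgue. indicator \<Omega> p * f' p)" by (rule integral_cong_AE[OF m mc ae])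
  also have "\<dots> = (LINT p|lborel. indicator \<Omega> p * f' p)" by (rule integral_completion[OF m'])
  finally show "(LINT p|lebesgue_on \<Omega>. f p) = (LINT p|lborel. indicator \<Omega> p * f' p)" .
  have "integrable (lebesgue_on \<Omega>) f \<longleftrightarrow> integrable lebesgue (\<lambda>p. indicator \<Omega> p * f p)"
    using integrable_restrict_space[OF S, of f] by simp
  also have "\<dots> \<longleftrightarrow> integrable lebesgue (\<lambda>p. indicator \<Omega> p * f' p)" by (rule integrable_cong_AE[OF m mc ae])
  also have "\<dots> \<longleftrightarrow> integrable lborel (\<lambda>p. indicator \<Omega> p * f' p)" by (rule integrable_completion[OF m'])
  finally show "integrable (lebesgue_on \<Omega>) f \<longleftrightarrow> integrable lborel (\<lambda>p. indicator \<Omega> p * f' p)" .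
qed

context grushin begin

lemma gauge_DD: "pseudo_gauge \<gamma> p = DD p powr (1 / (2 * kap))" for p :: "('m, 'k) pt"
  by (cases p) (simp add: DD_def kap_def)

lemma gauge_exp_lg: "p \<noteq> 0 \<Longrightarrow> pseudo_gauge \<gamma> p = exp (lg p)" for p :: "('m, 'k) pt"
  using DD_pos[of p] by (simp add: gauge_DD powr_def lg_def)

lemma gauge_0: "pseudo_gauge \<gamma> (0 :: ('m, 'k) pt) = 0"
  by (simp add: gauge_DD)

lemma mem_gauge_ball: "p \<in> gauge_ball \<gamma> r \<longleftrightarrow> 0 < r \<and> (p = 0 \<or> lg p < ln r)" for p :: "('m, 'k) pt"
proof (cases "p = 0")
  case True
  then show ?thesis by (simp add: gauge_ball_def gauge_0)
next
  case False
  have "exp (lg p) < r \<longleftrightarrow> 0 < r \<and> lg p < ln r"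
    by (metis exp_gt_zero exp_less_cancel_iff exp_ln order_less_trans)
  then show ?thesis using False by (simp add: gauge_ball_def gauge_exp_lg)
qed

lemma gauge_ball_DD: "0 < r \<Longrightarrow> (gauge_ball \<gamma> r :: ('m, 'k) pt set) = {p. DD p < exp (2 * kap * ln r)}"
proof -
  assume r: "0 < r"
  have "p \<in> gauge_ball \<gamma> r \<longleftrightarrow> DD p < exp (2 * kap * ln r)" for p :: "('m, 'k) pt"
  proof (cases "p = 0")
    case False
    have "lg p < ln r \<longleftrightarrow> exp (2 * kap * lg p) < exp (2 * kap * ln r)" using kap by simp
    then show ?thesis using False r by (simp add: mem_gauge_ball exp_lg)
  qed (use r in \<open>simp add: mem_gauge_ball\<close>)
  then show ?thesis by blast
qed

lemma gauge_ball_measurable: "0 < r \<Longrightarrow> (gauge_ball \<gamma> r :: ('m, 'k) pt set) \<in> sets borel"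
  unfolding gauge_ball_DD by (intro borel_open open_Collect_less continuous_intros)

lemma gauge_ball_bounded: "0 < r \<Longrightarrow> bounded (gauge_ball \<gamma> r :: ('m, 'k) pt set)"
  unfolding gauge_ball_DD by (rule bounded_subset[OF DD_le_bounded[of "exp (2 * kap * ln r)"]]) auto

lemma angle_eq: "p \<noteq> 0 \<Longrightarrow> angle \<gamma> p = WW p * exp (- 2 * \<gamma> * lg p)" for p :: "('m, 'k) pt"
proof -
  assume p: "p \<noteq> 0"
  have "angle \<gamma> p = WW p / pseudo_gauge \<gamma> p powr (2 * \<gamma>)" by (cases p) (simp add: WW_def)
  also have "pseudo_gauge \<gamma> p powr (2 * \<gamma>) = exp (2 * \<gamma> * lg p)"
    unfolding gauge_exp_lg[OF p] by (simp add: powr_def)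
  finally show ?thesis by (simp add: exp_minus divide_inverse)
qed

lemma AE_nonzero: "AE p in lebesgue. p \<noteq> (0 :: ('m, 'k) pt)"
  by (intro AE_completion AE_lborel_singleton)

text \<open>The functions are altered so that the bounds hold at every point (off the origin for
  \<open>g\<close>); bounds that hold almost everywhere would be awkward under the translations of
  \<open>av\<close>. The equation survives only as the bound on \<open>g\<close>.\<close>

lemma solution_representatives:
  fixes u V :: "('m, 'k) pt \<Rightarrow> real" and R K K0 :: real
  defines "\<Omega> \<equiv> gauge_ball \<gamma> R :: ('m, 'k) pt set"
  assumes R: "R > 0" and K0: "K0 \<ge> 0"
    and sol: "is_solution \<gamma> \<Omega> V u"
    and V: "AE p in lebesgue_on \<Omega>. \<bar>V p\<bar> \<le> K * angle \<gamma> p"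
    and u: "AE p in lebesgue_on \<Omega>. \<bar>u p\<bar> \<le> K0"
  obtains f f1 f2 v g where "\<And>n::nat. C2 (f n) (f1 n) (f2 n)"
    "v \<in> borel_measurable borel" "AE p in lebesgue. p \<in> \<Omega> \<longrightarrow> v p = u p" "\<And>p. \<bar>v p\<bar> \<le> K0"
    "sqi \<Omega> v" "sqi \<Omega> g" "(\<lambda>n. nsq \<Omega> (\<lambda>p. f n p - v p)) \<longlonglongrightarrow> 0"
    "(\<lambda>n. nsq \<Omega> (\<lambda>p. BB (f2 n) p - g p)) \<longlonglongrightarrow> 0"
    "\<And>p. p \<noteq> 0 \<Longrightarrow> K \<ge> 0 \<Longrightarrow> \<bar>g p\<bar> \<le> K * (WW p * exp (- 2 * \<gamma> * lg p)) * \<bar>v p\<bar>"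
    "u \<in> borel_measurable (lebesgue_on \<Omega>)"
proof -
  have \<Omega>: "\<Omega> \<in> sets borel" "bounded \<Omega>" unfolding \<Omega>_def using gauge_ball_measurable gauge_ball_bounded R by auto
  have S: "\<Omega> \<inter> space lebesgue \<in> sets lebesgue" using \<Omega> by auto
  have ae: "AE p in lebesgue. p \<in> \<Omega> \<longrightarrow> P p" if "AE p in lebesgue_on \<Omega>. P p" for P
    using that AE_restrict_space_iff[OF S] by simp
  obtain g0 f where g0: "AE p in lebesgue_on \<Omega>. - g0 p = V p * u p"
    and f: "S22_approx \<gamma> \<Omega> f u" "L2_tendsto \<Omega> (\<lambda>n. Grushin \<gamma> (f n)) g0"
    using sol unfolding is_solution_def has_Grushin_def by blast
  have fs: "smooth (f n)" for n using f(1) by (auto simp: S22_approx_def S22_smooth_def)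
  have fu: "L2_tendsto \<Omega> f u" using f(1) by (simp add: S22_approx_def)
  have "\<forall>n. \<exists>f1 f2. C2 (f n) f1 f2" using smooth_C2[OF fs] by metis
  then obtain f1 f2 where C: "\<And>n. C2 (f n) (f1 n) (f2 n)" by metis
  have G: "Grushin \<gamma> (f n) = BB (f2 n)" for n using C2_X(3)[OF C] .
  have um: "u \<in> borel_measurable (lebesgue_on \<Omega>)" and gm: "g0 \<in> borel_measurable (lebesgue_on \<Omega>)"
    using fu f(2) by (auto simp: L2_tendsto_def square_integrable_def)
  obtain v0 where v0: "v0 \<in> borel_measurable borel" "AE p in lebesgue. p \<in> \<Omega> \<longrightarrow> v0 p = u p"
    by (rule lebesgue_on_borel_representative[OF um \<Omega>(1)])
  obtain g1 where g1: "g1 \<in> borel_measurable borel" "AE p in lebesgue. p \<in> \<Omega> \<longrightarrow> g1 p = g0 p"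
    by (rule lebesgue_on_borel_representative[OF gm \<Omega>(1)])
  \<comment> \<open>Inside \<open>\<Omega>\<close> the truncation changes values on a null set only;
    outside, it makes the bound true.\<close>
  define v where "v p = (if \<bar>v0 p\<bar> \<le> K0 then v0 p else 0)" for p
  define b where "b p = K * (WW p * exp (- 2 * \<gamma> * lg p)) * \<bar>v p\<bar>" for p
  \<comment> \<open>Truncation at the bound that the equation yields almost everywhere in
    \<open>\<Omega>\<close>.\<close>
  define g where "g p = (if \<bar>g1 p\<bar> \<le> b p then g1 p else 0)" for p
  have [measurable]: "v0 \<in> borel_measurable borel" "g1 \<in> borel_measurable borel" by fact+
  have vm [measurable]: "v \<in> borel_measurable borel" unfolding v_def[abs_def] by measurable
  have bm [measurable]: "b \<in> borel_measurable borel" unfolding b_def[abs_def] by measurable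
  have gm' [measurable]: "g \<in> borel_measurable borel" unfolding g_def[abs_def] by measurable
  have v: "AE p in lebesgue. p \<in> \<Omega> \<longrightarrow> v p = u p"
    using v0(2) ae[OF u] by eventually_elim (auto simp: v_def)
  have g: "AE p in lebesgue. p \<in> \<Omega> \<longrightarrow> g p = g0 p"
    using v g1(2) ae[OF V] ae[OF g0] AE_nonzero
  proof eventually_elim
    case (elim p)
    show ?case
    proof
      assume p: "p \<in> \<Omega>"
      have "\<bar>g1 p\<bar> = \<bar>V p\<bar> * \<bar>u p\<bar>" using elim p by (metis abs_minus_cancel abs_mult)
      also have "\<dots> \<le> K * angle \<gamma> p * \<bar>u p\<bar>" using elim p by (intro mult_right_mono) auto
      also have "\<dots> = b p" using elim p by (simp add: b_def angle_eq del: angle.simps)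
      finally show "g p = g0 p" using elim p by (simp add: g_def)
    qed
  qed
  have transfer: "nsq \<Omega> (\<lambda>p. \<phi> p - w' p) = (LINT p|lebesgue_on \<Omega>. (\<phi> p - w p)\<^sup>2)"
    if "w \<in> borel_measurable (lebesgue_on \<Omega>)" "w' \<in> borel_measurable borel" "AE p in lebesgue. p \<in> \<Omega> \<longrightarrow> w' p = w p"
      "\<phi> \<in> borel_measurable borel" for \<phi> w w'
  proof -
    have m: "\<phi> \<in> borel_measurable (lebesgue_on \<Omega>)"
      using that(4) by (intro measurable_restrict_space1 measurable_completion) simp
    show ?thesis unfolding nsq_def
    proof (rule lebesgue_on_integral_representative(1)[OF \<Omega>(1), symmetric])
      show "(\<lambda>p. (\<phi> p - w p)\<^sup>2) \<in> borel_measurable (lebesgue_on \<Omega>)" using m that(1) by measurable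
      show "(\<lambda>p. (\<phi> p - w' p)\<^sup>2) \<in> borel_measurable borel" using that(2,4) by measurable
      show "AE p in lebesgue. p \<in> \<Omega> \<longrightarrow> (\<phi> p - w' p)\<^sup>2 = (\<phi> p - w p)\<^sup>2"
        using that(3) by eventually_elim auto
    qed
  qed
  have sq: "sqi \<Omega> w'" if "square_integrable \<Omega> w" "w' \<in> borel_measurable borel" "AE p in lebesgue. p \<in> \<Omega> \<longrightarrow> w' p = w p" for w w'
  proof -
    have w: "w \<in> borel_measurable (lebesgue_on \<Omega>)" "integrable (lebesgue_on \<Omega>) (\<lambda>p. (w p)\<^sup>2)"
      using that(1) by (auto simp: square_integrable_def)
    have "integrable lborel (\<lambda>p. indicator \<Omega> p * (w' p)\<^sup>2)"
    proof (rule lebesgue_on_integral_representative(2)[OF \<Omega>(1), THEN iffD1, OF _ _ _ w(2)])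
      show "(\<lambda>p. (w p)\<^sup>2) \<in> borel_measurable (lebesgue_on \<Omega>)" using w(1) by measurable
      show "(\<lambda>p. (w' p)\<^sup>2) \<in> borel_measurable borel" using that(2) by measurable
      show "AE p in lebesgue. p \<in> \<Omega> \<longrightarrow> (w' p)\<^sup>2 = (w p)\<^sup>2" using that(3) by eventually_elim auto
    qed
    then show ?thesis using that(2) by (simp add: sqi_def)
  qed
  have fm: "f n \<in> borel_measurable borel" "BB (f2 n) \<in> borel_measurable borel" for n
    using C2D(1)[OF C] BB_continuous[OF C] borel_measurable_continuous_onI by blast+
  have 1: "sqi \<Omega> v" "sqi \<Omega> g"
    using sq[OF _ vm v] sq[OF _ gm' g] fu f(2) by (auto simp: L2_tendsto_def)
  have 2: "(\<lambda>n. nsq \<Omega> (\<lambda>p. f n p - v p)) \<longlonglongrightarrow> 0"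
    unfolding transfer[OF um vm v fm(1)] using fu by (simp add: L2_tendsto_def)
  have 3: "(\<lambda>n. nsq \<Omega> (\<lambda>p. BB (f2 n) p - g p)) \<longlonglongrightarrow> 0"
    unfolding transfer[OF gm gm' g fm(2)] using f(2) by (simp add: L2_tendsto_def G)
  have 4: "\<bar>g p\<bar> \<le> K * (WW p * exp (- 2 * \<gamma> * lg p)) * \<bar>v p\<bar>" if "K \<ge> 0" for p
    using that by (simp add: g_def b_def)
  show ?thesis by (rule that[of f f1 f2 v g]) (use C vm v 1 2 3 4 um K0 in \<open>auto simp: v_def\<close>)
qed

end

section \<open>The quantitative estimate\<close>

context carleman_weights begin

text \<open>One unit of s is spent on the room for translates and one on the gradient bound, whence
  the assumption that b + 2 lies below ln R.\<close>

lemma carleman_for_solution: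
  fixes f :: "nat \<Rightarrow> ('m, 'k) pt \<Rightarrow> real" and R K :: real
  defines "\<Omega> \<equiv> gauge_ball \<gamma> R :: ('m, 'k) pt set"
  assumes R: "R > 0" "b + 2 < ln R" and K: "K \<ge> 0"
    and f: "\<And>n. C2 (f n) (f1 n) (f2 n)"
    and v: "sqi \<Omega> v" and g: "sqi \<Omega> g"
    and fv: "(\<lambda>n. nsq \<Omega> (\<lambda>p. f n p - v p)) \<longlonglongrightarrow> 0"
    and fg: "(\<lambda>n. nsq \<Omega> (\<lambda>p. BB (f2 n) p - g p)) \<longlonglongrightarrow> 0"
    and V: "\<And>p. p \<noteq> 0 \<Longrightarrow> \<bar>g p\<bar> \<le> K * (WW p * exp (- 2 * \<gamma> * lg p)) * \<bar>v p\<bar>"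
  shows "(LINT p|lborel. (mm p * rad wmain p - mm p * rad wcut p) * (v p)\<^sup>2)
    \<le> K\<^sup>2 * (LINT p|lborel. mm p * rad (\<lambda>s. wpot s * exp (4 * s)) p * (v p)\<^sup>2)"
proof -
  let ?S' = "shell (a - 1) (b + 1)" and ?S'' = "shell (a - 1 - 1) (b + 1 + 1)"
  have \<Omega>: "\<Omega> \<in> sets borel" "bounded \<Omega>" unfolding \<Omega>_def using gauge_ball_measurable gauge_ball_bounded R by auto
  have sub: "?S' \<subseteq> \<Omega>" "?S'' \<subseteq> \<Omega>" using R by (auto simp: \<Omega>_def mem_gauge_ball shell_def)
  have fs: "sqi \<Omega> (f n)" "sqi \<Omega> (BB (f2 n))" for n
    by (intro sqi_continuous C2D[OF f] BB_continuous[OF f] \<Omega>)+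
  have lim: "(\<lambda>n. nsq ?S' (w n)) \<longlonglongrightarrow> 0" if "(\<lambda>n. nsq \<Omega> (w n)) \<longlonglongrightarrow> 0" "\<And>n. sqi \<Omega> (w n)" for w
  proof (rule tendsto_sandwich[OF _ _ tendsto_const that(1)])
    show "\<forall>\<^sub>F n in sequentially. nsq ?S' (w n) \<le> nsq \<Omega> (w n)"
      using sqi_subset(2)[OF that(2) sub(1) shell_measurable] by (intro always_eventually) auto
  qed simp
  have bdd: "\<exists>B. \<forall>n. nsq \<Omega> (w n) \<le> B" if l: "(\<lambda>n. nsq \<Omega> (\<lambda>p. w n p - x p)) \<longlonglongrightarrow> 0" and wx: "\<And>n. sqi \<Omega> (w n)" "sqi \<Omega> x" for w x
  proof -
    obtain B where B: "\<And>n. norm (nsq \<Omega> (\<lambda>p. w n p - x p)) \<le> B"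
      using convergent_imp_bounded[OF l] unfolding bounded_iff by auto
    have "nsq \<Omega> (w n) \<le> 2 * B + 2 * nsq \<Omega> x" for n
      using sqi_add(2)[OF \<Omega>(1) sqi_diff(1)[OF \<Omega>(1) wx(1)[of n] wx(2)] wx(2)] B[of n] by simp
    then show ?thesis by blast
  qed
  obtain B1 where B1: "\<And>n. nsq \<Omega> (f n) \<le> B1" using bdd[OF fv fs(1) v] by auto
  obtain B2 where B2: "\<And>n. nsq \<Omega> (BB (f2 n)) \<le> B2" using bdd[OF fg fs(2) g] by auto
  obtain c where c: "c \<ge> 0" "\<And>h h1 h2 i. C2 h h1 h2 \<Longrightarrow> nsq ?S' (h1 (Inl i)) \<le> c * (nsq ?S'' h + nsq ?S'' (BB h2))"
    by (rule gradient_bound[of "a - 1" "b + 1"]) (rule that)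
  have M: "nsq ?S' (f1 n (Inl i)) \<le> c * (B1 + B2)" for n i
  proof -
    have "nsq ?S'' (f n) + nsq ?S'' (BB (f2 n)) \<le> B1 + B2"
      using sqi_subset(2)[OF fs(1) sub(2) shell_measurable] sqi_subset(2)[OF fs(2) sub(2) shell_measurable] B1 B2
      by (meson add_mono order_trans)
    then show ?thesis using c(2)[OF f, of n i] mult_left_mono[OF _ c(1)] by (meson order_trans)
  qed
  show ?thesis
  proof (rule carleman_solution[OF _ _ f _ _ _ _ M _ K])
    show "sqi ?S' v" "sqi ?S' g"
      using sqi_subset(1)[OF v sub(1) shell_measurable] sqi_subset(1)[OF g sub(1) shell_measurable] by auto
    show "(\<lambda>n. nsq ?S' (\<lambda>p. f n p - v p)) \<longlonglongrightarrow> 0" "(\<lambda>n. nsq ?S' (\<lambda>p. BB (f2 n) p - g p)) \<longlonglongrightarrow> 0"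
      by (intro lim fv fg sqi_diff(1)[OF \<Omega>(1)] fs v g)+
    show "\<bar>g p\<bar> \<le> K * (WW p * exp (- 2 * \<gamma> * lg p)) * \<bar>v p\<bar>" if "p \<in> ?S'" for p
      using V that by (auto simp: shell_def)
  qed simp_all
qed

end

section \<open>Constants and the angle function\<close>

context grushin begin

text \<open>\<open>CM\<close> is a generous factor for the terms with derivatives of the cutoff. In
  \<open>CZ\<close>, 3 e^8 covers 3/2 (1 + K^2) e^(2 s) for s \<le> 4, and the rest covers 2
  \<open>zeta\<close> together with the derivatives of \<open>zeta\<close>.\<close>

definition CM :: real where "CM = 4000 * (1 + \<bar>qq\<bar>)"
definition CZ :: real where "CZ = 3 * exp 8 + 1922 + 120 * \<bar>qq\<bar>"
text \<open>The ball of gauge radius e^4. It contains the shells in use, because \<open>s0\<close>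
  will be at most 4, and so makes \<open>vol\<close> independent of R.\<close>

definition bigball :: "('m, 'k) pt set" where "bigball = {p. DD p \<le> exp (2 * kap * 4)}"
definition vol :: real where "vol = (LINT p|lborel. indicator bigball p)"
text \<open>The angle function off the origin, written through \<open>lg\<close>.\<close>

definition psi :: "('m, 'k) pt \<Rightarrow> real" where "psi p = WW p * exp (- 2 * \<gamma> * lg p)"

lemma CM_pos: "CM > 0" by (simp add: CM_def add_pos_nonneg)

lemma CZ_pos: "CZ > 0" by (simp add: CZ_def add_pos_nonneg add_pos_pos)

lemma bigball: "p \<noteq> 0 \<Longrightarrow> p \<in> bigball \<longleftrightarrow> lg p \<le> 4"
  using kap by (simp add: bigball_def exp_lg[symmetric])

lemma bigball_measurable [measurable]: "bigball \<in> sets borel"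
  unfolding bigball_def by (intro borel_closed closed_Collect_le continuous_intros)

lemma bigball_integrable: "integrable lborel (\<lambda>p. indicator bigball p :: real)"
proof (rule integrable_bounded_support[of _ 1 bigball])
  show "bounded bigball" unfolding bigball_def by (rule DD_le_bounded)
qed (auto simp: indicator_def)

lemma vol_nonneg: "vol \<ge> 0" unfolding vol_def by (intro integral_nonneg_AE) auto

lemma psi_nonneg: "psi p \<ge> 0" by (simp add: psi_def)

lemma psi_le_1: "p \<noteq> 0 \<Longrightarrow> psi p \<le> 1"
proof -
  assume p: "p \<noteq> 0"
  have "norm (fst p) powr (2 * kap) \<le> exp (2 * kap * lg p)"
    unfolding exp_lg[OF p] DD_def by simp
  then have "(norm (fst p) powr (2 * kap)) powr (\<gamma> / kap) \<le> exp (2 * kap * lg p) powr (\<gamma> / kap)"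
    using gam kap by (intro powr_mono2) auto
  moreover have "2 * kap * (\<gamma> / kap) = 2 * \<gamma>" using kap by simp
  ultimately have "WW p \<le> exp (2 * \<gamma> * lg p)"
    using kap by (simp add: WW_def powr_powr powr_def[of "exp _"] mult_ac)
  then have "WW p * exp (- 2 * \<gamma> * lg p) \<le> exp (2 * \<gamma> * lg p) * exp (- 2 * \<gamma> * lg p)"
    by (rule mult_right_mono) simp
  also have "\<dots> = 1" by (simp add: exp_add[symmetric])
  finally show ?thesis by (simp add: psi_def)
qed

lemma mm_psi: "p \<noteq> 0 \<Longrightarrow> mm p = psi p * exp (- 2 * lg p)"
proof -
  assume p: "p \<noteq> 0"
  have "mm p = WW p * exp (- (2 * kap * lg p))" unfolding mm_def exp_minus exp_lg[OF p] by (simp add: divide_inverse)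
  also have "- (2 * kap * lg p) = - 2 * \<gamma> * lg p + - 2 * lg p" by (simp add: kap_def algebra_simps)
  finally show ?thesis by (simp only: psi_def exp_add mult.assoc)
qed

lemma psi_measurable [measurable]: "psi \<in> borel_measurable borel"
  unfolding psi_def[abs_def] by measurable

end

section \<open>Size of the profile, and the main estimate\<close>

context carleman_profile begin

lemma bb_bounds: "s \<le> s0 \<Longrightarrow> al / 2 \<le> bb s" "bb s \<le> al" "bb1 s \<le> 0" "s \<le> s0 \<Longrightarrow> - al / 2 \<le> bb1 s"
proof -
  have e: "al * exp (s - s0) \<le> al * 1" if "s \<le> s0" using al that by (intro mult_left_mono) auto
  show "s \<le> s0 \<Longrightarrow> al / 2 \<le> bb s" using e by (simp add: bb_def algebra_simps)
  show "bb s \<le> al" "bb1 s \<le> 0" using al by (auto simp: bb_def bb1_def algebra_simps)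
  show "s \<le> s0 \<Longrightarrow> - al / 2 \<le> bb1 s" using e by (simp add: bb1_def)
qed

text \<open>The logarithmic derivative of \<open>EE\<close> is \<open>- 2 * bb\<close>, and
  \<open>bb\<close> lies between \<open>al / 2\<close> and \<open>al\<close> up to
  \<open>s0\<close>.\<close>

lemma EE_ratio:
  assumes "s \<le> s'" "s' \<le> s0"
  shows "EE s' \<le> EE s * exp (- al * (s' - s))" "EE s \<le> EE s' * exp (2 * al * (s' - s))"
proof -
  have "1 + (s - s') \<le> exp (s - s')" by (rule exp_ge_add_one_self)
  then have "1 - exp (s - s') \<le> s' - s" by linarith
  then have "exp (s' - s0) * (1 - exp (s - s')) \<le> exp (s' - s0) * (s' - s)"
    by (rule mult_left_mono) simp
  also have "\<dots> \<le> 1 * (s' - s)" using assms by (intro mult_right_mono) auto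
  finally have d: "exp (s' - s0) - exp (s - s0) \<le> s' - s"
    by (simp add: right_diff_distrib exp_add[symmetric])
  have d0: "0 \<le> exp (s' - s0) - exp (s - s0)" using assms by simp
  have "al * (exp (s' - s0) - exp (s - s0)) \<le> al * (s' - s)" using al d by (rule mult_left_mono[rotated])
  moreover have "0 \<le> al * (exp (s' - s0) - exp (s - s0))" using al d0 by simp
  ultimately show "EE s' \<le> EE s * exp (- al * (s' - s))" "EE s \<le> EE s' * exp (2 * al * (s' - s))"
    unfolding EE_def exp_add[symmetric] by (simp_all add: algebra_simps)
qed

lemma EE_antimono: "s \<le> s' \<Longrightarrow> s' \<le> s0 \<Longrightarrow> EE s' \<le> EE s"
proof -
  assume a: "s \<le> s'" "s' \<le> s0"
  have "EE s * exp (- al * (s' - s)) \<le> EE s * 1"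
    using EE_pos[of s] al a by (intro mult_left_mono) auto
  then show ?thesis using EE_ratio(1)[OF a] by linarith
qed

lemma profile_bounds:
  assumes "s \<le> s0" "al \<ge> 1"
  shows "\<bar>bb s\<bar> \<le> al" "\<bar>bb1 s - 2 * (bb s)\<^sup>2\<bar> \<le> 3 * al\<^sup>2" "\<bar>bet s\<bar> \<le> (2 * \<bar>qq\<bar> + 3) * al\<^sup>2"
    "\<bar>gg s\<bar> \<le> (3 + 3 * \<bar>qq\<bar>) * al ^ 3"
proof -
  have b: "\<bar>bb s\<bar> \<le> al" "\<bar>bb1 s\<bar> \<le> al / 2"
    using bb_bounds[of s] assms by auto
  show "\<bar>bb s\<bar> \<le> al" by (rule b)
  have a2: "al \<le> al\<^sup>2" "al\<^sup>2 \<le> al ^ 3" "al \<le> al ^ 3"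
    using assms(2) power_increasing[of 1 2 al] power_increasing[of 2 3 al] power_increasing[of 1 3 al] by auto
  have b2: "\<bar>(bb s)\<^sup>2\<bar> \<le> al\<^sup>2" using power_mono[OF b(1), of 2] by simp
  have b3: "\<bar>bb s ^ 3\<bar> \<le> al ^ 3" using power_mono[OF b(1), of 3] by (simp add: power_abs)
  have bb1: "\<bar>bb s * bb1 s\<bar> \<le> al\<^sup>2 / 2"
    using mult_mono[OF b] al by (simp add: abs_mult power2_eq_square)
  have q1: "\<bar>qq * bb1 s\<bar> \<le> \<bar>qq\<bar> * (al / 2)" unfolding abs_mult using b by (intro mult_left_mono) auto
  have q2: "\<bar>qq * (bb s)\<^sup>2\<bar> \<le> \<bar>qq\<bar> * al\<^sup>2" unfolding abs_mult using b2 by (intro mult_left_mono) auto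
  have q3: "\<bar>qq * bb s\<bar> \<le> \<bar>qq\<bar> * al" unfolding abs_mult using b by (intro mult_left_mono) auto
  have m: "\<bar>qq\<bar> * al \<le> \<bar>qq\<bar> * al\<^sup>2" "\<bar>qq\<bar> * al\<^sup>2 \<le> \<bar>qq\<bar> * al ^ 3" "\<bar>qq\<bar> * al \<le> \<bar>qq\<bar> * al ^ 3"
    using a2 by (auto intro!: mult_left_mono)
  show "\<bar>bb1 s - 2 * (bb s)\<^sup>2\<bar> \<le> 3 * al\<^sup>2" using b b2 a2 by linarith
  have "bet s = 2 * (qq * bb s) - 2 * (bb s)\<^sup>2 + bb1 s"
    by (simp add: bet_def power2_eq_square algebra_simps)
  then show "\<bar>bet s\<bar> \<le> (2 * \<bar>qq\<bar> + 3) * al\<^sup>2"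
    using b b2 a2 q3 m unfolding distrib_right by linarith
  have "gg s = - bb1 s / 2 - bb s * bb1 s + 2 * bb s ^ 3 + qq * bb1 s - 2 * (qq * (bb s)\<^sup>2)"
    by (simp add: gg_def)
  then show "\<bar>gg s\<bar> \<le> (3 + 3 * \<bar>qq\<bar>) * al ^ 3"
    using b b3 a2 bb1 q1 q2 m unfolding distrib_right by linarith
qed

text \<open>The cutoff will be \<open>trap (sr - 2) (s0 - 1)\<close>, whose derivatives live on (sr
  - 2, sr - 1) and (s0 - 2, s0 - 1). The plateaus in \<open>zz\<close> are 1 on these intervals, and
  since \<open>EE\<close> decreases, its values at the left ends majorize it there.\<close>

definition "Mi sr = CM * al ^ 3 * EE (sr - 2)"
definition "Mo = CM * al ^ 3 * EE (s0 - 2)"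
definition "zz sr s = Mi sr * trap (sr - 3) sr s + Mo * trap (s0 - 3) s0 s"
definition "zz1 sr s = Mi sr * trap1 (sr - 3) sr s + Mo * trap1 (s0 - 3) s0 s"
definition "zz2 sr s = Mi sr * trap2 (sr - 3) sr s + Mo * trap2 (s0 - 3) s0 s"

lemma M_nonneg: "Mi sr \<ge> 0" "Mo \<ge> 0"
  unfolding Mi_def Mo_def
  by (intro mult_nonneg_nonneg zero_le_power al less_imp_le[OF CM_pos] less_imp_le[OF EE_pos])+

lemma zz_nonneg: "zz sr s \<ge> 0"
  unfolding zz_def by (intro add_nonneg_nonneg mult_nonneg_nonneg M_nonneg trap_bounds)

lemma zz_lower:
  assumes sr: "sr \<le> s0 - 4"
    and s: "s \<in> {sr - 2<..<sr - 1} \<or> s \<in> {s0 - 2<..<s0 - 1}"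
  shows "CM * al ^ 3 * EE s \<le> zz sr s"
  using s
proof
  assume s: "s \<in> {sr - 2<..<sr - 1}"
  have "EE s \<le> EE (sr - 2)" using s sr by (intro EE_antimono) auto
  then have "CM * al ^ 3 * EE s \<le> Mi sr * 1" unfolding Mi_def using CM_pos al by (simp add: mult_left_mono)
  also have "1 = trap (sr - 3) sr s" using s by (intro trap_one[symmetric]) auto
  also have "Mi sr * trap (sr - 3) sr s \<le> zz sr s"
    unfolding zz_def using M_nonneg(2) trap_bounds(1)[of "s0 - 3" s0 s] by simp
  finally show ?thesis .
next
  assume s: "s \<in> {s0 - 2<..<s0 - 1}"
  have "EE s \<le> EE (s0 - 2)" using s by (intro EE_antimono) auto
  then have "CM * al ^ 3 * EE s \<le> Mo * 1" unfolding Mo_def using CM_pos al by (simp add: mult_left_mono)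
  also have "1 = trap (s0 - 3) s0 s" using s by (intro trap_one[symmetric]) auto
  also have "Mo * trap (s0 - 3) s0 s \<le> zz sr s"
    unfolding zz_def using M_nonneg(1)[of sr] trap_bounds(1)[of "sr - 3" sr s] by simp
  finally show ?thesis .
qed

lemma cutoff_bounds:
  assumes sr: "sr \<le> s0 - 4" and al1: "al \<ge> 1"
  defines "e1 \<equiv> trap1 (sr - 2) (s0 - 1)" and "e2 \<equiv> trap2 (sr - 2) (s0 - 1)"
  shows "2 * \<bar>e1 s * bb s * EE s\<bar> \<le> zz sr s"
    "\<bar>e1 s * EE s * bet s + e2 s * bb s * EE s + e1 s * (bb1 s - 2 * (bb s)\<^sup>2) * EE s\<bar> \<le> 2 * zz sr s"
    "\<bar>e1 s * EE s * gg s\<bar> \<le> zz sr s"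
proof -
  have "2 * \<bar>e1 s * bb s * EE s\<bar> \<le> zz sr s \<and>
    \<bar>e1 s * EE s * bet s + e2 s * bb s * EE s + e1 s * (bb1 s - 2 * (bb s)\<^sup>2) * EE s\<bar> \<le> 2 * zz sr s \<and>
    \<bar>e1 s * EE s * gg s\<bar> \<le> zz sr s"
  proof (cases "s \<in> {sr - 2<..<sr - 1} \<or> s \<in> {s0 - 2<..<s0 - 1}")
    case False
    then have "e1 s = 0" "e2 s = 0"
      using trap12_zero[of s "sr - 2" "s0 - 1"] unfolding e1_def e2_def by auto
    then show ?thesis using zz_nonneg by simp
  next
    case True
    have ss: "s \<le> s0" using True sr by auto
    note Z = zz_lower[OF sr True]
    note P = profile_bounds[OF ss al1]
    have E: "EE s > 0" by (rule EE_pos)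
    have e1: "\<bar>e1 s\<bar> \<le> 60" and e2: "\<bar>e2 s\<bar> \<le> 1920" unfolding e1_def e2_def by (rule trap_bounds)+
    have a2: "al \<le> al\<^sup>2" "al\<^sup>2 \<le> al ^ 3" "al \<le> al ^ 3"
      using al1 power_increasing[of 1 2 al] power_increasing[of 2 3 al] power_increasing[of 1 3 al] by auto
    have q: "\<bar>qq\<bar> * al\<^sup>2 \<le> \<bar>qq\<bar> * al ^ 3" using a2 by (intro mult_left_mono) auto
    have q0: "0 \<le> \<bar>qq\<bar> * al ^ 3" using al by simp
    have CMe: "CM * al ^ 3 = 4000 * al ^ 3 + 4000 * (\<bar>qq\<bar> * al ^ 3)" by (simp add: CM_def algebra_simps)
    have m1: "\<bar>e1 s * bb s\<bar> \<le> 60 * al" unfolding abs_mult using e1 P(1) by (intro mult_mono) auto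
    have m2: "\<bar>e1 s * bet s\<bar> \<le> 60 * ((2 * \<bar>qq\<bar> + 3) * al\<^sup>2)" unfolding abs_mult using e1 P(3) by (intro mult_mono) auto
    have m3: "\<bar>e2 s * bb s\<bar> \<le> 1920 * al" unfolding abs_mult using e2 P(1) by (intro mult_mono) auto
    have m4: "\<bar>e1 s * (bb1 s - 2 * (bb s)\<^sup>2)\<bar> \<le> 60 * (3 * al\<^sup>2)" unfolding abs_mult using e1 P(2) by (intro mult_mono) auto
    have m5: "\<bar>e1 s * gg s\<bar> \<le> 60 * ((3 + 3 * \<bar>qq\<bar>) * al ^ 3)" unfolding abs_mult using e1 P(4) by (intro mult_mono) auto
    have fin: "\<bar>x * EE s\<bar> \<le> zz sr s" if "\<bar>x\<bar> \<le> CM * al ^ 3" for x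
    proof -
      have "\<bar>x * EE s\<bar> \<le> CM * al ^ 3 * EE s" using that E by (simp add: abs_mult mult_right_mono)
      then show ?thesis using Z by linarith
    qed
    have f1: "\<bar>(2 * (e1 s * bb s)) * EE s\<bar> \<le> zz sr s"
      by (rule fin) (use m1 a2 q0 CMe in linarith)
    have f2: "\<bar>(e1 s * bet s + e2 s * bb s + e1 s * (bb1 s - 2 * (bb s)\<^sup>2)) * EE s\<bar> \<le> zz sr s"
    proof (rule fin)
      have "60 * ((2 * \<bar>qq\<bar> + 3) * al\<^sup>2) = 120 * (\<bar>qq\<bar> * al\<^sup>2) + 180 * al\<^sup>2" by (simp add: algebra_simps)
      then show "\<bar>e1 s * bet s + e2 s * bb s + e1 s * (bb1 s - 2 * (bb s)\<^sup>2)\<bar> \<le> CM * al ^ 3"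
        using m2 m3 m4 a2 q q0 CMe by linarith
    qed
    have f3: "\<bar>(e1 s * gg s) * EE s\<bar> \<le> zz sr s"
    proof (rule fin)
      have "60 * ((3 + 3 * \<bar>qq\<bar>) * al ^ 3) = 180 * al ^ 3 + 180 * (\<bar>qq\<bar> * al ^ 3)" by (simp add: algebra_simps)
      moreover have "al ^ 3 \<ge> 0" using al by simp
      ultimately show "\<bar>e1 s * gg s\<bar> \<le> CM * al ^ 3" using m5 q0 CMe by linarith
    qed
    have "2 * \<bar>e1 s * bb s * EE s\<bar> = \<bar>(2 * (e1 s * bb s)) * EE s\<bar>" by (simp add: abs_mult)
    moreover have "e1 s * EE s * bet s + e2 s * bb s * EE s + e1 s * (bb1 s - 2 * (bb s)\<^sup>2) * EE s
      = (e1 s * bet s + e2 s * bb s + e1 s * (bb1 s - 2 * (bb s)\<^sup>2)) * EE s" by (simp add: algebra_simps)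
    moreover have "e1 s * EE s * gg s = (e1 s * gg s) * EE s" by simp
    ultimately show ?thesis using f1 f2 f3 zz_nonneg[of sr s] by linarith
  qed
  then show "2 * \<bar>e1 s * bb s * EE s\<bar> \<le> zz sr s"
    "\<bar>e1 s * EE s * bet s + e2 s * bb s * EE s + e1 s * (bb1 s - 2 * (bb s)\<^sup>2) * EE s\<bar> \<le> 2 * zz sr s"
    "\<bar>e1 s * EE s * gg s\<bar> \<le> zz sr s" by auto
qed

text \<open>On the inner region of \<open>zz\<close> the bound \<open>Mu\<close> is used, on the
  outer one only \<open>K0\<close>. After division by the weight at s0 - 4, the outer term keeps the
  factor exp (-2 al), because its region starts to matter two units further out, where
  \<open>EE\<close> has dropped by that much.\<close>

lemma key_estimate:
  fixes f :: "nat \<Rightarrow> ('m, 'k) pt \<Rightarrow> real" and R K K0 Mu sr :: real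
  defines "\<Omega> \<equiv> gauge_ball \<gamma> R :: ('m, 'k) pt set" and "L \<equiv> s0 - 4 - sr"
  assumes R: "R > 0" "s0 + 2 < ln R" and K: "K \<ge> 0"
    and f: "\<And>n. C2 (f n) (f1 n) (f2 n)"
    and v: "sqi \<Omega> v" and g: "sqi \<Omega> g"
    and fv: "(\<lambda>n. nsq \<Omega> (\<lambda>p. f n p - v p)) \<longlonglongrightarrow> 0"
    and fg: "(\<lambda>n. nsq \<Omega> (\<lambda>p. BB (f2 n) p - g p)) \<longlonglongrightarrow> 0"
    and V: "\<And>p. p \<noteq> 0 \<Longrightarrow> \<bar>g p\<bar> \<le> K * (WW p * exp (- 2 * \<gamma> * lg p)) * \<bar>v p\<bar>"
    and sr: "sr \<le> s0 - 4" and s0: "s0 \<le> 4"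
    and al2: "al \<ge> 2" and alK: "4 * exp 16 * (1 + K\<^sup>2) \<le> al ^ 3"
    and K0: "\<And>p. \<bar>v p\<bar> \<le> K0" and Mu: "AE p in lborel. p \<noteq> 0 \<and> lg p < sr \<longrightarrow> \<bar>v p\<bar> \<le> Mu"
  shows "(LINT p|lborel. indicator (shell sr (s0 - 4)) p * (psi p * (v p)\<^sup>2))
    \<le> 8 * exp 4 * CZ * CM * vol * al ^ 3 * (exp (6 + 2 * L + 2 * al * (L + 2)) * Mu\<^sup>2 + K0\<^sup>2 * exp (- 2 * al))"
proof -
  have al1: "al \<ge> 1" using al2 by simp
  define e where "e = trap (sr - 2) (s0 - 1)"
  define e1 where "e1 = trap1 (sr - 2) (s0 - 1)"
  define e2 where "e2 = trap2 (sr - 2) (s0 - 1)"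
  have z: "(zz sr has_real_derivative zz1 sr s) (at s)" "(zz1 sr has_real_derivative zz2 sr s) (at s)" for s
    unfolding zz_def[abs_def] zz1_def[abs_def] zz2_def
    by (auto intro!: derivative_eq_intros trap_deriv)
  have zc: "continuous_on UNIV (zz2 sr)"
    unfolding zz2_def[abs_def] by (intro continuous_intros trap_continuous)
  have z0: "s \<notin> {sr - 3..s0} \<Longrightarrow> zz sr s = 0" for s
    using trap_support[of s "sr - 3" sr] trap_support[of s "s0 - 3" s0] sr by (auto simp: zz_def)
  have e0: "s \<notin> {sr - 3..s0} \<Longrightarrow> e s = 0" for s
    using trap_support[of s "sr - 2" "s0 - 1"] by (auto simp: e_def)
  have ed: "(e has_real_derivative e1 s) (at s)" "(e1 has_real_derivative e2 s) (at s)"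
    "continuous_on UNIV e2" "e s \<ge> 0" for s
    unfolding e_def e1_def e2_def by (rule trap_deriv trap_continuous trap_bounds)+
  note cb = cutoff_bounds[OF sr al1, folded e1_def e2_def]
  interpret W: carleman_weights \<gamma> dims al s0 "sr - 3" s0 e e1 e2 "zz sr" "zz1 sr" "zz2 sr"
    by unfold_locales (rule ed e0 z zc z0 zz_nonneg cb; assumption)+
  \<comment> \<open>All terms on one side, as a single profile in s; it is bounded below in
    \<open>Nlow\<close>.\<close>
  define N where "N s = W.wmain s - W.wcut s - K\<^sup>2 * (W.wpot s * exp (4 * s))" for s
  let ?S = "shell (sr - 3) s0"
  have subS: "?S \<subseteq> \<Omega>" using R by (auto simp: \<Omega>_def mem_gauge_ball shell_def)
  have vS: "sqi ?S v" by (rule sqi_subset(1)[OF v subS shell_measurable])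
  have vm [measurable]: "v \<in> borel_measurable borel" by (rule sqiD(1)[OF v])
  have wi: "integrable lborel (\<lambda>p. mm p * rad F p * (v p)\<^sup>2)"
    if F: "continuous_on UNIV F" "\<And>s. s \<notin> {sr - 3..s0} \<Longrightarrow> F s = 0" for F
  proof -
    have Fc: "continuous_on UNIV (\<lambda>p. mm p * rad F p)" by (rule rad_mm_continuous[of _ "sr - 3" s0]) (rule F)+
    have F0: "mm p * rad F p = 0" if "p \<notin> ?S" for p using rad_support[of "sr - 3" s0 F p] F(2) that by simp
    obtain C where C: "C > 0" "\<And>p. \<bar>mm p * rad F p\<bar> \<le> C * indicator ?S p"
      using W.weight_bounded[OF Fc F0] by blast
    have Cb: "\<bar>mm p * rad F p\<bar> \<le> C" for p using C(2)[of p] C(1) by (cases "p \<in> ?S") auto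
    have "integrable lborel (\<lambda>p. (mm p * rad F p) * (indicator ?S p * (v p)\<^sup>2))"
      by (rule integrable_mult_bounded[OF borel_measurable_continuous_onI[OF Fc] Cb sqiD(2)[OF vS]])
    moreover have "(mm p * rad F p) * (indicator ?S p * (v p)\<^sup>2) = mm p * rad F p * (v p)\<^sup>2" for p
      using F0[of p] by (cases "p \<in> ?S") auto
    ultimately show ?thesis by simp
  qed
  have i1: "integrable lborel (\<lambda>p. mm p * rad W.wmain p * (v p)\<^sup>2)"
    by (rule wi[OF W.w_continuous(1)]) (rule W.w_support)
  have i2: "integrable lborel (\<lambda>p. mm p * rad W.wcut p * (v p)\<^sup>2)"
    by (rule wi[OF W.w_continuous(3)]) (rule W.w_support)
  have i3: "integrable lborel (\<lambda>p. mm p * rad (\<lambda>s. W.wpot s * exp (4 * s)) p * (v p)\<^sup>2)"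
    by (rule wi) (auto intro!: continuous_intros W.w_continuous simp: W.w_support)
  have Ne: "mm p * rad N p * (v p)\<^sup>2 = (mm p * rad W.wmain p * (v p)\<^sup>2 - mm p * rad W.wcut p * (v p)\<^sup>2)
      - K\<^sup>2 * (mm p * rad (\<lambda>s. W.wpot s * exp (4 * s)) p * (v p)\<^sup>2)" for p
    by (cases "p = 0") (auto simp: rad_def N_def algebra_simps)
  have iN: "integrable lborel (\<lambda>p. mm p * rad N p * (v p)\<^sup>2)"
    unfolding Ne using i1 i2 i3 by simp
  have "(LINT p|lborel. (mm p * rad W.wmain p - mm p * rad W.wcut p) * (v p)\<^sup>2)
    \<le> K\<^sup>2 * (LINT p|lborel. mm p * rad (\<lambda>s. W.wpot s * exp (4 * s)) p * (v p)\<^sup>2)"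
    by (rule W.carleman_for_solution[OF R K f v[unfolded \<Omega>_def] g[unfolded \<Omega>_def] fv[unfolded \<Omega>_def] fg[unfolded \<Omega>_def] V])
  then have N0: "(LINT p|lborel. mm p * rad N p * (v p)\<^sup>2) \<le> 0"
    unfolding Ne left_diff_distrib using i1 i2 i3 by simp
  \<comment> \<open>The function al^3 / 8 e^(-2 s) e^(s - s0) \<open>EE s\<close> decreases, and
    this is its value at s0 - 4; e^(-2 s) comes from \<open>mm\<close>.\<close>
  define c1 where "c1 = al ^ 3 / 8 * EE (s0 - 4) * exp (- 2 * (s0 - 4) - 4)"
  define c2 where "c2 = CZ * al ^ 3 * (Mi sr * exp (- 2 * sr + 6) * Mu\<^sup>2 + Mo * exp (- 2 * (s0 - 4)) * K0\<^sup>2)"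
  have al3: "al ^ 3 > 0" using al1 by simp
  have c1: "c1 > 0" unfolding c1_def using al3 EE_pos by simp
  have t2: "Mi sr * exp (- 2 * sr + 6) * Mu\<^sup>2 \<ge> 0" "Mo * exp (- 2 * (s0 - 4)) * K0\<^sup>2 \<ge> 0"
    using M_nonneg by simp_all
  have CZa: "CZ * al ^ 3 \<ge> 0" using CZ_pos al3 by simp
  have c2: "c2 \<ge> 0" unfolding c2_def by (rule mult_nonneg_nonneg[OF CZa add_nonneg_nonneg[OF t2]])
  have "1 \<le> 4 * exp (16::real)" using exp_ge_add_one_self[of "16::real"] by simp
  then have "1 * (1 + K\<^sup>2) \<le> 4 * exp 16 * (1 + K\<^sup>2)" by (rule mult_right_mono) simp
  from order_trans[OF this alK] have aK: "1 + K\<^sup>2 \<le> al ^ 3" by simp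
  have Nlow: "N s \<ge> al ^ 3 / 8 * exp (s - s0) * e s * EE s
      - CZ * al ^ 3 * (Mi sr * of_bool (s < sr) + Mo * of_bool (s > s0 - 3))" if s: "s \<le> s0" for s
  proof -
    let ?X = "exp (s - s0)" and ?Z = "Mi sr * of_bool (s < sr) + Mo * of_bool (s > s0 - 3)"
    have eE: "e s * EE s \<ge> 0" using ed(4)[of s] EE_pos[of s] by simp
    have Z0: "?Z \<ge> 0" using M_nonneg by simp
    \<comment> \<open>As \<open>al\<close> is at least 2, the loss of 1/4 is at most al^2 / 16 of
      the available al^2 / 4.\<close>
    have "(al / 2)\<^sup>2 \<le> (bb s)\<^sup>2" using bb_bounds(1)[OF s] al by (intro power_mono) auto
    moreover have "4 \<le> al\<^sup>2" using power_mono[OF al2, of 2] by simp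
    ultimately have b2: "3 / 16 * al\<^sup>2 \<le> (bb s)\<^sup>2 - 1 / 4" by (simp add: power_divide)
    have m: "al * ?X * (3 / 16 * al\<^sup>2) \<le> al * ?X * ((bb s)\<^sup>2 - 1 / 4)"
      using b2 al by (intro mult_left_mono) auto
    \<comment> \<open>One factor e^(s - s0) is split off to match the main term; what remains is at
      most e^16. Of the three sixteenths of al^3 available, the potential uses one, which leaves
      al^3 / 8.\<close>
    have "exp (4 * s) = ?X * exp (s0 + 3 * s)" by (simp add: exp_add[symmetric])
    also have "\<dots> \<le> ?X * exp 16" using s s0 by (intro mult_left_mono) auto
    finally have "K\<^sup>2 * exp (4 * s) \<le> K\<^sup>2 * (?X * exp 16)" by (rule mult_left_mono) simp
    also have "\<dots> = ?X * (exp 16 * K\<^sup>2)" by simp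
    also have "\<dots> \<le> ?X * (al ^ 3 / 4)"
    proof (rule mult_left_mono)
      have "4 * (exp 16 * K\<^sup>2) \<le> 4 * exp 16 * (1 + K\<^sup>2)" by (simp add: distrib_left)
      from order_trans[OF this alK] show "exp 16 * K\<^sup>2 \<le> al ^ 3 / 4" by simp
    qed simp
    finally have k4: "K\<^sup>2 * exp (4 * s) / 4 \<le> al ^ 3 / 16 * ?X" by (simp add: mult.commute)
    have t: "al * ?X * (3 / 16 * al\<^sup>2) = 3 * (al ^ 3 / 16 * ?X)" "al ^ 3 / 8 * ?X = 2 * (al ^ 3 / 16 * ?X)"
      by (simp_all add: power2_eq_square power3_eq_cube)
    have "x \<le> y - z" if "w = 3 * u" "x = 2 * u" "w \<le> y" "z \<le> u" for x y z w u :: real using that by linarith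
    from this[OF t m k4]
    have "al ^ 3 / 8 * ?X \<le> al * ?X * ((bb s)\<^sup>2 - 1 / 4) - K\<^sup>2 * exp (4 * s) / 4" .
    then have p1: "e s * EE s * (al ^ 3 / 8 * ?X) \<le> e s * EE s * (al * ?X * ((bb s)\<^sup>2 - 1 / 4) - K\<^sup>2 * exp (4 * s) / 4)"
      using eE by (rule mult_left_mono)
    have ti: "trap (sr - 3) sr s \<le> of_bool (s < sr)" "trap (s0 - 3) s0 s \<le> of_bool (s > s0 - 3)"
      using trap_bounds(2)[of "sr - 3" sr s] trap_bounds(2)[of "s0 - 3" s0 s]
      by (auto simp: of_bool_def trap_def step_values)
    have tq: "\<bar>trap2 (sr - 3) sr s + 2 * qq * trap1 (sr - 3) sr s\<bar> \<le> (1920 + 120 * \<bar>qq\<bar>) * of_bool (s < sr)"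
      "\<bar>trap2 (s0 - 3) s0 s + 2 * qq * trap1 (s0 - 3) s0 s\<bar> \<le> (1920 + 120 * \<bar>qq\<bar>) * of_bool (s > s0 - 3)"
    proof -
      have g: "\<bar>trap2 p q s + 2 * qq * trap1 p q s\<bar> \<le> 1920 + 120 * \<bar>qq\<bar>" for p q
      proof -
        have "\<bar>qq\<bar> * \<bar>trap1 p q s\<bar> \<le> \<bar>qq\<bar> * 60" by (intro mult_left_mono trap_bounds) simp
        then have "\<bar>2 * qq * trap1 p q s\<bar> \<le> 120 * \<bar>qq\<bar>" by (simp add: abs_mult)
        then show ?thesis using trap_bounds(4)[of p q s] by linarith
      qed
      show "\<bar>trap2 (sr - 3) sr s + 2 * qq * trap1 (sr - 3) sr s\<bar> \<le> (1920 + 120 * \<bar>qq\<bar>) * of_bool (s < sr)"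
        using g[of "sr - 3" sr] trap12_zero[of s "sr - 3" sr] by (cases "s < sr") auto
      show "\<bar>trap2 (s0 - 3) s0 s + 2 * qq * trap1 (s0 - 3) s0 s\<bar> \<le> (1920 + 120 * \<bar>qq\<bar>) * of_bool (s > s0 - 3)"
        using g[of "s0 - 3" s0] trap12_zero[of s "s0 - 3" s0] by (cases "s > s0 - 3") auto
    qed
    have zZ: "zz sr s \<le> ?Z" unfolding zz_def
      by (intro add_mono mult_left_mono ti M_nonneg)
    have "\<bar>zz2 sr s + 2 * qq * zz1 sr s\<bar> =
        \<bar>Mi sr * (trap2 (sr - 3) sr s + 2 * qq * trap1 (sr - 3) sr s) + Mo * (trap2 (s0 - 3) s0 s + 2 * qq * trap1 (s0 - 3) s0 s)\<bar>"
      by (simp add: zz1_def zz2_def algebra_simps)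
    also have "\<dots> \<le> Mi sr * \<bar>trap2 (sr - 3) sr s + 2 * qq * trap1 (sr - 3) sr s\<bar>
        + Mo * \<bar>trap2 (s0 - 3) s0 s + 2 * qq * trap1 (s0 - 3) s0 s\<bar>"
      using M_nonneg by (intro order_trans[OF abs_triangle_ineq]) (simp add: abs_mult)
    also have "\<dots> \<le> Mi sr * ((1920 + 120 * \<bar>qq\<bar>) * of_bool (s < sr)) + Mo * ((1920 + 120 * \<bar>qq\<bar>) * of_bool (s > s0 - 3))"
      by (intro add_mono mult_left_mono tq M_nonneg)
    also have "\<dots> = (1920 + 120 * \<bar>qq\<bar>) * ?Z" by (simp add: algebra_simps)
    finally have z2: "\<bar>zz2 sr s + 2 * qq * zz1 sr s\<bar> \<le> (1920 + 120 * \<bar>qq\<bar>) * ?Z" .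
    have e8: "exp (2 * s) \<le> exp 8" using s s0 by simp
    have "(1 + K\<^sup>2) * exp (2 * s) \<le> al ^ 3 * exp 8" using aK e8 al by (intro mult_mono) auto
    have "1 * (1922 + 120 * \<bar>qq\<bar>) \<le> al ^ 3 * (1922 + 120 * \<bar>qq\<bar>)"
    proof (rule mult_right_mono)
      show "1 \<le> al ^ 3" using aK zero_le_power2[of K] by linarith
    qed simp
    have cz: "3 / 2 * ((1 + K\<^sup>2) * exp (2 * s)) + 2 + (1920 + 120 * \<bar>qq\<bar>) \<le> CZ * al ^ 3"
    proof -
      have c: "CZ * al ^ 3 = 3 * (al ^ 3 * exp 8) + al ^ 3 * (1922 + 120 * \<bar>qq\<bar>)"
        by (simp add: CZ_def algebra_simps)
      have A: "0 \<le> al ^ 3 * exp 8" using al by simp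
      have "3 / 2 * u + 2 + (1920 + r) \<le> w" if "u \<le> A" "1 * (1922 + r) \<le> y" "w = 3 * A + y" "0 \<le> A"
        for u A r y w :: real using that by argo
      from this[OF _ _ c A] show ?thesis
        using \<open>(1 + K\<^sup>2) * exp (2 * s) \<le> al ^ 3 * exp 8\<close> \<open>1 * (1922 + 120 * \<bar>qq\<bar>) \<le> al ^ 3 * (1922 + 120 * \<bar>qq\<bar>)\<close>
        by blast
    qed
    have "(3 / 2 * ((1 + K\<^sup>2) * exp (2 * s)) + 2) * zz sr s + \<bar>zz2 sr s + 2 * qq * zz1 sr s\<bar>
      \<le> (3 / 2 * ((1 + K\<^sup>2) * exp (2 * s)) + 2) * ?Z + (1920 + 120 * \<bar>qq\<bar>) * ?Z"
      using zZ z2 by (intro add_mono mult_left_mono) auto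
    also have "\<dots> = (3 / 2 * ((1 + K\<^sup>2) * exp (2 * s)) + 2 + (1920 + 120 * \<bar>qq\<bar>)) * ?Z" by (simp only: distrib_right)
    also have "\<dots> \<le> CZ * al ^ 3 * ?Z" by (rule mult_right_mono[OF cz Z0])
    finally have p2: "(3 / 2 * ((1 + K\<^sup>2) * exp (2 * s)) + 2) * zz sr s + \<bar>zz2 sr s + 2 * qq * zz1 sr s\<bar> \<le> CZ * al ^ 3 * ?Z" .
    have x42: "exp (- 2 * s) * exp (4 * s) = exp (2 * s)" by (simp add: exp_add[symmetric])
    have Ns: "N s = e s * EE s * (al * ?X * ((bb s)\<^sup>2 - 1 / 4) - K\<^sup>2 * exp (4 * s) / 4)
        - ((3 / 2 * ((1 + K\<^sup>2) * exp (2 * s)) + 2) * zz sr s + \<bar>zz2 sr s + 2 * qq * zz1 sr s\<bar>)"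
      unfolding N_def W.wmain_def W.wcut_def W.wpot_def bb1_def
      using x42 by (simp add: algebra_simps)
    have "e s * EE s * (al ^ 3 / 8 * ?X) = al ^ 3 / 8 * ?X * e s * EE s" by (simp add: mult_ac)
    from diff_mono[OF p1 p2, unfolded this] show ?thesis unfolding Ns .
  qed
  have pw: "AE p in lborel. c1 * (indicator (shell sr (s0 - 4)) p * (psi p * (v p)\<^sup>2)) - c2 * indicator bigball p
      \<le> mm p * rad N p * (v p)\<^sup>2"
    using Mu
  proof eventually_elim
    case (elim p)
    show ?case
    proof (cases "p \<in> ?S")
      case False
      then have "p \<notin> shell sr (s0 - 4)" by (auto simp: shell_def)
      moreover have "rad N p = 0"
        by (rule rad_support[OF _ False]) (simp add: N_def W.w_support)
      ultimately show ?thesis using c2 by simp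
    next
      case True
      then have p: "p \<noteq> 0" and s: "sr - 3 \<le> lg p" "lg p \<le> s0" by (auto simp: shell_def)
      let ?s = "lg p" and ?y = "psi p * (v p)\<^sup>2"
      have y0: "?y \<ge> 0" using psi_nonneg by simp
      have yv: "?y \<le> (v p)\<^sup>2" using psi_le_1[OF p] mult_right_mono[of "psi p" 1 "(v p)\<^sup>2"] by simp
      have yK: "?y \<le> K0\<^sup>2" using yv K0[of p] power_mono[of "\<bar>v p\<bar>" K0 2] by simp
      have yM: "?y \<le> Mu\<^sup>2" if "?s < sr" using yv elim p that power_mono[of "\<bar>v p\<bar>" Mu 2] by simp
      have big: "p \<in> bigball" using bigball[OF p] s s0 by simp
      have mv: "mm p * rad N p * (v p)\<^sup>2 = exp (- 2 * ?s) * ?y * N ?s"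
        using p by (simp add: mm_psi rad_def)
      have w0: "exp (- 2 * ?s) * ?y \<ge> 0" using y0 by simp
      have "exp (- 2 * ?s) * ?y * N ?s \<ge> exp (- 2 * ?s) * ?y * (al ^ 3 / 8 * exp (?s - s0) * e ?s * EE ?s
          - CZ * al ^ 3 * (Mi sr * of_bool (?s < sr) + Mo * of_bool (?s > s0 - 3)))"
        by (rule mult_left_mono[OF Nlow[OF s(2)] w0])
      moreover have "exp (- 2 * ?s) * ?y * (al ^ 3 / 8 * exp (?s - s0) * e ?s * EE ?s)
          \<ge> c1 * (indicator (shell sr (s0 - 4)) p * ?y)"
      proof (cases "p \<in> shell sr (s0 - 4)")
        case True
        then have s': "sr \<le> ?s" "?s \<le> s0 - 4" by (auto simp: shell_def)
        have e: "e ?s = 1" unfolding e_def using s' by (intro trap_one) auto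
        have "EE (s0 - 4) * exp (- 2 * (s0 - 4) - 4) \<le> EE ?s * exp (- ?s - s0)"
          using s' EE_antimono[OF s'(2)] EE_pos[of ?s] by (intro mult_mono) auto
        also have "exp (- ?s - s0) = exp (- 2 * ?s) * exp (?s - s0)" by (simp add: exp_add[symmetric])
        finally have "(al ^ 3 / 8 * ?y) * (EE (s0 - 4) * exp (- 2 * (s0 - 4) - 4)) \<le>
            (al ^ 3 / 8 * ?y) * (EE ?s * (exp (- 2 * ?s) * exp (?s - s0)))"
          using y0 al3 by (intro mult_left_mono) auto
        then show ?thesis using True by (simp add: c1_def e mult_ac)
      next
        case False
        have "0 \<le> exp (- 2 * ?s) * ?y * (al ^ 3 / 8 * exp (?s - s0) * e ?s * EE ?s)"
          using al3 ed(4)[of ?s] EE_pos[of ?s]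
          by (intro mult_nonneg_nonneg[OF w0] mult_nonneg_nonneg) auto
        then show ?thesis using False by simp
      qed
      moreover have "exp (- 2 * ?s) * ?y * (CZ * al ^ 3 * (Mi sr * of_bool (?s < sr) + Mo * of_bool (?s > s0 - 3))) \<le> c2"
      proof -
        \<comment> \<open>The inner plateau reaches down to sr - 3, whence the 6.\<close>
        have a: "exp (- 2 * ?s) * ?y * (Mi sr * of_bool (?s < sr)) \<le> Mi sr * exp (- 2 * sr + 6) * Mu\<^sup>2"
        proof (cases "?s < sr")
          case True
          have "exp (- 2 * ?s) * ?y \<le> exp (- 2 * sr + 6) * Mu\<^sup>2"
            using s yM[OF True] y0 by (intro mult_mono) auto
          from mult_left_mono[OF this M_nonneg(1)[of sr]] show ?thesis using True by (simp add: mult_ac)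
        qed (use t2 in simp)
        have b: "exp (- 2 * ?s) * ?y * (Mo * of_bool (?s > s0 - 3)) \<le> Mo * exp (- 2 * (s0 - 4)) * K0\<^sup>2"
        proof (cases "?s > s0 - 3")
          case True
          have "exp (- 2 * ?s) * ?y \<le> exp (- 2 * (s0 - 4)) * K0\<^sup>2"
            using True yK y0 by (intro mult_mono) auto
          from mult_left_mono[OF this M_nonneg(2)] show ?thesis using True by (simp add: mult_ac)
        qed (use t2 in simp)
        have "exp (- 2 * ?s) * ?y * (Mi sr * of_bool (?s < sr) + Mo * of_bool (?s > s0 - 3))
            \<le> Mi sr * exp (- 2 * sr + 6) * Mu\<^sup>2 + Mo * exp (- 2 * (s0 - 4)) * K0\<^sup>2"
          using a b by (simp only: distrib_left)
        from mult_left_mono[OF this CZa] show ?thesis unfolding c2_def by (simp only: mult_ac)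
      qed
      ultimately have "c1 * (indicator (shell sr (s0 - 4)) p * ?y) - c2 \<le> exp (- 2 * ?s) * ?y * N ?s"
        unfolding right_diff_distrib[of "exp (- 2 * ?s) * ?y"] by argo
      then show ?thesis unfolding mv using big by simp
    qed
  qed
  have Ji: "integrable lborel (\<lambda>p. indicator (shell sr (s0 - 4)) p * (psi p * (v p)\<^sup>2))"
  proof (rule Bochner_Integration.integrable_bound[OF sqiD(2)[OF vS]])
    show "AE p in lborel. norm (indicator (shell sr (s0 - 4)) p * (psi p * (v p)\<^sup>2)) \<le> norm (indicator ?S p * (v p)\<^sup>2)"
    proof (rule AE_I2)
      fix p
      show "norm (indicator (shell sr (s0 - 4)) p * (psi p * (v p)\<^sup>2)) \<le> norm (indicator ?S p * (v p)\<^sup>2)"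
      proof (cases "p \<in> shell sr (s0 - 4)")
        case True
        then have "p \<noteq> 0" "p \<in> ?S" by (auto simp: shell_def)
        then show ?thesis using True psi_le_1[of p] psi_nonneg[of p] by (simp add: abs_mult mult_left_le_one_le)
      qed simp
    qed
  qed measurable
  let ?J = "LINT p|lborel. indicator (shell sr (s0 - 4)) p * (psi p * (v p)\<^sup>2)"
  have "(LINT p|lborel. c1 * (indicator (shell sr (s0 - 4)) p * (psi p * (v p)\<^sup>2)) - c2 * indicator bigball p)
      \<le> (LINT p|lborel. mm p * rad N p * (v p)\<^sup>2)"
    by (rule integral_mono_AE[OF _ iN pw]) (use Ji bigball_integrable in simp)
  then have "c1 * ?J - c2 * vol \<le> 0"
    using N0 Ji bigball_integrable by (simp add: vol_def)
  then have J: "?J \<le> c2 * vol / c1" using c1 by (simp add: field_simps)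
  define E where "E = EE (s0 - 4)"
  have E: "E > 0" unfolding E_def by (rule EE_pos)
  \<comment> \<open>L + 2 is the distance from sr - 2 to s0 - 4.\<close>
  have E1: "EE (sr - 2) \<le> E * exp (2 * al * (L + 2))"
    using EE_ratio(2)[of "sr - 2" "s0 - 4"] sr unfolding E_def L_def by (simp add: algebra_simps)
  \<comment> \<open>This factor exp (-2 al) is the gain that beats the outer cutoff.\<close>
  have E2: "EE (s0 - 2) \<le> E * exp (- 2 * al)"
    using EE_ratio(1)[of "s0 - 4" "s0 - 2"] unfolding E_def by (simp add: mult.commute)
  have "Mi sr * exp (- 2 * sr + 6) * Mu\<^sup>2 \<le> (CM * al ^ 3 * (E * exp (2 * al * (L + 2)))) * exp (- 2 * sr + 6) * Mu\<^sup>2"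
    unfolding Mi_def using E1 CM_pos al3 by (intro mult_right_mono mult_left_mono) auto
  also have "\<dots> = CM * al ^ 3 * E * exp (- 2 * (s0 - 4)) * (exp (6 + 2 * L + 2 * al * (L + 2)) * Mu\<^sup>2)"
  proof -
    have "exp (2 * al * (L + 2)) * exp (- 2 * sr + 6) = exp (- 2 * (s0 - 4)) * exp (6 + 2 * L + 2 * al * (L + 2))"
      unfolding exp_add[symmetric] by (simp add: L_def algebra_simps)
    then show ?thesis by (simp add: mult_ac)
  qed
  finally have m1: "Mi sr * exp (- 2 * sr + 6) * Mu\<^sup>2 \<le> CM * al ^ 3 * E * exp (- 2 * (s0 - 4)) * (exp (6 + 2 * L + 2 * al * (L + 2)) * Mu\<^sup>2)" .
  have m2: "Mo * exp (- 2 * (s0 - 4)) * K0\<^sup>2 \<le> (CM * al ^ 3 * (E * exp (- 2 * al))) * exp (- 2 * (s0 - 4)) * K0\<^sup>2"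
    unfolding Mo_def using E2 CM_pos al3 by (intro mult_right_mono mult_left_mono) auto
  let ?T = "exp (6 + 2 * L + 2 * al * (L + 2)) * Mu\<^sup>2 + K0\<^sup>2 * exp (- 2 * al)"
  have "Mi sr * exp (- 2 * sr + 6) * Mu\<^sup>2 + Mo * exp (- 2 * (s0 - 4)) * K0\<^sup>2 \<le> CM * al ^ 3 * E * exp (- 2 * (s0 - 4)) * ?T"
    using m1 m2 by (simp add: distrib_left mult_ac)
  then have "c2 \<le> CZ * al ^ 3 * (CM * al ^ 3 * E * exp (- 2 * (s0 - 4)) * ?T)"
    unfolding c2_def by (rule mult_left_mono[OF _ CZa])
  also have "\<dots> = (8 * exp 4 * CZ * CM * al ^ 3 * ?T) * c1"
  proof -
    have "exp (- 2 * (s0 - 4)) = exp 4 * exp (- 2 * (s0 - 4) - 4)" by (simp add: exp_add[symmetric])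
    then show ?thesis unfolding c1_def E_def[symmetric] by (simp add: mult_ac)
  qed
  finally have "c2 * vol \<le> (8 * exp 4 * CZ * CM * al ^ 3 * ?T) * c1 * vol"
    by (rule mult_right_mono[OF _ vol_nonneg])
  then have "c2 * vol / c1 \<le> 8 * exp 4 * CZ * CM * al ^ 3 * ?T * vol"
    using c1 by (simp add: pos_divide_le_eq mult_ac)
  then show ?thesis using J by (simp add: mult_ac)
qed

end

section \<open>Choice of the parameters and the contradiction\<close>

context grushin begin

definition KC :: real where "KC = 8 * exp 4 * CZ * CM * vol"

lemma KC_nonneg: "KC \<ge> 0"
  unfolding KC_def using CZ_pos CM_pos vol_nonneg by simp

text \<open>The exponential beats the cube. I / 64 and I / 4 are any two bounds with sum below I;
  the condition with e^16 serves the absorption of the potential.\<close>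

lemma choose_constant:
  assumes "I > 0"
  obtains C3 where "C3 \<ge> 2" "4 * exp 16 \<le> C3"
    "\<And>al. al \<ge> C3 \<Longrightarrow> KC * (K0\<^sup>2 + 1) * (al ^ 3 * exp (- 2 * al)) \<le> I / 64"
    "\<And>al. al \<ge> C3 \<Longrightarrow> vol * exp (- 2 * al) \<le> I / 4"
proof -
  define B where "B = KC * (K0\<^sup>2 + 1) + vol + 1"
  have B: "B > 0" "KC * (K0\<^sup>2 + 1) \<le> B" "vol \<le> B"
    using KC_nonneg vol_nonneg by (auto simp: B_def add_nonneg_pos)
  have "I / (64 * B) > 0" using assms B by simp
  then have "\<forall>\<^sub>F x in at_top. x ^ 3 / exp x < I / (64 * B)"
    using order_tendstoD(2)[OF tendsto_power_div_exp_0[of 3]] by blast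
  then obtain C :: real where C: "\<And>x. x \<ge> C \<Longrightarrow> x ^ 3 / exp x < I / (64 * B)"
    unfolding eventually_at_top_linorder by auto
  define C3 where "C3 = max C (max 2 (4 * exp 16))"
  have key: "B * (x ^ 3 * exp (- 2 * x)) \<le> I / 64" and one: "1 \<le> x ^ 3" if "x \<ge> C3" for x
  proof -
    have x: "x \<ge> C" "x \<ge> 2" using that by (auto simp: C3_def)
    show "1 \<le> x ^ 3" using x by simp
    have "x ^ 3 * exp (- 2 * x) \<le> x ^ 3 * exp (- x)" using x by (intro mult_left_mono) auto
    also have "\<dots> = x ^ 3 / exp x" by (simp only: exp_minus divide_inverse)
    also have "\<dots> \<le> I / (64 * B)" by (rule less_imp_le[OF C[OF x(1)]])
    finally have "B * (x ^ 3 * exp (- 2 * x)) \<le> B * (I / (64 * B))"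
      by (rule mult_left_mono) (rule less_imp_le[OF B(1)])
    also have "\<dots> = I / 64" using B(1) by simp
    finally show "B * (x ^ 3 * exp (- 2 * x)) \<le> I / 64" .
  qed
  show ?thesis
  proof (rule that[of C3])
    fix al assume al: "al \<ge> C3"
    have "0 \<le> al ^ 3" using one[OF al] by linarith
    then have p: "0 \<le> al ^ 3 * exp (- 2 * al)" by (rule mult_nonneg_nonneg) simp
    show "KC * (K0\<^sup>2 + 1) * (al ^ 3 * exp (- 2 * al)) \<le> I / 64"
      using mult_right_mono[OF B(2) p] key[OF al] by (rule order_trans)
    have "vol * exp (- 2 * al) \<le> B * (al ^ 3 * exp (- 2 * al))"
    proof (rule mult_mono[OF B(3)])
      show "exp (- 2 * al) \<le> al ^ 3 * exp (- 2 * al)" using mult_right_mono[OF one[OF al], of "exp (- 2 * al)"] by simp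
    qed (use B in auto)
    then show "vol * exp (- 2 * al) \<le> I / 4" using key[OF al] assms by linarith
  qed (auto simp: C3_def)
qed

lemma angle_measurable: "(angle \<gamma> :: ('m, 'k) pt \<Rightarrow> real) \<in> borel_measurable borel"
proof -
  have [measurable]: "DD \<in> borel_measurable borel"
    by (rule borel_measurable_continuous_onI) (rule DD_continuous)
  have "angle \<gamma> = (\<lambda>p::('m, 'k) pt. WW p / (DD p powr (1 / (2 * kap))) powr (2 * \<gamma>))"
  proof
    fix p :: "('m, 'k) pt"
    show "angle \<gamma> p = WW p / (DD p powr (1 / (2 * kap))) powr (2 * \<gamma>)"
      unfolding gauge_DD[symmetric] by (cases p) (simp add: WW_def)
  qed
  then show ?thesis by simp
qed

text \<open>Under the contrary assumption the ball B_r contributes at most I / 4 to the integral I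
  over B_(R0/4), and the remaining shell at most I / 64 by \<open>key_estimate\<close>.\<close>

lemma lower_bound:
  fixes u V :: "('m, 'k) pt \<Rightarrow> real" and R K K0 I r C3 :: real
  defines "\<Omega> \<equiv> gauge_ball \<gamma> R :: ('m, 'k) pt set" and "R0 \<equiv> min 1 (R / 256)"
  assumes I: "I > 0" and K0: "K0 > 0" and R: "R > 0" and K: "K \<ge> 0"
    and C3: "C3 \<ge> 2" "4 * exp 16 \<le> C3"
      "\<And>al. al \<ge> C3 \<Longrightarrow> KC * (K0\<^sup>2 + 1) * (al ^ 3 * exp (- 2 * al)) \<le> I / 64"
      "\<And>al. al \<ge> C3 \<Longrightarrow> vol * exp (- 2 * al) \<le> I / 4"
    and u: "AE p in lebesgue_on \<Omega>. \<bar>u p\<bar> \<le> K0"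
    and V: "AE p in lebesgue_on \<Omega>. \<bar>V p\<bar> \<le> K * angle \<gamma> p"
    and sol: "is_solution \<gamma> \<Omega> V u"
    and uI: "(LINT p|lebesgue_on (gauge_ball \<gamma> (R0 / 4)). (u p)\<^sup>2 * angle \<gamma> p) = I"
    and r: "0 < r" "r < R0 / 9"
  shows "ereal (1 * (r / R0) powr ((5 + 5 * C3) / 2 * (K powr (2 / 3) + 1))) \<le> Linf_norm (gauge_ball \<gamma> r) u"
proof (rule ccontr)
  define k where "k = K powr (2 / 3)"
  define w where "w = (5 + 5 * C3) / 2 * (k + 1)"
  define Mu where "Mu = (r / R0) powr w"
  \<comment> \<open>Its cube is at least C3^3 (1 + K^2), which is what the absorption of the
    potential requires; this fixes the power 2/3.\<close>
  define al where "al = C3 * (k + 1)"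
  define s4 where "s4 = ln (R0 / 4)"
  define sr where "sr = ln r"
  define ly where "ly = ln (R0 / r)"
  let ?Br = "gauge_ball \<gamma> r :: ('m, 'k) pt set" and ?B = "gauge_ball \<gamma> (R0 / 4) :: ('m, 'k) pt set"
  assume "\<not> ?thesis"
  then have less: "Linf_norm ?Br u < ereal Mu" by (simp add: Mu_def w_def k_def)
  have R0: "R0 > 0" "R0 \<le> 1" "R0 \<le> R / 256" using R by (auto simp: R0_def)
  have k0: "k \<ge> 0" by (simp add: k_def)
  have al3: "al \<ge> C3" using k0 C3(1) by (simp add: al_def algebra_simps)
  have e3: "exp (1::real) \<le> 3" by (rule exp_le)
  have "exp 6 = exp (1::real) ^ 6" by (simp add: exp_of_nat_mult[symmetric])
  also have "\<dots> \<le> 3 ^ 6" using e3 by (intro power_mono) auto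
  finally have e6: "exp (6::real) \<le> 729" by simp
  have "exp 2 = exp (1::real) ^ 2" by (simp add: exp_of_nat_mult[symmetric])
  also have "\<dots> \<le> 3 ^ 2" using e3 by (intro power_mono) auto
  finally have e2: "exp (2::real) \<le> 9" by simp
  \<comment> \<open>The shell ends at s4 = s0 - 4, and s0 + 2 must stay below ln R: e^6 \<le> 729
    while R0 / 4 \<le> R / 1024.\<close>
  have s06: "s4 + 4 + 2 < ln R"
  proof -
    have "R0 / 4 * exp 6 \<le> R0 / 4 * 729" using R0 e6 by (intro mult_left_mono) auto
    then have "R0 / 4 * exp 6 < R" using R0 R by linarith
    moreover have "exp (s4 + 6) = R0 / 4 * exp 6" using R0 by (simp add: s4_def exp_add)
    ultimately have "exp (s4 + 6) < exp (ln R)" using R by simp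
    then show ?thesis by simp
  qed
  have s4: "s4 \<le> 0" using R0 by (simp add: s4_def)
  have sr: "sr \<le> s4" unfolding sr_def s4_def using r R0 by (subst ln_le_cancel_iff) auto
  \<comment> \<open>The condition r < R0 / 9 enters here, as e^2 \<le> 9.\<close>
  have ly: "ly \<ge> 2"
  proof -
    have "9 < R0 / r" using r by (simp add: field_simps)
    then have "exp 2 \<le> R0 / r" using e2 by linarith
    then have "ln (exp 2) \<le> ln (R0 / r)" using r R0 by (subst ln_le_cancel_iff) auto
    then show ?thesis by (simp add: ly_def)
  qed
  have L: "s4 - sr \<le> ly" "s4 - sr \<ge> 0"
    using r R0 sr by (auto simp: s4_def sr_def ly_def ln_div)
  have Mu: "Mu = exp (- w * ly)"
    using r R0 by (simp add: Mu_def powr_def ly_def ln_div algebra_simps)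
  have K3: "k ^ 3 = K\<^sup>2"
  proof -
    have "k ^ 3 = k powr 3" using powr_numeral[OF k0, of "num.Bit1 num.One"] by simp
    also have "\<dots> = K powr 2" by (simp add: k_def powr_powr)
    also have "\<dots> = K\<^sup>2" using powr_numeral[OF K, of "num.Bit0 num.One"] by simp
    finally show ?thesis .
  qed
  have alK: "4 * exp 16 * (1 + K\<^sup>2) \<le> al ^ 3"
  proof -
    have "1 + K\<^sup>2 \<le> (k + 1) ^ 3" unfolding K3[symmetric] using k0 by (simp add: power3_eq_cube algebra_simps)
    moreover have "4 * exp 16 \<le> C3 ^ 3"
      using C3(1,2) power_increasing[of 1 3 C3] by (auto intro: order_trans)
    ultimately have "4 * exp 16 * (1 + K\<^sup>2) \<le> C3 ^ 3 * (k + 1) ^ 3"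
      using C3(1) by (intro mult_mono) auto
    then show ?thesis by (simp add: al_def power_mult_distrib)
  qed
  obtain f f1 f2 v g where D: "\<And>n::nat. C2 (f n) (f1 n) (f2 n)"
    "v \<in> borel_measurable borel" "AE p in lebesgue. p \<in> \<Omega> \<longrightarrow> v p = u p" "\<And>p. \<bar>v p\<bar> \<le> K0"
    "sqi \<Omega> v" "sqi \<Omega> g" "(\<lambda>n. nsq \<Omega> (\<lambda>p. f n p - v p)) \<longlonglongrightarrow> 0"
    "(\<lambda>n. nsq \<Omega> (\<lambda>p. BB (f2 n) p - g p)) \<longlonglongrightarrow> 0"
    "\<And>p. p \<noteq> 0 \<Longrightarrow> K \<ge> 0 \<Longrightarrow> \<bar>g p\<bar> \<le> K * (WW p * exp (- 2 * \<gamma> * lg p)) * \<bar>v p\<bar>"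
    "u \<in> borel_measurable (lebesgue_on \<Omega>)"
    using solution_representatives[of R K0 V u K, OF R less_imp_le[OF K0] sol[unfolded \<Omega>_def] V[unfolded \<Omega>_def] u[unfolded \<Omega>_def], folded \<Omega>_def]
    by blast
  note [measurable] = D(2)
  have sub: "?Br \<subseteq> \<Omega>" "?B \<subseteq> \<Omega>"
    unfolding \<Omega>_def gauge_ball_def using r R0 R by auto
  have Bm: "?Br \<in> sets borel" "?B \<in> sets borel" using gauge_ball_measurable r R0 by auto
  have uB: "u \<in> borel_measurable (lebesgue_on ?Br)" "u \<in> borel_measurable (lebesgue_on ?B)"
    using measurable_restrict_mono[OF D(10)] sub by auto
  have "AE p in lebesgue_on ?Br. ereal \<bar>u p\<bar> \<le> Linf_norm ?Br u"
    unfolding Linf_norm_def by (rule esssup_AE)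
  then have "AE p in lebesgue_on ?Br. \<bar>u p\<bar> \<le> Mu"
    by eventually_elim (use less in \<open>metis ereal_less_eq(3) less_imp_le order_trans\<close>)
  then have "AE p in lebesgue. p \<in> ?Br \<longrightarrow> \<bar>u p\<bar> \<le> Mu"
    using Bm by (subst (asm) AE_restrict_space_iff) auto
  then have "AE p in lebesgue. p \<in> ?Br \<longrightarrow> \<bar>v p\<bar> \<le> Mu"
    using D(3) by eventually_elim (use sub in auto)
  then have "AE p in lebesgue. p \<noteq> 0 \<and> lg p < sr \<longrightarrow> \<bar>v p\<bar> \<le> Mu"
    by eventually_elim (use r in \<open>auto simp: mem_gauge_ball sr_def\<close>)
  then have MuAE: "AE p in lborel. p \<noteq> 0 \<and> lg p < sr \<longrightarrow> \<bar>v p\<bar> \<le> Mu"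
    by (simp only: AE_completion_iff)
  interpret P: carleman_profile \<gamma> dims al "s4 + 4"
    by unfold_locales (use al3 C3 in linarith)
  let ?J = "LINT p|lborel. indicator (shell sr s4) p * (psi p * (v p)\<^sup>2)"
  let ?X = "exp (6 + 2 * (s4 - sr) + 2 * al * (s4 - sr + 2))"
  have J: "?J \<le> KC * al ^ 3 * (?X * Mu\<^sup>2 + K0\<^sup>2 * exp (- 2 * al))"
  proof -
    have "(LINT p|lborel. indicator (shell sr (s4 + 4 - 4)) p * (psi p * (v p)\<^sup>2))
      \<le> 8 * exp 4 * CZ * CM * vol * al ^ 3 * (exp (6 + 2 * (s4 + 4 - 4 - sr) + 2 * al * (s4 + 4 - 4 - sr + 2)) * Mu\<^sup>2 + K0\<^sup>2 * exp (- 2 * al))"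
    proof (rule P.key_estimate[OF R _ K D(1) _ _ _ _ D(9)[OF _ K] _ _ _ alK D(4) MuAE])
      show "sqi (gauge_ball \<gamma> R) v" "sqi (gauge_ball \<gamma> R) g"
        "(\<lambda>n. nsq (gauge_ball \<gamma> R) (\<lambda>p. f n p - v p)) \<longlonglongrightarrow> 0"
        "(\<lambda>n. nsq (gauge_ball \<gamma> R) (\<lambda>p. BB (f2 n) p - g p)) \<longlonglongrightarrow> 0"
        using D(5-8) unfolding \<Omega>_def by auto
    qed (use s06 sr s4 al3 C3 in auto)
    then show ?thesis by (simp add: KC_def)
  qed
  have al0: "al \<ge> 2" using al3 C3 by linarith
  have w2: "(5 + 5 * al) * ly \<le> 2 * w * ly"
  proof (rule mult_right_mono)
    have "2 * w = 5 * (k + 1) + 5 * al" by (simp add: w_def al_def algebra_simps)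
    then show "5 + 5 * al \<le> 2 * w" using k0 by simp
  qed (use ly in simp)
  have Mu2: "Mu\<^sup>2 = exp (- (2 * w * ly))"
    unfolding Mu by (simp add: power2_eq_square exp_add[symmetric])
  have aly: "2 * al \<le> al * ly" using mult_left_mono[OF ly, of al] al0 by simp
  \<comment> \<open>The constant terms 6 and 6 al are paid for by 3 ly and 3 al ly, since ly is at
    least 2; with the 2 ly and 2 al ly already present this gives the fives in the exponent.\<close>
  have "2 * al + (6 + 2 * (s4 - sr) + 2 * al * (s4 - sr + 2)) \<le> (5 + 5 * al) * ly"
  proof -
    have a: "al * (s4 - sr) \<le> al * ly" using L al0 by (intro mult_left_mono) auto
    have "2 * al * (s4 - sr + 2) = 2 * (al * (s4 - sr)) + 4 * al" "(5 + 5 * al) * ly = 5 * ly + 5 * (al * ly)"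
      by (simp_all add: algebra_simps)
    then show ?thesis using a aly L ly by argo
  qed
  then have "2 * al + (6 + 2 * (s4 - sr) + 2 * al * (s4 - sr + 2)) - 2 * w * ly \<le> 0" using w2 by linarith
  then have X1: "exp (2 * al) * ?X * Mu\<^sup>2 \<le> 1"
    unfolding Mu2 exp_add[symmetric] by simp
  have Mu3: "Mu\<^sup>2 \<le> exp (- 2 * al)"
  proof -
    have "(5 + 5 * al) * ly = 5 * ly + 5 * (al * ly)" by (simp add: algebra_simps)
    then have "2 * al \<le> (5 + 5 * al) * ly" using aly al0 ly by argo
    then show ?thesis unfolding Mu2 using w2 by simp
  qed
  \<comment> \<open>A factor exp (2 al) is inserted next to Mu^2, so that both terms of the estimate
    become multiples of \<open>q\<close>.\<close>
  define q where "q = KC * (al ^ 3 * exp (- 2 * al))"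
  have q0: "q \<ge> 0" unfolding q_def using KC_nonneg al0 by simp
  have "(K0\<^sup>2 + 1) * q \<le> I / 64" using C3(3)[OF al3] by (simp add: q_def mult_ac)
  then have q: "q + K0\<^sup>2 * q \<le> I / 64" by (simp add: algebra_simps)
  have "KC * al ^ 3 * (?X * Mu\<^sup>2 + K0\<^sup>2 * exp (- 2 * al)) = q * (exp (2 * al) * ?X * Mu\<^sup>2) + K0\<^sup>2 * q"
  proof -
    have e: "exp (- 2 * al) * exp (2 * al) = 1" by (simp add: exp_add[symmetric])
    have "q * (exp (2 * al) * ?X * Mu\<^sup>2) = KC * al ^ 3 * (?X * Mu\<^sup>2) * (exp (- 2 * al) * exp (2 * al))"
      by (simp only: q_def mult_ac)
    then show ?thesis unfolding e by (simp add: q_def algebra_simps)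
  qed
  also have "\<dots> \<le> q * 1 + K0\<^sup>2 * q" using X1 q0 by (intro add_mono mult_left_mono) auto
  finally have J2: "?J \<le> I / 64" using J q by simp
  have psiv: "psi p * (v p)\<^sup>2 \<le> K0\<^sup>2" "psi p * (v p)\<^sup>2 \<le> (v p)\<^sup>2" if "p \<noteq> 0" for p
  proof -
    show a: "psi p * (v p)\<^sup>2 \<le> (v p)\<^sup>2" using psi_le_1[OF that] mult_right_mono[of "psi p" 1 "(v p)\<^sup>2"] by simp
    have "(v p)\<^sup>2 \<le> K0\<^sup>2" using D(4)[of p] power_mono[of "\<bar>v p\<bar>" K0 2] by simp
    then show "psi p * (v p)\<^sup>2 \<le> K0\<^sup>2" using a by linarith
  qed
  have int: "integrable lborel (\<lambda>p. indicator A p * (psi p * (v p)\<^sup>2))"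
    if A: "A \<in> sets borel" "\<And>p. p \<in> A \<Longrightarrow> p \<noteq> 0 \<Longrightarrow> lg p \<le> s4" for A
  proof (rule Bochner_Integration.integrable_bound)
    show "integrable lborel (\<lambda>p. K0\<^sup>2 * indicator bigball p)" using bigball_integrable by simp
    show "AE p in lborel. norm (indicator A p * (psi p * (v p)\<^sup>2)) \<le> norm (K0\<^sup>2 * indicator bigball p)"
      using AE_lborel_singleton[of 0]
    proof eventually_elim
      case (elim p)
      then show ?case using psiv(1)[of p] psi_nonneg[of p] A(2)[of p] s4 bigball[of p]
        by (cases "p \<in> A") auto
    qed
  qed (use A in measurable)
  have i1: "integrable lborel (\<lambda>p. indicator ?B p * (psi p * (v p)\<^sup>2))"
    by (rule int[OF Bm(2)]) (auto simp: mem_gauge_ball s4_def)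
  have i2: "integrable lborel (\<lambda>p. indicator (shell sr s4) p * (psi p * (v p)\<^sup>2))"
    by (rule int[OF shell_measurable]) (auto simp: shell_def)
  have "I = (LINT p|lborel. indicator ?B p * (psi p * (v p)\<^sup>2))"
    unfolding uI[symmetric]
  proof (rule lebesgue_on_integral_representative(1)[OF Bm(2)])
    have "angle \<gamma> \<in> borel_measurable (lebesgue_on ?B)"
      using angle_measurable by (intro measurable_restrict_space1 measurable_completion) simp
    then show "(\<lambda>p. (u p)\<^sup>2 * angle \<gamma> p) \<in> borel_measurable (lebesgue_on ?B)"
      using uB(2) by measurable
    show "(\<lambda>p. psi p * (v p)\<^sup>2) \<in> borel_measurable borel" by measurable
    show "AE p in lebesgue. p \<in> ?B \<longrightarrow> psi p * (v p)\<^sup>2 = (u p)\<^sup>2 * angle \<gamma> p"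
      using D(3) AE_nonzero
    proof eventually_elim
      case (elim p)
      then show ?case using sub angle_eq[of p] by (auto simp: psi_def simp del: angle.simps)
    qed
  qed
  \<comment> \<open>The ball B_(R0/4) splits at gauge radius r; on the inner part \<psi> \<le> 1 and
    the assumed smallness of u are used.\<close>
  also have "\<dots> \<le> (LINT p|lborel. indicator (shell sr s4) p * (psi p * (v p)\<^sup>2) + Mu\<^sup>2 * indicator bigball p)"
  proof (rule integral_mono_AE[OF i1])
    show "integrable lborel (\<lambda>p. indicator (shell sr s4) p * (psi p * (v p)\<^sup>2) + Mu\<^sup>2 * indicator bigball p)"
      using i2 bigball_integrable by simp
    show "AE p in lborel. indicator ?B p * (psi p * (v p)\<^sup>2)
        \<le> indicator (shell sr s4) p * (psi p * (v p)\<^sup>2) + Mu\<^sup>2 * indicator bigball p"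
      using MuAE AE_lborel_singleton[of 0]
    proof eventually_elim
      case (elim p)
      have nn: "0 \<le> psi p * (v p)\<^sup>2" using psi_nonneg[of p] by simp
      show ?case
      proof (cases "p \<in> ?B")
        case True
        then have l: "lg p < s4" using elim by (simp add: mem_gauge_ball s4_def)
        show ?thesis
        proof (cases "lg p < sr")
          case True
          then have "(v p)\<^sup>2 \<le> Mu\<^sup>2" using elim power_mono[of "\<bar>v p\<bar>" Mu 2] by simp
          then have "psi p * (v p)\<^sup>2 \<le> Mu\<^sup>2" using psiv(2)[of p] elim by linarith
          moreover have "p \<in> bigball" using bigball[of p] elim l s4 by simp
          ultimately show ?thesis using nn by (simp add: indicator_def)
        next
          case False
          then have "p \<in> shell sr s4" using l elim by (simp add: shell_def)
          then show ?thesis using True by (simp add: indicator_def)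
        qed
      qed (use nn in \<open>simp add: indicator_def\<close>)
    qed
  qed
  also have "\<dots> = ?J + Mu\<^sup>2 * vol" using i2 bigball_integrable by (simp add: vol_def)
  also have "\<dots> \<le> I / 64 + I / 4"
  proof -
    have "Mu\<^sup>2 * vol \<le> exp (- 2 * al) * vol" by (rule mult_right_mono[OF Mu3 vol_nonneg])
    then show ?thesis using C3(4)[OF al3] J2 by (simp add: mult.commute)
  qed
  finally show False using I by linarith
qed

end

theorem theorem1p3:
  fixes \<gamma> :: real
  assumes "\<gamma> > 0"
  shows "\<exists>R0 :: real \<Rightarrow> real. (\<forall>R>0. 0 < R0 R \<and> R0 R \<le> R / 2) \<and>
    (\<forall>K0>0. \<forall>I>0. \<exists>C1>0. \<exists>C2>0.
      \<forall>R>0. \<forall>K\<ge>0. \<forall>(u :: ('m::finite, 'k::finite) pt \<Rightarrow> real) (V :: ('m, 'k) pt \<Rightarrow> real).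
        u \<in> S22 \<gamma> (gauge_ball \<gamma> R) \<longrightarrow>
        (AE p in lebesgue_on (gauge_ball \<gamma> R). \<bar>u p\<bar> \<le> K0) \<longrightarrow>
        (AE p in lebesgue_on (gauge_ball \<gamma> R). \<bar>V p\<bar> \<le> K * angle \<gamma> p) \<longrightarrow>
        is_solution \<gamma> (gauge_ball \<gamma> R) V u \<longrightarrow>
        (LINT p|lebesgue_on (gauge_ball \<gamma> (R0 R / 4)). (u p)\<^sup>2 * angle \<gamma> p) = I \<longrightarrow>
        (\<forall>r. 0 < r \<and> r < R0 R / 9 \<longrightarrow>
          ereal (C1 * (r / R0 R) powr (C2 * (K powr (2 / 3) + 1)))
            \<le> Linf_norm (gauge_ball \<gamma> r) u))"
proof -
  interpret grushin \<gamma> "TYPE('m \<times> 'k)" by unfold_locales (rule assms)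
  \<comment> \<open>The minimum with 1 gives R0 / 4 < 1, hence s0 \<le> 4, and keeps all constants
    independent of R; 256 leaves the room for cutoffs and translates.\<close>
  show ?thesis
  proof (rule exI[of _ "\<lambda>R. min 1 (R / 256)"], intro conjI allI impI)
    fix K0 I :: real assume K0: "K0 > 0" and I: "I > 0"
    obtain C3 where C3: "C3 \<ge> 2" "4 * exp 16 \<le> C3"
      "\<And>al. al \<ge> C3 \<Longrightarrow> KC * (K0\<^sup>2 + 1) * (al ^ 3 * exp (- 2 * al)) \<le> I / 64"
      "\<And>al. al \<ge> C3 \<Longrightarrow> vol * exp (- 2 * al) \<le> I / 4"
      by (rule choose_constant[OF I, of K0]) (rule that)
    show "\<exists>C1>0. \<exists>C2>0.
      \<forall>R>0. \<forall>K\<ge>0. \<forall>(u :: ('m, 'k) pt \<Rightarrow> real) (V :: ('m, 'k) pt \<Rightarrow> real).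
        u \<in> S22 \<gamma> (gauge_ball \<gamma> R) \<longrightarrow>
        (AE p in lebesgue_on (gauge_ball \<gamma> R). \<bar>u p\<bar> \<le> K0) \<longrightarrow>
        (AE p in lebesgue_on (gauge_ball \<gamma> R). \<bar>V p\<bar> \<le> K * angle \<gamma> p) \<longrightarrow>
        is_solution \<gamma> (gauge_ball \<gamma> R) V u \<longrightarrow>
        (LINT p|lebesgue_on (gauge_ball \<gamma> (min 1 (R / 256) / 4)). (u p)\<^sup>2 * angle \<gamma> p) = I \<longrightarrow>
        (\<forall>r. 0 < r \<and> r < min 1 (R / 256) / 9 \<longrightarrow>
          ereal (C1 * (r / min 1 (R / 256)) powr (C2 * (K powr (2 / 3) + 1)))
            \<le> Linf_norm (gauge_ball \<gamma> r) u)"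
    \<comment> \<open>\<open>C1\<close> can be 1, because the dependence on \<open>K0\<close> and
      \<open>I\<close> is carried entirely by the exponent through \<open>C3\<close>.\<close>
    proof (rule exI[of _ 1], rule conjI[OF zero_less_one], rule exI[of _ "(5 + 5 * C3) / 2"],
        intro conjI allI impI)
      show "0 < (5 + 5 * C3) / 2" using C3(1) by simp
    qed (rule lower_bound[OF I K0 _ _ C3]; blast)
  qed auto
qed

end
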